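(* Let $a,b,z>0$ be real numbers, let $F(a,b,z)$ be the free energy of the monopole-dimer model on the square grid with edge weights $a,b$ and vertex weights $z$, and let $\rho_z=z\,\frac{\partial}{\partial z}F(a,b,z)$ be the monopole density. Then $$\rho_z=\frac{z^2\,k\,K(k)}{2\pi ab},\qquad k=\frac{4ab}{\sqrt{(4a^2+z^2)(4b^2+z^2)}},$$ where $K(k)=\int_0^{\pi/2}\frac{dt}{\sqrt{1-k^2\sin^2t}}$ is the complete elliptic integral of the first kind with modulus $k$.
   Context: The free energy is $$F(a,b,z)=\lim_{\substack{m,n\to\infty\\ m,n\text{ even}}}\frac1{mn}\ln Z_{m,n},$$ where $Z_{m,n}$ is the partition function of the monopole-dimer model on the grid graph $Q_{m,n}$, defined as follows. Grid graph: $Q_{m,n}$ has vertex set $\{(i,j): 1\le i\le m,\ 1\le j\le n\}$ with its standard planar embedding as points of $\mathbb{Z}^2$. Edges $\{(i,j),(i,j+1)\}$ have weight $a$, edges $\{(i,j),(i+1,j)\}$ have weight $b$, and every vertex has weight $z$. Monopole-dimer configuration on a plane graph $G=[V,E]$: a collection $C$ of pairwise vertex-disjoint directed loops of even length in $G$, where a loop of length $2$ is a doubled edge (exactly one such loop for each edge) and a loop of length $2k\ge4$ is a directed simple cycle (so each undirected cycle gives two distinct directed loops). Every vertex is either isolated (a monopole) or belongs to exactly one loop. Weights: the weight of a loop $\ell$ is $w(\ell)=(-1)^{N(\ell)}$ times the product of the weights of the edges traversed by $\ell$ (for a doubled edge, the square of the edge weight), where $N(\ell)$ is the number of vertices of $V$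 strictly enclosed by $\ell$. The weight $w(C)$ is the product of $w(\ell)$ over the loops $\ell$ of $C$ and of the vertex weights over the isolated vertices of $C$. The partition function is $Z=\sum_C w(C)$, summed over all monopole-dimer configurations. *)

theory Defs
  imports "HOL-Analysis.Analysis"
begin

section \<open>The monopole-dimer model on a weighted plane graph\<close>

text \<open>Edges are two-element sets of vertices, drawn as the straight segments joining the
  positions of their endpoints in the complex plane.\<close>

record 'v weighted_plane_graph =
  vertices :: "'v set"
  edges :: "'v set set"
  position :: "'v \<Rightarrow> complex"
  edge_weight :: "'v set \<Rightarrow> real"
  vertex_weight :: "'v \<Rightarrow> real"

definition cyclic_arcs :: "'v list \<Rightarrow> ('v \<times> 'v) set" where
  "cyclic_arcs vs = set (zip vs (rotate1 vs))"

text \<open>A directed loop is identified with its set of arcs. This forgets the starting point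
  but not the direction: an edge \<open>{u, v}\<close> gives the single loop \<open>{(u, v), (v, u)}\<close>
  of length 2, whereas a cycle of length at least 4 gives two loops.\<close>

definition directed_loops :: "('v, 'b) weighted_plane_graph_scheme \<Rightarrow> ('v \<times> 'v) set set" where
  "directed_loops G = {cyclic_arcs vs | vs.
     distinct vs \<and> even (length vs) \<and> 2 \<le> length vs \<and> set vs \<subseteq> vertices G \<and>
     (\<forall>(u, v) \<in> cyclic_arcs vs. {u, v} \<in> edges G)}"

definition loop_vertices :: "('v \<times> 'v) set \<Rightarrow> 'v set" where
  "loop_vertices l = fst ` l"

definition loop_curve ::
    "('v, 'b) weighted_plane_graph_scheme \<Rightarrow> ('v \<times> 'v) set \<Rightarrow> complex set" where
  "loop_curve G l = (\<Union>(u, v) \<in> l. closed_segment (position G u) (position G v))"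

text \<open>The set \<open>inside S\<close> consists of the points off \<open>S\<close> that lie in a bounded component of
  the complement of \<open>S\<close>; for a doubled edge it is empty.\<close>

definition enclosed_count ::
    "('v, 'b) weighted_plane_graph_scheme \<Rightarrow> ('v \<times> 'v) set \<Rightarrow> nat" where
  "enclosed_count G l = card {v \<in> vertices G. position G v \<in> inside (loop_curve G l)}"

definition loop_weight ::
    "('v, 'b) weighted_plane_graph_scheme \<Rightarrow> ('v \<times> 'v) set \<Rightarrow> real" where
  "loop_weight G l = (- 1) ^ enclosed_count G l * (\<Prod>(u, v) \<in> l. edge_weight G {u, v})"

definition monopole_dimer_configurations ::
    "('v, 'b) weighted_plane_graph_scheme \<Rightarrow> ('v \<times> 'v) set set set" where
  "monopole_dimer_configurations G =
     {C. C \<subseteq> directed_loops G \<and> disjoint_family_on loop_vertices C}"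

definition monopoles ::
    "('v, 'b) weighted_plane_graph_scheme \<Rightarrow> ('v \<times> 'v) set set \<Rightarrow> 'v set" where
  "monopoles G C = vertices G - (\<Union>l \<in> C. loop_vertices l)"

definition configuration_weight ::
    "('v, 'b) weighted_plane_graph_scheme \<Rightarrow> ('v \<times> 'v) set set \<Rightarrow> real" where
  "configuration_weight G C =
     (\<Prod>l \<in> C. loop_weight G l) * (\<Prod>v \<in> monopoles G C. vertex_weight G v)"

definition partition_function :: "('v, 'b) weighted_plane_graph_scheme \<Rightarrow> real" where
  "partition_function G = (\<Sum>C \<in> monopole_dimer_configurations G. configuration_weight G C)"

section \<open>Grid graphs and the free energy\<close>

definition grid_vertices :: "nat \<Rightarrow> nat \<Rightarrow> (nat \<times> nat) set" where
  "grid_vertices m n = {1..m} \<times> {1..n}"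

definition grid_graph ::
    "nat \<Rightarrow> nat \<Rightarrow> real \<Rightarrow> real \<Rightarrow> real \<Rightarrow> (nat \<times> nat) weighted_plane_graph" where
  "grid_graph m n a b z =
     \<lparr> vertices = grid_vertices m n,
       edges = {e. e \<subseteq> grid_vertices m n \<and>
                   (\<exists>i j. e = {(i, j), (i, j + 1)} \<or> e = {(i, j), (i + 1, j)})},
       position = (\<lambda>(i, j). Complex (real i) (real j)),
       edge_weight = (\<lambda>e. if \<exists>i j. e = {(i, j), (i, j + 1)} then a else b),
       vertex_weight = (\<lambda>_. z) \<rparr>"

definition both_even_to_infinity :: "(nat \<times> nat) filter" where
  "both_even_to_infinity =
     inf (at_top \<times>\<^sub>F at_top) (principal {(m, n). even m \<and> even n})"

definition finite_free_energy :: "real \<Rightarrow> real \<Rightarrow> real \<Rightarrow> nat \<times> nat \<Rightarrow> real" where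
  "finite_free_energy a b z =
     (\<lambda>(m, n). 1 / (real m * real n) * ln (partition_function (grid_graph m n a b z)))"

definition free_energy :: "real \<Rightarrow> real \<Rightarrow> real \<Rightarrow> real" where
  "free_energy a b z = Lim both_even_to_infinity (finite_free_energy a b z)"

definition monopole_density :: "real \<Rightarrow> real \<Rightarrow> real \<Rightarrow> real" where
  "monopole_density a b z = z * deriv (\<lambda>x. free_energy a b x) z"

definition elliptic_K :: "real \<Rightarrow> real" where
  "elliptic_K k = integral {0..pi/2} (\<lambda>t. 1 / sqrt (1 - k\<^sup>2 * (sin t)\<^sup>2))"

end

(*
  On a lattice, orient the edges by the Kasteleyn signs: steps in the first coordinate get b, steps in
  the second coordinate get (-1)^i a, antisymmetrically, and the diagonal carries z.  The nonzero terms
  of the determinant are the permutations moving along edges, i.e. the loop configurations, and the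
  sign of a cycle is minus (-1) to the number of enclosed vertices.  The latter is Pick's theorem modulo 2:
  the signed area is the sum of the winding numbers around the unit cells attached to all lattice points,
  and the contribution of the points on the cycle itself is determined by the turning number, which is
  odd by a discrete form of Hopf's secant argument.

  The two directional pieces of the off-diagonal part X anticommute, so (z + X)(z - X) is diagonalised
  by products of sines, up to powers of the imaginary unit.  Hence Z^2 is an explicit product and the free energy is a double integral of a
  logarithm.  Its z-derivative is evaluated by the substitution tan phi = kappa tan theta.
*)

theory Submission
  imports Defs "HOL-Combinatorics.Cycles" "HOL-Complex_Analysis.Winding_Numbers" "Jordan_Normal_Form.Determinant"
begin

text \<open>The obstacle is that \<open>enclosed_count\<close> refers to a topological interior,
  while the Kasteleyn signs are local. The bridge is the integer \<open>wind\<close>, a count of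
  signed crossings of a horizontal ray that starts at a cell centre and so misses every vertex. The
  same ray is the branch cut of a logarithm, which identifies \<open>wind\<close> with the analytic
  winding number; the Jordan curve theorem then lets its parity decide interiority. Both the
  variation of \<open>wind\<close> along the polygon and the total turning come from one cochain on
  pairs of indices that is closed except near the diagonal.

  Multiplying by the transpose determines only Z^2. The sign of Z is settled by shrinking the edge
  weights to 0: for z > 0 the product formula keeps the determinant away from 0 throughout.

  The modulus k appears once the inner integral has been evaluated: after the substitution the
  remaining radicand is a square times 1 - k^2 (cos phi)^2.\<close>

section \<open>Lattice polygons and Pick's theorem modulo 2\<close>

text \<open>Signed crossing of the ray \<open>{(e, 1/2) | e > 0}\<close> by a unit step from \<open>(e, f)\<close> to height \<open>f'\<close>.
  Only vertical steps can cross it, so the new abscissa is not recorded.\<close>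

definition ray_crossing :: "int \<Rightarrow> int \<Rightarrow> int \<Rightarrow> int" where
  "ray_crossing e f f' = of_bool (e > 0 \<and> f = 0 \<and> f' = 1) - of_bool (e > 0 \<and> f = 1 \<and> f' = 0)"

definition unit_steps :: "(int \<times> int) set" where
  "unit_steps = {(1, 0), (-1, 0), (0, 1), (0, -1)}"

section \<open>Crossings of a half-integral ray by unit steps\<close>

lemma ray_crossing_eq:
  assumes "\<bar>f' - f\<bar> \<le> 1"
  shows "ray_crossing e f f' = of_bool (e > 0) * (of_bool (f' > 0) - of_bool (f > 0))"
proof (cases "e > 0")
  case True
  consider "f' = f" | "f' = f + 1" | "f' = f - 1" using assms by linarith
  then show ?thesis using True by cases (auto simp: ray_crossing_def)
qed (simp add: ray_crossing_def)

text \<open>The four corners form a unit cell or a degenerate parallelogram. A closed path around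
  them has a nonzero total crossing only if it encircles (1/2, 1/2), that is, for the cell with
  opposite corners (0, 0) and (1, 1), which has the origin as a corner.\<close>

lemma ray_crossing_square:
  assumes "(a, b) \<in> unit_steps" "(c, d) \<in> unit_steps"
    and "(e, f) \<noteq> (0, 0)" "(e + a, f + b) \<noteq> (0, 0)" "(e - c, f - d) \<noteq> (0, 0)"
      "(e + a - c, f + b - d) \<noteq> (0, 0)"
  shows "ray_crossing e f (f + b) + ray_crossing (e + a) (f + b) (f + b - d)
       = ray_crossing e f (f - d) + ray_crossing (e - c) (f - d) (f + b - d)"
proof -
  have le: "\<bar>a\<bar> \<le> 1" "\<bar>b\<bar> \<le> 1" "\<bar>c\<bar> \<le> 1" "\<bar>d\<bar> \<le> 1"
    and ac: "b = 0 \<Longrightarrow> d \<noteq> 0 \<Longrightarrow> c = 0" "d = 0 \<Longrightarrow> b \<noteq> 0 \<Longrightarrow> a = 0"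
    using assms(1,2) by (auto simp: unit_steps_def)
  have sgn: "(0 < e') = (0 < e' + r)" if "e' \<noteq> 0" "e' + r \<noteq> 0" "\<bar>r\<bar> \<le> 1" for e' r :: int
    using that by linarith
  \<comment> \<open>If the horizontal step changes the sign test on the abscissa, some corner has
    abscissa 0. The corners in that column avoid the origin, so the vertical move by
    \<open>d\<close> cannot change the sign test on the ordinate.\<close>
  have *: "(0 < f - d) = (0 < f) \<or> (0 < e) = (0 < e + a)" if b: "b = 0"
  proof (rule disjCI)
    assume ne: "(0 < e) \<noteq> (0 < e + a)"
    then have "e = 0 \<or> e + a = 0" using sgn[of e a] le by blast
    then have "f \<noteq> 0 \<and> f - d \<noteq> 0"
      using assms(3-6) b ac(1) by (cases "d = 0") auto
    then show "(0 < f - d) = (0 < f)" using sgn[of f "- d"] le by simp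
  qed
  have **: "(0 < f + b) = (0 < f) \<or> (0 < e) = (0 < e - c)" if d: "d = 0"
  proof (rule disjCI)
    assume ne: "(0 < e) \<noteq> (0 < e - c)"
    then have "e = 0 \<or> e - c = 0" using sgn[of e "- c"] le by auto
    then have "f \<noteq> 0 \<and> f + b \<noteq> 0"
      using assms(3-6) d ac(2) by (cases "b = 0") auto
    then show "(0 < f + b) = (0 < f)" using sgn[of f b] le by simp
  qed
  consider "b = 0" "d = 0" | "b = 0" | "d = 0" | "a = 0" "c = 0"
    using assms(1,2) by (auto simp: unit_steps_def)
  then show ?thesis
  proof cases
    case 1
    then show ?thesis by (simp add: ray_crossing_def)
  next
    case 2
    with *[OF 2] show ?thesis using le by (elim disjE; simp add: ray_crossing_eq)
  next
    case 3
    with **[OF 3] show ?thesis using le by (elim disjE; simp add: ray_crossing_eq)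
  next
    case 4
    then show ?thesis using le by (simp add: ray_crossing_eq algebra_simps)
  qed
qed

text \<open>A finite check over three consecutive steps without backtracking. The three brackets on
  the left are the defects of the squares of index pairs that touch the diagonal; the right side is
  the increment of \<open>local_status\<close>.\<close>

lemma wind_jump_identity:
  assumes "(a, b) \<in> unit_steps" "(c, d) \<in> unit_steps" "(e, f) \<in> unit_steps"
    and "(a + c, b + d) \<noteq> (0, 0)" "(c + e, d + f) \<noteq> (0, 0)"
  shows "(ray_crossing (- a - c) (- b - d) (- d) - ray_crossing (- a) (- b) 0 - ray_crossing 0 0 (- d) +
      ray_crossing (- a) (- b) (- b - d)) +
     (ray_crossing (- c) (- d) 0 - ray_crossing 0 0 d - ray_crossing c d 0 + ray_crossing 0 0 (- d)) +
     (ray_crossing 0 0 f - ray_crossing c d (d + f) - ray_crossing (c + e) (d + f) f + ray_crossing c d 0) =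
     (of_bool (e = 1 \<or> f = -1) - (of_bool (c = -1 \<and> f = -1) - of_bool (d = -1 \<and> e = -1))) -
     (of_bool (c = 1 \<or> d = -1) - (of_bool (a = -1 \<and> d = -1) - of_bool (b = -1 \<and> c = -1)))"
proof -
  have "(a = 1 \<and> b = 0 \<or> a = -1 \<and> b = 0 \<or> a = 0 \<and> b = 1 \<or> a = 0 \<and> b = -1)"
    "(c = 1 \<and> d = 0 \<or> c = -1 \<and> d = 0 \<or> c = 0 \<and> d = 1 \<or> c = 0 \<and> d = -1)"
    "(e = 1 \<and> f = 0 \<or> e = -1 \<and> f = 0 \<or> e = 0 \<and> f = 1 \<or> e = 0 \<and> f = -1)"
    using assms(1-3) by (simp_all add: unit_steps_def)
  then show ?thesis using assms(4-)
    by (elim disjE conjE; simp add: ray_crossing_def)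
qed

section \<open>Variation of the winding number along a lattice polygon\<close>

lemma sum_periodic:
  fixes F :: "nat \<Rightarrow> int"
  assumes "\<And>s. F (s + L) = F s"
  shows "(\<Sum>i<L. F (k + i)) = (\<Sum>i<L. F i)"
proof (induction k)
  case (Suc k)
  have "(\<Sum>i<L. F (Suc k + i)) + F k = (\<Sum>i<Suc L. F (k + i))"
    by (subst sum.lessThan_Suc_shift) simp
  also have "\<dots> = (\<Sum>i<L. F (k + i)) + F k" using assms[of k] by simp
  finally show ?case using Suc by simp
qed simp

text \<open>The vertices form a periodic sequence on all of \<open>nat\<close> instead of a list
  indexed modulo \<open>L\<close>, so a window of consecutive indices may begin anywhere. The bound
  on \<open>L\<close> excludes doubled edges, which enclose nothing and are treated
  separately.\<close>

locale lattice_polygon =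
  fixes L :: nat and x y :: "nat \<Rightarrow> int"
  assumes length_ge: "L \<ge> 4"
    and periodic_x: "x (t + L) = x t" and periodic_y: "y (t + L) = y t"
    and step: "(x (Suc t) - x t, y (Suc t) - y t) \<in> unit_steps"
    and distinct_points: "0 < d \<Longrightarrow> d < L \<Longrightarrow> (x (t + d), y (t + d)) \<noteq> (x t, y t)"
begin

text \<open>The winding number of the polygon around \<open>(u + 1/2, v + 1/2)\<close>; perturbing lattice points in this
  direction makes it meaningful also on the polygon.\<close>

definition wind :: "int \<Rightarrow> int \<Rightarrow> int" where
  "wind u v = (\<Sum>s<L. ray_crossing (x s - u) (y s - v) (y (Suc s) - v))"

text \<open>Crossings of the difference vector \<open>p s - p t\<close> on the torus of index pairs, when \<open>s\<close> (in \<open>h\<close>) or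
  \<open>t\<close> (in \<open>g\<close>) advances. Around a unit square of index pairs they cancel unless the vector vanishes there.\<close>

definition h :: "nat \<Rightarrow> nat \<Rightarrow> int" where
  "h s t = ray_crossing (x s - x t) (y s - y t) (y (Suc s) - y t)"

definition g :: "nat \<Rightarrow> nat \<Rightarrow> int" where
  "g s t = ray_crossing (x s - x t) (y s - y t) (y s - y (Suc t))"

text \<open>Signed number of turns at vertex \<open>Suc t\<close> across the south-west direction, west to south being positive.\<close>

definition W_S_turn :: "nat \<Rightarrow> int" where
  "W_S_turn t =
     of_bool (x (Suc t) - x t = -1 \<and> y (Suc (Suc t)) - y (Suc t) = -1) -
     of_bool (y (Suc t) - y t = -1 \<and> x (Suc (Suc t)) - x (Suc t) = -1)"

text \<open>For a counterclockwise polygon this tells whether the cell north-east of vertex \<open>Suc t\<close> is inside.\<close>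

definition local_status :: "nat \<Rightarrow> int" where
  "local_status t =
     of_bool (x (Suc (Suc t)) - x (Suc t) = 1 \<or> y (Suc (Suc t)) - y (Suc t) = -1) - W_S_turn t"

lemma h_periodic: "h (s + L) t = h s t"
  using periodic_x periodic_y[of s] periodic_y[of "Suc s"] by (simp add: h_def)

lemma g_periodic: "g (s + L) t = g s t"
  using periodic_x periodic_y[of s] by (simp add: g_def)

lemma points_differ: "s < t \<Longrightarrow> t < s + L \<Longrightarrow> (x s - x t, y s - y t) \<noteq> (0, 0)"
  using distinct_points[of "t - s" s] by (auto simp: less_diff_conv2 add.commute)

lemma points_differ_rev: "s < t \<Longrightarrow> t < s + L \<Longrightarrow> (x t - x s, y t - y s) \<noteq> (0, 0)"
  using points_differ[of s t] by auto

lemma square_closed: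
  assumes "(x s - x t, y s - y t) \<noteq> (0, 0)" "(x (Suc s) - x t, y (Suc s) - y t) \<noteq> (0, 0)"
    "(x s - x (Suc t), y s - y (Suc t)) \<noteq> (0, 0)"
    "(x (Suc s) - x (Suc t), y (Suc s) - y (Suc t)) \<noteq> (0, 0)"
  shows "h s t + g (Suc s) t = g s t + h s (Suc t)"
  using ray_crossing_square[OF step[of s] step[of t], of "x s - x t" "y s - y t"] assms
  by (simp add: h_def g_def)

lemma square_closed_below: "Suc s < t \<Longrightarrow> Suc t < s + L \<Longrightarrow> h s t + g (Suc s) t = g s t + h s (Suc t)"
  by (intro square_closed points_differ) auto

lemma square_closed_above: "Suc t < s \<Longrightarrow> Suc s < t + L \<Longrightarrow> h s t + g (Suc s) t = g s t + h s (Suc t)"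
  by (intro square_closed points_differ_rev) auto

lemma wind_eq_sum_h: "wind (x t) (y t) = (\<Sum>s<L. h s t)"
  by (simp add: wind_def h_def)

text \<open>\<open>D s\<close> is the defect of the square with corners \<open>s\<close>,
  \<open>Suc s\<close> and \<open>Suc t\<close>, \<open>Suc (Suc t)\<close>. Summed over a period
  the \<open>g\<close> terms cancel, leaving the jump of \<open>wind\<close>; the defect vanishes
  unless the square contains a pair of equal vertices.\<close>

lemma wind_minus_local_status_const:
  "wind (x (Suc (Suc t))) (y (Suc (Suc t))) - local_status (Suc t) =
   wind (x (Suc t)) (y (Suc t)) - local_status t"
proof -
  define D where "D s = h s (Suc (Suc t)) - h s (Suc t) - g (Suc s) (Suc t) + g s (Suc t)" for s
  have perD: "D (s + L) = D s" for s
    using h_periodic[of s] g_periodic[of s] g_periodic[of "Suc s"] by (simp add: D_def)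
  have sumD: "(\<Sum>s<L. D s) = wind (x (Suc (Suc t))) (y (Suc (Suc t))) - wind (x (Suc t)) (y (Suc t))"
  proof -
    have "(\<Sum>s<L. g (Suc s) (Suc t)) = (\<Sum>s<L. g s (Suc t))"
      using sum_periodic[of "\<lambda>s. g s (Suc t)" L 1] g_periodic by simp
    then show ?thesis
      by (simp add: D_def wind_eq_sum_h sum.distrib sum_subtractf)
  qed
  \<comment> \<open>Starting the period at \<open>t\<close> collects the squares that meet the
    diagonal, \<open>s = t\<close>, \<open>t + 1\<close> and \<open>t + 2\<close>, in the first
    three terms.\<close>
  have "(\<Sum>s<L. D s) = (\<Sum>i<L. D (t + i))"
    using sum_periodic[of D L t] perD by simp
  also have "\<dots> = (\<Sum>i<3. D (t + i)) + (\<Sum>i = 3..<L. D (t + i))"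
    using length_ge by (subst sum.atLeastLessThan_concat[of 0 3 L, symmetric, simplified atLeast0LessThan]) auto
  also have "(\<Sum>i = 3..<L. D (t + i)) = 0"
  proof (rule sum.neutral, rule ballI)
    fix i assume "i \<in> {3..<L}"
    then show "D (t + i) = 0"
      using square_closed_above[of "Suc t" "t + i"] by (simp add: D_def)
  qed
  finally have "(\<Sum>s<L. D s) = D t + D (Suc t) + D (Suc (Suc t))"
    by (simp add: eval_nat_numeral)
  moreover have "D t + D (Suc t) + D (Suc (Suc t)) = local_status (Suc t) - local_status t"
  proof -
    have 1: "(x (Suc (Suc t)) - x t, y (Suc (Suc t)) - y t) \<noteq> (0, 0)"
      "(x (Suc (Suc (Suc t))) - x (Suc t), y (Suc (Suc (Suc t))) - y (Suc t)) \<noteq> (0, 0)"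
      "(x (Suc (Suc (Suc t))) - x t, y (Suc (Suc (Suc t))) - y t) \<noteq> (0, 0)"
      using length_ge by (intro points_differ_rev; simp)+
    define a b where "a = x (Suc t) - x t" and "b = y (Suc t) - y t"
    then have ab: "(a, b) \<in> unit_steps" "x (Suc t) = x t + a" "y (Suc t) = y t + b"
      using step[of t] by simp_all
    define c d where "c = x (Suc (Suc t)) - x (Suc t)" and "d = y (Suc (Suc t)) - y (Suc t)"
    then have cd: "(c, d) \<in> unit_steps" "x (Suc (Suc t)) = x t + a + c" "y (Suc (Suc t)) = y t + b + d"
      using step[of "Suc t"] ab by simp_all
    define e f where "e = x (Suc (Suc (Suc t))) - x (Suc (Suc t))" and "f = y (Suc (Suc (Suc t))) - y (Suc (Suc t))"
    then have ef: "(e, f) \<in> unit_steps" "x (Suc (Suc (Suc t))) = x t + a + c + e"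
        "y (Suc (Suc (Suc t))) = y t + b + d + f"
      using step[of "Suc (Suc t)"] cd by simp_all
    have 2: "(a + c, b + d) \<noteq> (0, 0)" "(c + e, d + f) \<noteq> (0, 0)"
      using 1(1,2) ab cd ef by auto
    have "D t + D (Suc t) + D (Suc (Suc t)) =
        (ray_crossing (- a - c) (- b - d) (- d) - ray_crossing (- a) (- b) 0 - ray_crossing 0 0 (- d) +
         ray_crossing (- a) (- b) (- b - d)) +
        (ray_crossing (- c) (- d) 0 - ray_crossing 0 0 d - ray_crossing c d 0 + ray_crossing 0 0 (- d)) +
        (ray_crossing 0 0 f - ray_crossing c d (d + f) - ray_crossing (c + e) (d + f) f + ray_crossing c d 0)"
      by (simp add: D_def h_def g_def ab(2,3) cd(2,3) ef(2,3) algebra_simps)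
    moreover have "local_status (Suc t) - local_status t =
       (of_bool (e = 1 \<or> f = -1) - (of_bool (c = -1 \<and> f = -1) - of_bool (d = -1 \<and> e = -1))) -
       (of_bool (c = 1 \<or> d = -1) - (of_bool (a = -1 \<and> d = -1) - of_bool (b = -1 \<and> c = -1)))"
      by (simp add: local_status_def W_S_turn_def ab(2,3) cd(2,3) ef(2,3))
    ultimately show ?thesis
      using wind_jump_identity[OF ab(1) cd(1) ef(1) 2] by simp
  qed
  ultimately show ?thesis using sumD by simp
qed

lemma wind_minus_local_status:
  "wind (x (Suc t)) (y (Suc t)) - local_status t = wind (x 1) (y 1) - local_status 0"
  by (induction t) (simp_all add: wind_minus_local_status_const)

section \<open>Total turning of the polygon\<close>

lemma W_S_turn_eq: "h t (Suc (Suc t)) + g t (Suc t) = W_S_turn t"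
proof -
  define a b where "a = x (Suc t) - x t" and "b = y (Suc t) - y t"
  then have ab: "(a, b) \<in> unit_steps" "x (Suc t) = x t + a" "y (Suc t) = y t + b"
    using step[of t] by simp_all
  define c d where "c = x (Suc (Suc t)) - x (Suc t)" and "d = y (Suc (Suc t)) - y (Suc t)"
  then have cd: "(c, d) \<in> unit_steps" "x (Suc (Suc t)) = x t + a + c" "y (Suc (Suc t)) = y t + b + d"
    using step[of "Suc t"] ab by simp_all
  \<comment> \<open>The difference vector moves from \<open>- (a, b)\<close> through
    \<open>- (a + c, b + d)\<close> to \<open>- (c, d)\<close>, so these two crossings record how
    the reversed tangent sweeps over the north-east direction at a vertex. This is why
    \<open>W_S_turn\<close> watches the south-west direction.\<close>
  have "h t (Suc (Suc t)) + g t (Suc t) = ray_crossing (- a - c) (- b - d) (- d) + ray_crossing (- a) (- b) (- b - d)"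
    by (simp add: h_def g_def ab(2,3) cd(2,3) algebra_simps)
  moreover have "W_S_turn t = of_bool (a = -1 \<and> d = -1) - of_bool (b = -1 \<and> c = -1)"
    by (simp add: W_S_turn_def ab(2,3) cd(2,3))
  moreover have "(a = 1 \<and> b = 0 \<or> a = -1 \<and> b = 0 \<or> a = 0 \<and> b = 1 \<or> a = 0 \<and> b = -1)"
    "(c = 1 \<and> d = 0 \<or> c = -1 \<and> d = 0 \<or> c = 0 \<and> d = 1 \<or> c = 0 \<and> d = -1)"
    using ab(1) cd(1) by (simp_all add: unit_steps_def)
  then have "ray_crossing (- a - c) (- b - d) (- d) + ray_crossing (- a) (- b) (- b - d) =
      of_bool (a = -1 \<and> d = -1) - of_bool (b = -1 \<and> c = -1)"
    by (elim disjE conjE; simp add: ray_crossing_def)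
  ultimately show ?thesis by (simp only:)
qed

text \<open>Hopf's argument: the crossings are a closed cochain on the triangle \<open>s < t\<close> of index pairs and vanish on
  the two legs, because all difference vectors from the lexicographically extreme point lie in a half plane.\<close>

lemma sum_W_S_turn_aux:
  assumes base: "\<And>t. 0 < t \<Longrightarrow> t < L \<Longrightarrow> y t > y 0 \<or> y t = y 0 \<and> x t < x 0"
  shows "Suc (Suc k) < L \<Longrightarrow> (\<Sum>s<Suc k. h s (Suc (Suc k))) = (\<Sum>i<Suc k. W_S_turn i)"
proof (induction k)
  have g0: "g 0 t = 0" if "0 < t" "Suc t < L" for t
  proof -
    have "y 0 \<le> y t" "y 0 \<le> y (Suc t)" using base[of t] base[of "Suc t"] that by linarith+
    then show ?thesis by (simp add: g_def ray_crossing_def)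
  qed
  {
    case 0
    then show ?case using W_S_turn_eq[of 0] g0[of 1] by simp
  next
    case (Suc k)
    define t where "t = Suc (Suc k)"
    have tL: "Suc t < L" using Suc.prems by (simp add: t_def)
    have "(\<Sum>s<Suc k. h s (Suc t)) = (\<Sum>s<Suc k. h s t + (g (Suc s) t - g s t))"
    proof (rule sum.cong[OF refl])
      fix s assume "s \<in> {..<Suc k}"
      then show "h s (Suc t) = h s t + (g (Suc s) t - g s t)"
        using square_closed_below[of s t] tL by (simp add: t_def)
    qed
    also have "\<dots> = (\<Sum>s<Suc k. h s t) + (g (Suc k) t - g 0 t)"
      using sum_lessThan_telescope[of "\<lambda>s. g s t" "Suc k"] by (simp add: sum.distrib del: sum.lessThan_Suc)
    also have "g 0 t = 0" using g0[of t] tL by (simp add: t_def)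
    finally show ?case
      using Suc.IH Suc.prems W_S_turn_eq[of "Suc k"] by (simp add: t_def)
  }
qed

text \<open>The triangle is completed by column \<open>L\<close>, which is vertex 0 seen again. All
  crossings on its boundary cancel or vanish except those at the corner of the polygon at vertex 0,
  and a single corner contributes one turn.\<close>

lemma sum_W_S_turn:
  assumes base: "\<And>t. 0 < t \<Longrightarrow> t < L \<Longrightarrow> y t > y 0 \<or> y t = y 0 \<and> x t < x 0"
  shows "\<bar>\<Sum>t<L. W_S_turn t\<bar> = 1"
proof -
  obtain k where k: "L = k + 4" using length_ge by (metis add.commute le_Suc_ex)
  have xL: "x L = x 0" "y L = y 0" "x (Suc L) = x 1" "y (Suc L) = y 1"
    using periodic_x[of 0] periodic_y[of 0] periodic_x[of 1] periodic_y[of 1] by simp_all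
  have A: "(\<Sum>s<k+2. h s (k+3)) = (\<Sum>i<k+2. W_S_turn i)"
    using sum_W_S_turn_aux[OF base, of "Suc k"] k by (simp add: eval_nat_numeral)
  \<comment> \<open>Seen from vertex 0, every other vertex is strictly higher, or level and to the
    left, so no step between two of them crosses the ray.\<close>
  have h0: "h s L = 0" if "0 < s" "Suc s < L" for s
    
  proof -
    have "x s = x (Suc s)" if "y (Suc s) \<noteq> y s" using step[of s] that by (auto simp: unit_steps_def)
    then have "\<not> (x s - x 0 > 0 \<and> y s - y 0 = 0)" "\<not> (x s - x 0 > 0 \<and> y s - y 0 = 1 \<and> y (Suc s) - y 0 = 0)"
      using base[of s] base[of "Suc s"] that by force+
    then show ?thesis by (auto simp: h_def xL ray_crossing_def)
  qed
  \<comment> \<open>Row 0 is left out, since the pair of indices 0 and \<open>L\<close> has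
    difference vector zero and its square is not closed.\<close>
  have "h (Suc s) L = h (Suc s) (k+3) + (g (Suc (Suc s)) (k+3) - g (Suc s) (k+3))" if "s < k + 1" for s
    using square_closed_below[of "Suc s" "k+3"] k that by (simp add: eval_nat_numeral)
  then have "(\<Sum>s<k+1. h (Suc s) L) =
      (\<Sum>s<k+1. h (Suc s) (k+3) + (g (Suc (Suc s)) (k+3) - g (Suc s) (k+3)))"
    by (intro sum.cong) auto
  also have "\<dots> = (\<Sum>s<k+1. h (Suc s) (k+3)) + (g (k+2) (k+3) - g 1 (k+3))"
    using sum_lessThan_telescope[of "\<lambda>s. g (Suc s) (k+3)" "k+1"] by (simp add: sum.distrib)
  also have "(\<Sum>s<k+1. h (Suc s) (k+3)) = (\<Sum>s<Suc (k+1). h s (k+3)) - h 0 (k+3)"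
    by (subst sum.lessThan_Suc_shift) simp
  finally have "(\<Sum>s<k+1. h (Suc s) L) = (\<Sum>i<k+2. W_S_turn i) - h 0 (k+3) + g (k+2) (k+3) - g 1 (k+3)"
    using A by simp
  moreover have "(\<Sum>s<k+1. h (Suc s) L) = 0"
    using h0 k by (intro sum.neutral) auto
  moreover have "h (k+2) L = 0" using h0[of "k+2"] k by simp
  moreover have "h (k+2) L + g (k+2) (k+3) = W_S_turn (k+2)"
    using W_S_turn_eq[of "k+2"] k by (simp add: eval_nat_numeral)
  ultimately have "(\<Sum>i<L. W_S_turn i) = h 0 (k+3) + g 1 (k+3) + W_S_turn (k+3)"
    using k by (simp add: eval_nat_numeral)
  moreover have "\<bar>h 0 (k+3) + g 1 (k+3) + W_S_turn (k+3)\<bar> = 1"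
  proof -
    have Lk: "Suc (k+3) = L" using k by simp
    define a b where "a = x L - x (k+3)" and "b = y L - y (k+3)"
    then have ab: "(a, b) \<in> unit_steps" "x (k+3) = x 0 - a" "y (k+3) = y 0 - b"
      using step[of "k+3"] Lk xL by simp_all
    define c d where "c = x 1 - x 0" and "d = y 1 - y 0"
    then have cd: "(c, d) \<in> unit_steps" "x 1 = x 0 + c" "y 1 = y 0 + d"
      using step[of 0] by simp_all
    \<comment> \<open>Vertex 0 is the rightmost of the lowest vertices: it is entered going east or
      south and left going west or north. Excluding backtracking leaves east then north
      (counterclockwise) and south then west (clockwise), the two signs of the result.\<close>
    have 1: "- b > 0 \<or> b = 0 \<and> a > 0" using base[of "k+3"] ab k by auto
    have 2: "d > 0 \<or> d = 0 \<and> c < 0" using base[of 1] cd k by auto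
    have 3: "a + c \<noteq> 0 \<or> b + d \<noteq> 0"
      using points_differ_rev[of "k+3" "L+1"] k length_ge ab cd xL by auto
    have "h 0 (k+3) + g 1 (k+3) + W_S_turn (k+3) =
        ray_crossing a b (b + d) + ray_crossing (a + c) (b + d) d +
        (of_bool (a = -1 \<and> d = -1) - of_bool (b = -1 \<and> c = -1))"
      using cd(2,3) by (simp add: h_def g_def W_S_turn_def Lk xL ab(2,3) algebra_simps)
    moreover have "(a = 1 \<and> b = 0 \<or> a = 0 \<and> b = -1)" "(c = -1 \<and> d = 0 \<or> c = 0 \<and> d = 1)"
      using 1 2 ab(1) cd(1) by (auto simp: unit_steps_def)
    ultimately show ?thesis using 3
      by (elim disjE conjE; simp only:; simp add: ray_crossing_def)
  qed
  ultimately show ?thesis by simp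
qed

section \<open>Signed area and Pick's theorem modulo 2\<close>

lemma sum_shift: "(\<Sum>t<L. F (x (Suc t)) (y (Suc t))) = (\<Sum>t<L. F (x t) (y t) :: int)"
  using sum_periodic[of "\<lambda>t. F (x t) (y t)" L 1] periodic_x periodic_y by simp

lemma sum_steps: "(\<Sum>t<L. x (Suc t) - x t) = 0" "(\<Sum>t<L. y (Suc t) - y t) = 0"
  using sum_lessThan_telescope[of x L] sum_lessThan_telescope[of y L] periodic_x[of 0] periodic_y[of 0]
  by simp_all

definition backward :: "nat \<Rightarrow> int" where
  "backward t = of_bool (x (Suc t) - x t = -1 \<or> y (Suc t) - y t = -1)"

text \<open>Each step changes x + y by 1 or -1 and the polygon closes up, so exactly half of the
  steps go west or south. In particular \<open>L\<close> is even.\<close>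

lemma sum_backward: "2 * (\<Sum>t<L. backward t) = int L"
proof -
  have "2 * backward t = 1 - (x (Suc t) - x t) - (y (Suc t) - y t)" for t
    using step[of t] by (auto simp: backward_def unit_steps_def)
  then have "2 * (\<Sum>t<L. backward t) = (\<Sum>t<L. 1 - (x (Suc t) - x t) - (y (Suc t) - y t))"
    by (simp only: sum_distrib_left)
  also have "\<dots> = int L" using sum_steps by (simp only: sum_subtractf) simp
  finally show ?thesis .
qed

text \<open>Along the polygon \<open>wind\<close> is an east-or-south indicator for the outgoing
  step, minus a turn, plus a constant. The indicators sum to L/2, the turns to 1 or -1, and the
  constant disappears modulo 2 because \<open>L\<close> is even.\<close>

lemma sum_wind_parity:
  assumes base: "\<And>t. 0 < t \<Longrightarrow> t < L \<Longrightarrow> y t > y 0 \<or> y t = y 0 \<and> x t < x 0"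
  shows "even ((\<Sum>t<L. wind (x t) (y t)) + (\<Sum>t<L. backward t) + 1)"
proof -
  define e where "e t = (of_bool (x (Suc t) - x t = 1 \<or> y (Suc t) - y t = -1) :: int)" for t
  have "2 * e t = 1 + (x (Suc t) - x t) - (y (Suc t) - y t)" for t
    using step[of t] by (auto simp: e_def unit_steps_def)
  then have "2 * (\<Sum>t<L. e t) = (\<Sum>t<L. 1 + (x (Suc t) - x t) - (y (Suc t) - y t))"
    by (simp only: sum_distrib_left)
  also have "\<dots> = int L" using sum_steps by (simp only: sum_subtractf sum.distrib) simp
  finally have e: "(\<Sum>t<L. e t) = (\<Sum>t<L. backward t)" using sum_backward by simp
  have eS: "(\<Sum>t<L. e (Suc t)) = (\<Sum>t<L. e t)"
    using sum_periodic[of e L 1] periodic_x periodic_y periodic_x[of "Suc _"] periodic_y[of "Suc _"]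
    by (simp add: e_def)
  define c where "c = wind (x 1) (y 1) - local_status 0"
  have c: "wind (x (Suc t)) (y (Suc t)) = e (Suc t) - W_S_turn t + c" for t
    using wind_minus_local_status[of t] by (simp add: local_status_def[of t] e_def c_def)
  have "(\<Sum>t<L. wind (x t) (y t)) = (\<Sum>t<L. wind (x (Suc t)) (y (Suc t)))"
    by (rule sum_shift[symmetric])
  also have "\<dots> = (\<Sum>t<L. backward t) - (\<Sum>t<L. W_S_turn t) + int L * c"
    by (simp add: c sum.distrib sum_subtractf eS e)
  finally have "(\<Sum>t<L. wind (x t) (y t)) = (\<Sum>t<L. backward t) - (\<Sum>t<L. W_S_turn t) + int L * c" .
  moreover have "odd (\<Sum>t<L. W_S_turn t)"
    using sum_W_S_turn[OF base] by (metis dvd_abs_iff odd_one)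
  moreover have "even (int L)" using sum_backward by (metis dvd_triv_left)
  ultimately show ?thesis by simp
qed

text \<open>This is the area formula with integrand x dy, obtained by exchanging the sum over cells
  with the sum over steps.\<close>

lemma sum_wind_box:
  fixes m n :: int
  assumes box: "\<And>s. x s \<in> {1..m}" "\<And>s. y s \<in> {1..n}"
  shows "(\<Sum>u=1..m. \<Sum>v=1..n. wind u v) = (\<Sum>s<L. x s * (y (Suc s) - y s))"
proof -
  have 1: "(\<Sum>v=1..n. ray_crossing e (y s - v) (y (Suc s) - v)) = of_bool (e > 0) * (y (Suc s) - y s)" for e s
  proof -
    have "ray_crossing e (y s - v) (y (Suc s) - v) = of_bool (e > 0) *
      ((if v = y s then of_bool (y (Suc s) - y s = 1) else 0) -
       (if v = y (Suc s) then of_bool (y (Suc s) - y s = -1) else 0))" for v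
      by (auto simp: ray_crossing_def)
    then have "(\<Sum>v=1..n. ray_crossing e (y s - v) (y (Suc s) - v)) = of_bool (e > 0) *
      (of_bool (y (Suc s) - y s = 1) - of_bool (y (Suc s) - y s = -1))"
      using box(2) by (simp add: sum_subtractf flip: sum_distrib_left)
    also have "\<dots> = of_bool (e > 0) * (y (Suc s) - y s)"
      using step[of s] by (auto simp: unit_steps_def)
    finally show ?thesis .
  qed
  \<comment> \<open>A vertical step at abscissa \<open>x s\<close> is met by the rays of the cells
    with \<open>u < x s\<close>. The correction -1 drops out later, as the total vertical
    displacement is 0.\<close>
  have 2: "(\<Sum>u=1..m. of_bool (x s - u > 0)) = x s - 1" for s
  proof -
    have "(\<Sum>u=1..m. of_bool (x s - u > 0) :: int) = (\<Sum>u\<in>{1..x s - 1}. 1)"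
      using box(1)[of s] by (intro sum.mono_neutral_cong_right) auto
    then show ?thesis using box(1)[of s] by simp
  qed
  have "(\<Sum>u=1..m. \<Sum>v=1..n. wind u v) =
      (\<Sum>u=1..m. \<Sum>s<L. \<Sum>v=1..n. ray_crossing (x s - u) (y s - v) (y (Suc s) - v))"
    unfolding wind_def by (intro sum.cong refl sum.swap)
  also have "\<dots> = (\<Sum>s<L. \<Sum>u=1..m. \<Sum>v=1..n. ray_crossing (x s - u) (y s - v) (y (Suc s) - v))"
    by (rule sum.swap)
  also have "\<dots> = (\<Sum>s<L. (x s - 1) * (y (Suc s) - y s))"
    unfolding 1 sum_distrib_right[symmetric] 2 ..
  also have "\<dots> = (\<Sum>s<L. x s * (y (Suc s) - y s))"
    using sum_steps(2) by (simp add: left_diff_distrib sum_subtractf)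
  finally show ?thesis .
qed

lemma inj_on_points: "inj_on (\<lambda>t. (x t, y t)) {..<L}"
proof (rule inj_onI, rule ccontr)
  fix s t assume *: "s \<in> {..<L}" "t \<in> {..<L}" "(x s, y s) = (x t, y t)" "s \<noteq> t"
  then show False
    using points_differ[of s t] points_differ[of t s] by (cases "s < t") auto
qed

text \<open>The area is the sum of \<open>wind\<close> over the box. Off the polygon its parity
  counts the points with odd \<open>wind\<close>; on the polygon it is given by
  \<open>sum_wind_parity\<close>. The last sum is exactly the exponent of the product of Kasteleyn
  signs along the cycle.\<close>

lemma pick_parity:
  fixes m n :: int
  assumes box: "\<And>s. x s \<in> {1..m}" "\<And>s. y s \<in> {1..n}"
    and base: "\<And>t. 0 < t \<Longrightarrow> t < L \<Longrightarrow> y t > y 0 \<or> y t = y 0 \<and> x t < x 0"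
  defines "P \<equiv> (\<lambda>t. (x t, y t)) ` {..<L}"
  shows "even (int (card {(u, v) \<in> {1..m} \<times> {1..n} - P. odd (wind u v)}) + 1 +
    (\<Sum>s<L. backward s + x s * (y (Suc s) - y s)))"
proof -
  let ?V = "{1..m} \<times> {1..n}"
  have sub: "P \<subseteq> ?V" using box by (auto simp: P_def)
  have "{(u, v) \<in> ?V - P. odd (wind u v)} = (?V - P) \<inter> {p. odd (wind (fst p) (snd p))}" by auto
  then have N: "int (card {(u, v) \<in> ?V - P. odd (wind u v)}) = (\<Sum>p\<in>?V - P. of_bool (odd (wind (fst p) (snd p))))"
    by (subst sum_of_bool_eq) auto
  have "even ((\<Sum>p\<in>?V - P. of_bool (odd (wind (fst p) (snd p)))) - (\<Sum>p\<in>?V - P. wind (fst p) (snd p)))"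
    by (subst sum_subtractf[symmetric]) (rule dvd_sum, auto)
  moreover have "(\<Sum>p\<in>?V. wind (fst p) (snd p)) = (\<Sum>p\<in>?V - P. wind (fst p) (snd p)) + (\<Sum>p\<in>P. wind (fst p) (snd p))"
    by (rule sum.subset_diff[OF sub]) simp
  moreover have "(\<Sum>p\<in>?V. wind (fst p) (snd p)) = (\<Sum>s<L. x s * (y (Suc s) - y s))"
    using sum_wind_box[OF box] by (simp add: sum.cartesian_product case_prod_beta)
  moreover have "(\<Sum>p\<in>P. wind (fst p) (snd p)) = (\<Sum>t<L. wind (x t) (y t))"
    unfolding P_def by (subst sum.reindex[OF inj_on_points]) simp
  moreover note sum_wind_parity[OF base]
  ultimately show ?thesis
    unfolding N sum.distrib even_add even_diff by auto
qed

end

section \<open>The topological interior of a lattice polygon\<close>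

lemma unit_edge_midpoint:
  fixes a b c d u v u' v' :: int
  assumes ab: "a = 1 \<and> b = 0 \<or> a = -1 \<and> b = 0 \<or> a = 0 \<and> b = 1 \<or> a = 0 \<and> b = -1"
    and cd: "c = 1 \<and> d = 0 \<or> c = -1 \<and> d = 0 \<or> c = 0 \<and> d = 1 \<or> c = 0 \<and> d = -1"
    and mid: "2 * u + a = 2 * u' + c" "2 * v + b = 2 * v' + d"
  shows "u' = u \<and> v' = v \<or> u' = u + a \<and> v' = v + b \<and> u' + c = u \<and> v' + d = v"
proof -
  have "even a \<longleftrightarrow> even c" using mid(1) by presburger
  then have "a = c \<and> b = d \<or> a = - c \<and> b = - d" using ab cd by (elim disjE conjE; simp)
  then show ?thesis using mid by (elim disjE conjE) (simp, linarith)
qed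

context lattice_polygon
begin

section \<open>The polygon as a simple closed path\<close>

definition pt :: "nat \<Rightarrow> complex" where
  "pt t = Complex (of_int (x t)) (of_int (y t))"

definition edge_segment :: "nat \<Rightarrow> complex set" where
  "edge_segment t = closed_segment (pt t) (pt (Suc t))"

definition curve :: "complex set" where
  "curve = (\<Union>t<L. edge_segment t)"

primrec polypath :: "nat \<Rightarrow> real \<Rightarrow> complex" where
  "polypath 0 = linepath (pt 0) (pt 1)"
| "polypath (Suc k) = polypath k +++ linepath (pt (Suc k)) (pt (Suc (Suc k)))"

lemma pathstart_polypath [simp]: "pathstart (polypath k) = pt 0"
  by (induction k) simp_all

lemma pathfinish_polypath [simp]: "pathfinish (polypath k) = pt (Suc k)"
  by (cases k) simp_all

lemma valid_path_polypath [simp]: "valid_path (polypath k)"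
  by (induction k) (simp_all add: valid_path_join)

lemma path_image_polypath: "path_image (polypath k) = (\<Union>t\<le>k. edge_segment t)"
  by (induction k) (auto simp: path_image_join edge_segment_def atMost_Suc)

lemma mem_edge_segment:
  assumes "q \<in> edge_segment t"
  obtains r where "0 \<le> r" "r \<le> 1"
    "Re q = real_of_int (x t) + r * real_of_int (x (Suc t) - x t)"
    "Im q = real_of_int (y t) + r * real_of_int (y (Suc t) - y t)"
proof -
  obtain r where "0 \<le> r" "r \<le> 1" "q = (1 - r) *\<^sub>R pt t + r *\<^sub>R pt (Suc t)"
    using assms by (auto simp: edge_segment_def in_segment)
  then show ?thesis by (intro that[of r]) (simp_all add: pt_def, simp_all add: algebra_simps)
qed

text \<open>Floor plus ceiling recovers twice the midpoint of a unit edge from any of its interior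
  points, because one coordinate is an integer and the other lies strictly between consecutive
  integers.\<close>

lemma edge_segment_interior:
  assumes "q \<in> edge_segment t" "q \<noteq> pt t" "q \<noteq> pt (Suc t)"
  shows "Re q \<notin> \<int> \<or> Im q \<notin> \<int>"
    and "\<lfloor>Re q\<rfloor> + \<lceil>Re q\<rceil> = x t + x (Suc t)"
    and "\<lfloor>Im q\<rfloor> + \<lceil>Im q\<rceil> = y t + y (Suc t)"
proof -
  obtain r where r: "0 \<le> r" "r \<le> 1"
    "Re q = real_of_int (x t) + r * real_of_int (x (Suc t) - x t)"
    "Im q = real_of_int (y t) + r * real_of_int (y (Suc t) - y t)"
    using mem_edge_segment[OF assms(1)] .
  have "r \<noteq> 0" "r \<noteq> 1"
    using assms(2,3) r(3,4) by (auto simp: pt_def complex_eq_iff)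
  then have r01: "0 < r" "r < 1" using r by auto
  have fl: "\<lfloor>real_of_int k + r\<rfloor> = k" "\<lceil>real_of_int k + r\<rceil> = k + 1"
    "\<lfloor>real_of_int k - r\<rfloor> = k - 1" "\<lceil>real_of_int k - r\<rceil> = k" for k
    using r01 by linarith+
  have ni: "real_of_int k + r \<notin> \<int>" "real_of_int k - r \<notin> \<int>" for k
    using r01 fl[of k] by (metis Ints_cases ceiling_of_int floor_of_int add_cancel_right_right zero_neq_one diff_eq_eq)+
  define a b where "a = x (Suc t) - x t" and "b = y (Suc t) - y t"
  have ab: "x (Suc t) = x t + a" "y (Suc t) = y t + b" by (simp_all add: a_def b_def)
  have q: "Re q = real_of_int (x t) + r * real_of_int a" "Im q = real_of_int (y t) + r * real_of_int b" using r(3,4) by (simp_all add: ab)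
  have "a = 1 \<and> b = 0 \<or> a = -1 \<and> b = 0 \<or> a = 0 \<and> b = 1 \<or> a = 0 \<and> b = -1"
    using step[of t] by (auto simp: unit_steps_def a_def b_def)
  then show "Re q \<notin> \<int> \<or> Im q \<notin> \<int>" "\<lfloor>Re q\<rfloor> + \<lceil>Re q\<rceil> = x t + x (Suc t)"
     "\<lfloor>Im q\<rfloor> + \<lceil>Im q\<rceil> = y t + y (Suc t)"
    unfolding q ab using ni fl by (elim disjE conjE; simp)+
qed

lemma pt_Ints [simp]: "Re (pt t) \<in> \<int>" "Im (pt t) \<in> \<int>"
  by (simp_all add: pt_def)

lemma edge_segment_endpoint:
  assumes "q \<in> edge_segment t" "Re q \<in> \<int>" "Im q \<in> \<int>"
  shows "q \<in> {pt t, pt (Suc t)}"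
  using edge_segment_interior(1)[OF assms(1)] assms by auto

text \<open>A common point that is not a lattice point gives both edges the same midpoint, hence
  they agree up to direction. Equal direction repeats a vertex, and opposite direction forces
  \<open>t = s + 1\<close> and \<open>t + 1 = s + L\<close>, that is \<open>L = 2\<close>.\<close>

lemma edge_segment_Int:
  assumes "s < t" "t < s + L"
  shows "edge_segment s \<inter> edge_segment t \<subseteq> {pt s, pt (Suc s)} \<inter> {pt t, pt (Suc t)}"
proof
  fix q assume q: "q \<in> edge_segment s \<inter> edge_segment t"
  show "q \<in> {pt s, pt (Suc s)} \<inter> {pt t, pt (Suc t)}"
  proof (cases "Re q \<in> \<int> \<and> Im q \<in> \<int>")
    case True
    then show ?thesis using q edge_segment_endpoint by blast
  next
    case False
    then have "q \<noteq> pt s" "q \<noteq> pt (Suc s)" "q \<noteq> pt t" "q \<noteq> pt (Suc t)" by auto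
    then have *: "x s + x (Suc s) = x t + x (Suc t)" "y s + y (Suc s) = y t + y (Suc t)"
      using edge_segment_interior(2,3)[of q s] edge_segment_interior(2,3)[of q t] q by auto
    define a b c d where "a = x (Suc s) - x s" and "b = y (Suc s) - y s"
      and "c = x (Suc t) - x t" and "d = y (Suc t) - y t"
    have ab: "x (Suc s) = x s + a" "y (Suc s) = y s + b" "x (Suc t) = x t + c" "y (Suc t) = y t + d"
      by (simp_all add: a_def b_def c_def d_def)
    have "(a = 1 \<and> b = 0 \<or> a = -1 \<and> b = 0 \<or> a = 0 \<and> b = 1 \<or> a = 0 \<and> b = -1)"
      "(c = 1 \<and> d = 0 \<or> c = -1 \<and> d = 0 \<or> c = 0 \<and> d = 1 \<or> c = 0 \<and> d = -1)"
      using step[of s] step[of t] by (auto simp: unit_steps_def a_def b_def c_def d_def)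
    then have "x t = x s \<and> y t = y s \<or> x t = x (Suc s) \<and> y t = y (Suc s) \<and> x (Suc t) = x s \<and> y (Suc t) = y s"
      using unit_edge_midpoint[of a b c d "x s" "x t" "y s" "y t"] * unfolding ab by linarith
    moreover have "\<not> (x t = x s \<and> y t = y s)"
      using points_differ[OF assms] by auto
    ultimately have e: "x t = x (Suc s)" "y t = y (Suc s)" "x (Suc t) = x s" "y (Suc t) = y s" by auto
    have "t = Suc s"
      using points_differ[of "Suc s" t] e assms by (cases "Suc s < t") auto
    moreover have "Suc t = s + L"
      using points_differ[of s "Suc t"] e assms by (cases "Suc t < s + L") auto
    ultimately show ?thesis using length_ge by simp
  qed
qed

lemma pt_neq: "s < t \<Longrightarrow> t < s + L \<Longrightarrow> pt s \<noteq> pt t"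
  using points_differ[of s t] by (auto simp: pt_def complex_eq_iff)

lemma pt_periodic: "pt (t + L) = pt t"
  by (simp add: pt_def periodic_x periodic_y)

lemma arc_polypath: "Suc k < L \<Longrightarrow> arc (polypath k)"
proof (induction k)
  case 0
  then show ?case using pt_neq[of 0 1] by (simp add: arc_linepath)
next
  case (Suc k)
  have "path_image (polypath k) \<inter> path_image (linepath (pt (Suc k)) (pt (Suc (Suc k)))) \<subseteq> {pt (Suc k)}"
  proof
    fix q assume q: "q \<in> path_image (polypath k) \<inter> path_image (linepath (pt (Suc k)) (pt (Suc (Suc k))))"
    then obtain t where t: "t \<le> k" "q \<in> edge_segment t" "q \<in> edge_segment (Suc k)"
      by (auto simp: path_image_polypath edge_segment_def)
    then have "q \<in> {pt t, pt (Suc t)} \<inter> {pt (Suc k), pt (Suc (Suc k))}"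
      using edge_segment_Int[of t "Suc k"] Suc.prems by auto
    moreover have "pt t \<noteq> pt (Suc (Suc k))" "pt (Suc t) \<noteq> pt (Suc (Suc k))"
      using pt_neq[of t "Suc (Suc k)"] pt_neq[of "Suc t" "Suc (Suc k)"] t(1) Suc.prems by auto
    ultimately show "q \<in> {pt (Suc k)}" by auto
  qed
  moreover have "pt (Suc k) \<noteq> pt (Suc (Suc k))"
    using pt_neq[of "Suc k" "Suc (Suc k)"] length_ge by simp
  ultimately show ?case
    using Suc by (auto intro!: arc_join simp: arc_linepath)
qed

definition closed_path :: "real \<Rightarrow> complex" where
  "closed_path = polypath (L - 1)"

lemma path_image_closed_path: "path_image closed_path = curve"
proof -
  have "{..L - 1} = {..<L}" using length_ge by auto
  then show ?thesis by (simp add: closed_path_def path_image_polypath curve_def)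
qed

lemma closed_path_loop: "pathfinish closed_path = pathstart closed_path"
  using length_ge pt_periodic[of 0] by (simp add: closed_path_def)

lemma simple_path_closed_path: "simple_path closed_path"
proof -
  obtain k where k: "L = Suc (Suc k)" using length_ge by (cases L; cases "L - 1") auto
  have "path_image (polypath k) \<inter> path_image (linepath (pt (Suc k)) (pt (Suc (Suc k)))) \<subseteq> {pt 0, pt (Suc k)}"
  proof
    fix q assume q: "q \<in> path_image (polypath k) \<inter> path_image (linepath (pt (Suc k)) (pt (Suc (Suc k))))"
    then obtain t where t: "t \<le> k" "q \<in> edge_segment t" "q \<in> edge_segment (Suc k)"
      by (auto simp: path_image_polypath edge_segment_def)
    then have "q \<in> {pt t, pt (Suc t)} \<inter> {pt (Suc k), pt (Suc (Suc k))}"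
      using edge_segment_Int[of t "Suc k"] k by auto
    then show "q \<in> {pt 0, pt (Suc k)}" using pt_periodic[of 0] k by auto
  qed
  moreover have "pt (Suc k) \<noteq> pt (Suc (Suc k))"
    using pt_neq[of "Suc k" "Suc (Suc k)"] length_ge by simp
  ultimately have "simple_path (polypath k +++ linepath (pt (Suc k)) (pt (Suc (Suc k))))"
    using arc_polypath[of k] k pt_periodic[of 0]
    by (intro simple_path_join_loop) (auto simp: arc_linepath)
  moreover have "L - 1 = Suc k" using k by simp
  ultimately show ?thesis by (simp add: closed_path_def)
qed

section \<open>Winding numbers around cell centres\<close>

definition centre :: "int \<Rightarrow> int \<Rightarrow> complex" where
  "centre u v = Complex (u + 1/2) (v + 1/2)"

lemma half_not_int: "real_of_int k \<noteq> real_of_int l + 1/2"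
proof
  assume "real_of_int k = real_of_int l + 1/2"
  then have "real_of_int (2 * k) = real_of_int (2 * l + 1)" by simp
  then have "2 * k = 2 * l + 1" by (simp only: of_int_eq_iff)
  then show False by presburger
qed

lemma edge_segment_cases:
  assumes "q \<in> edge_segment t"
  obtains "Im q = y t" "y (Suc t) = y t"
  | "Re q = x t" "x (Suc t) = x t" "Im q \<ge> min (y t) (y (Suc t))" "Im q \<le> max (y t) (y (Suc t))"
    "\<bar>y (Suc t) - y t\<bar> = 1"
proof -
  obtain r where r: "0 \<le> r" "r \<le> 1"
    "Re q = real_of_int (x t) + r * real_of_int (x (Suc t) - x t)"
    "Im q = real_of_int (y t) + r * real_of_int (y (Suc t) - y t)"
    using mem_edge_segment[OF assms] .
  consider "y (Suc t) = y t" | "x (Suc t) = x t" "y (Suc t) = y t + 1" | "x (Suc t) = x t" "y (Suc t) = y t - 1"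
    using step[of t] by (auto simp: unit_steps_def algebra_simps)
  then show ?thesis
    using r that by cases auto
qed

lemma centre_notin_edge_segment: "centre u v \<notin> edge_segment t"
proof
  assume "centre u v \<in> edge_segment t"
  then show False
    using half_not_int[of "y t" v] half_not_int[of "x t" u]
    by (elim edge_segment_cases) (auto simp: centre_def)
qed

text \<open>\<open>Ln (- (w - c))\<close> has its cut along the ray to the right of the centre
  \<open>c\<close>. An edge off the cut uses it as a primitive. An edge crossing the cut uses
  \<open>Ln (w - c)\<close> on a right half plane; the two branches differ by i pi with opposite
  signs above and below the cut, which produces the 2 pi i.\<close>

lemma contour_integral_edge:
  "contour_integral (linepath (pt t) (pt (Suc t))) (\<lambda>w. 1 / (w - centre u v)) =
   Ln (- (pt (Suc t) - centre u v)) - Ln (- (pt t - centre u v)) +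
   2 * pi * \<i> * of_int (ray_crossing (x t - u) (y t - v) (y (Suc t) - v))"
proof -
  let ?c = "centre u v"
  consider (cross) "x t > u" "x (Suc t) = x t" "y t = v \<and> y (Suc t) = v + 1 \<or> y t = v + 1 \<and> y (Suc t) = v"
    | (other) "\<not> (x t > u \<and> x (Suc t) = x t \<and> (y t = v \<and> y (Suc t) = v + 1 \<or> y t = v + 1 \<and> y (Suc t) = v))"
    by blast
  then show ?thesis
  proof cases
    case cross
    have pos: "Re (w - ?c) > 0" if "w \<in> edge_segment t" for w
    proof -
      have "Re w = x t" using that cross by (elim mem_edge_segment) simp
      moreover have "real_of_int (x t) \<ge> real_of_int u + 1" using cross(1) by linarith
      ultimately show ?thesis by (simp add: centre_def)
    qed
    have "((\<lambda>w. 1 / (w - ?c)) has_contour_integral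
        (Ln (pathfinish (linepath (pt t) (pt (Suc t))) - ?c) - Ln (pathstart (linepath (pt t) (pt (Suc t))) - ?c)))
        (linepath (pt t) (pt (Suc t)))"
    proof (rule contour_integral_primitive[where S = "edge_segment t"])
      fix w assume "w \<in> edge_segment t"
      then have "w - ?c \<notin> \<real>\<^sub>\<le>\<^sub>0" using pos[of w] by (auto simp: complex_nonpos_Reals_iff)
      then show "((\<lambda>w. Ln (w - ?c)) has_field_derivative 1 / (w - ?c)) (at w within edge_segment t)"
        by (auto intro!: derivative_eq_intros simp: inverse_eq_divide)
    qed (auto simp: edge_segment_def)
    then have 1: "contour_integral (linepath (pt t) (pt (Suc t))) (\<lambda>w. 1 / (w - ?c)) =
        Ln (pt (Suc t) - ?c) - Ln (pt t - ?c)"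
      by (simp add: contour_integral_unique)
    have ne: "pt t - ?c \<noteq> 0" "pt (Suc t) - ?c \<noteq> 0"
      using pos[of "pt t"] pos[of "pt (Suc t)"] by (auto simp: edge_segment_def)
    have xu: "x t - u > 0" using cross by simp
    from cross(3) show ?thesis
    proof
      assume *: "y t = v \<and> y (Suc t) = v + 1"
      then have "Im (pt t - ?c) < 0" "Im (pt (Suc t) - ?c) > 0" by (auto simp: pt_def centre_def)
      then show ?thesis
        unfolding 1 Ln_minus[OF ne(1)] Ln_minus[OF ne(2)] using * xu
        by (simp add: ray_crossing_def)
    next
      assume *: "y t = v + 1 \<and> y (Suc t) = v"
      then have "Im (pt t - ?c) > 0" "Im (pt (Suc t) - ?c) < 0" by (auto simp: pt_def centre_def)
      then show ?thesis
        unfolding 1 Ln_minus[OF ne(1)] Ln_minus[OF ne(2)] using * xu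
        by (simp add: ray_crossing_def)
    qed
  next
    case other
    have rc: "ray_crossing (x t - u) (y t - v) (y (Suc t) - v) = 0"
    proof -
      have "x (Suc t) = x t" if "y (Suc t) \<noteq> y t" using step[of t] that by (auto simp: unit_steps_def)
      then show ?thesis using other by (auto simp: ray_crossing_def)
    qed
    have nonpos: "- (w - ?c) \<notin> \<real>\<^sub>\<le>\<^sub>0" if "w \<in> edge_segment t" for w
    proof
      assume "- (w - ?c) \<in> \<real>\<^sub>\<le>\<^sub>0"
      then have w: "Im w = v + 1/2" "Re w \<ge> u + 1/2"
        by (auto simp: complex_nonpos_Reals_iff centre_def)
      from that show False
      proof (cases rule: edge_segment_cases)
        case 1
        then show False using w half_not_int[of "y t" v] by simp
      next
        case 2
        have "x t > u" using w(2) 2(1) by linarith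
        moreover have "min (y t) (y (Suc t)) \<le> v" "max (y t) (y (Suc t)) \<ge> v + 1"
          using 2(3,4) w(1) by linarith+
        ultimately show False using other 2(2,5) by auto
      qed
    qed
    have "((\<lambda>w. 1 / (w - ?c)) has_contour_integral
        (Ln (- (pathfinish (linepath (pt t) (pt (Suc t))) - ?c)) - Ln (- (pathstart (linepath (pt t) (pt (Suc t))) - ?c))))
        (linepath (pt t) (pt (Suc t)))"
    proof (rule contour_integral_primitive[where S = "edge_segment t"])
      fix w assume w: "w \<in> edge_segment t"
      have "w - ?c \<noteq> 0" using centre_notin_edge_segment[of u v t] w by auto
      then show "((\<lambda>w. Ln (- (w - ?c))) has_field_derivative 1 / (w - ?c)) (at w within edge_segment t)"
        using nonpos[OF w] by (auto intro!: derivative_eq_intros simp: divide_simps)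
    qed (auto simp: edge_segment_def)
    then show ?thesis
      unfolding rc by (simp add: contour_integral_unique)
  qed
qed

lemma winding_number_edge:
  "winding_number (linepath (pt t) (pt (Suc t))) (centre u v) =
   (Ln (- (pt (Suc t) - centre u v)) - Ln (- (pt t - centre u v))) / (2 * pi * \<i>) +
   of_int (ray_crossing (x t - u) (y t - v) (y (Suc t) - v))"
  using centre_notin_edge_segment[of u v t]
  by (subst winding_number_valid_path) (auto simp: contour_integral_edge edge_segment_def field_simps)

text \<open>The logarithms telescope along the edges, so for the closed path only the integer count
  of crossings survives.\<close>

lemma winding_number_polypath:
  "winding_number (polypath k) (centre u v) =
   (Ln (- (pt (Suc k) - centre u v)) - Ln (- (pt 0 - centre u v))) / (2 * pi * \<i>) +
   of_int (\<Sum>t\<le>k. ray_crossing (x t - u) (y t - v) (y (Suc t) - v))"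
proof (induction k)
  case 0
  then show ?case using winding_number_edge[of 0] by simp
next
  case (Suc k)
  have "winding_number (polypath (Suc k)) (centre u v) =
      winding_number (polypath k) (centre u v) +
      winding_number (linepath (pt (Suc k)) (pt (Suc (Suc k)))) (centre u v)"
    unfolding polypath.simps using centre_notin_edge_segment[of u v]
    by (intro winding_number_join)
       (auto simp: path_image_polypath valid_path_imp_path simp flip: edge_segment_def)
  then show ?case
    unfolding Suc winding_number_edge by (simp add: diff_divide_distrib)
qed

lemma winding_number_closed_path:
  "winding_number closed_path (centre u v) = of_int (wind u v)"
proof -
  obtain k where k: "L = Suc k" using length_ge by (cases L) auto
  show ?thesis
    using pt_periodic[of 0] winding_number_polypath[of k u v]
    unfolding closed_path_def wind_def unfolding k by (simp add: lessThan_Suc_atMost)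
qed

text \<open>By the Jordan curve theorem the winding number is 1 or -1 inside and 0 outside, so its
  parity suffices and the orientation of the polygon is irrelevant.\<close>

lemma centre_inside_iff: "centre u v \<in> inside curve \<longleftrightarrow> odd (wind u v)"
proof -
  have notin: "centre u v \<notin> path_image closed_path"
    using centre_notin_edge_segment by (auto simp: path_image_closed_path curve_def)
  show ?thesis
  proof
    assume "centre u v \<in> inside curve"
    then have "cmod (winding_number closed_path (centre u v)) = 1"
      using simple_closed_path_norm_winding_number_inside[OF simple_path_closed_path]
      by (simp add: path_image_closed_path closed_path_loop)
    then have "\<bar>wind u v\<bar> = 1"
      unfolding winding_number_closed_path norm_of_int by linarith
    then show "odd (wind u v)" by (metis dvd_abs_iff odd_one)
  next
    assume odd: "odd (wind u v)"
    show "centre u v \<in> inside curve"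
    proof (rule ccontr)
      assume "centre u v \<notin> inside curve"
      then have "centre u v \<in> outside (path_image closed_path)"
        using notin by (simp add: path_image_closed_path outside_inside)
      then have "winding_number closed_path (centre u v) = 0"
        using simple_path_closed_path closed_path_loop
        by (intro winding_number_zero_in_outside) (auto simp: simple_path_imp_path)
      then show False using odd unfolding winding_number_closed_path by simp
    qed
  qed
qed

text \<open>The diagonal half-step from a lattice point to the centre of its north-east cell leaves
  the lattice lines at once, so it avoids the polygon and both ends lie in the same component of the
  complement.\<close>

lemma lattice_point_inside_iff:
  fixes u v :: int
  assumes "(u, v) \<notin> (\<lambda>t. (x t, y t)) ` {..<L}"
  shows "Complex u v \<in> inside curve \<longleftrightarrow> odd (wind u v)"
proof -
  let ?q = "Complex (of_int u) (of_int v)"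
  have "closed_segment ?q (centre u v) \<subseteq> - curve"
  proof
    fix w assume "w \<in> closed_segment ?q (centre u v)"
    then obtain r where r: "0 \<le> r" "r \<le> 1" "w = (1 - r) *\<^sub>R ?q + r *\<^sub>R centre u v"
      by (auto simp: in_segment)
    then have w: "Re w = u + r / 2" "Im w = v + r / 2"
      by (simp_all add: centre_def) (simp_all add: field_simps)
    show "w \<in> - curve"
    proof
      assume "w \<in> curve"
      then obtain t where t: "t < L" "w \<in> edge_segment t" by (auto simp: curve_def)
      \<comment> \<open>For 0 < r both coordinates of \<open>w\<close> lie strictly between
        integers, whereas every point of an edge has an integral coordinate.\<close>
      have nonint: "real_of_int l + r / 2 \<noteq> real_of_int k" if "r > 0" for k l
      proof
        assume "real_of_int l + r / 2 = real_of_int k"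
        then have "real_of_int l < real_of_int k" "real_of_int k < real_of_int (l + 1)"
          using that r by simp_all
        then show False by (simp only: of_int_less_iff)
      qed
      from t(2) have "r = 0"
      proof (cases rule: edge_segment_cases)
        case 1
        then show ?thesis using w r(1) nonint[of v "y t"] by linarith
      next
        case 2
        then show ?thesis using w r(1) nonint[of u "x t"] by linarith
      qed
      then have "w = ?q" using w by (simp add: complex_eq_iff)
      then have "?q \<in> {pt t, pt (Suc t)}" using edge_segment_endpoint[OF t(2)] by simp
      then consider "(u, v) = (x t, y t)" | "(u, v) = (x (Suc t), y (Suc t))"
        by (auto simp: pt_def)
      then show False
      proof cases
        case 1
        then show False using assms t by auto
      next
        case 2
        show False
        proof (cases "Suc t < L")
          case True
          then show False using assms 2 by blast
        next
          case False
          then have "Suc t = 0 + L" using t by simp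
          then have "(u, v) = (x 0, y 0)" using 2 periodic_x[of 0] periodic_y[of 0] by simp
          then show False using assms length_ge by force
        qed
      qed
    qed
  qed
  then have "connected_component (- curve) ?q (centre u v)"
    by (meson connected_component_def connected_segment(1) ends_in_segment)
  then have "?q \<in> inside curve \<longleftrightarrow> centre u v \<in> inside curve"
    by (metis connected_component_sym inside_same_component)
  then show ?thesis by (simp add: centre_inside_iff)
qed

end

section \<open>Configurations as permutations\<close>

lemma cycle_of_list_nth:
  assumes "distinct cs" "i < length cs"
  shows "(cycle_of_list cs ^^ n) (cs ! i) = cs ! ((n + i) mod length cs)"
proof -
  have "(cycle_of_list cs ^^ n) (cs ! i) = map (cycle_of_list cs ^^ n) cs ! i"
    using assms(2) by simp
  also have "\<dots> = cs ! ((n + i) mod length cs)"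
    unfolding cyclic_rotation[OF assms(1)] using assms(2) by (simp add: nth_rotate)
  finally show ?thesis .
qed

lemma cycle_of_list_neq:
  assumes "distinct cs" "2 \<le> length cs" "v \<in> set cs"
  shows "cycle_of_list cs v \<noteq> v"
proof -
  obtain i where i: "i < length cs" "v = cs ! i" using assms(3) by (metis in_set_conv_nth)
  have "cycle_of_list cs v = cs ! (Suc i mod length cs)"
    using cycle_of_list_nth[OF assms(1) i(1), of 1] i by simp
  moreover have "Suc i mod length cs \<noteq> i" "Suc i mod length cs < length cs"
    using assms(2) i(1) by (auto simp: mod_Suc)
  ultimately show ?thesis using i assms(1) by (simp add: nth_eq_iff_index_eq)
qed

lemma sign_cycle_of_list:
  "distinct cs \<Longrightarrow> sign (cycle_of_list cs) = (- 1) ^ (length cs - 1)"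
proof (induction cs rule: cycle_of_list.induct)
  case (1 i j cs)
  then show ?case
    unfolding cycle_of_list.simps
    by (subst sign_compose[OF permutation_swap_id permutation_of_cycle]) (auto simp: sign_swap_id)
qed simp_all

lemma cyclic_arcs_eq_image:
  assumes "distinct vs"
  shows "cyclic_arcs vs = (\<lambda>v. (v, cycle_of_list vs v)) ` set vs"
proof -
  have "map (cycle_of_list vs) vs = rotate1 vs"
    using cyclic_rotation[OF assms, of 1] by simp
  moreover have "set (zip vs (map f vs)) = (\<lambda>v. (v, f v)) ` set vs" for f :: "'a \<Rightarrow> 'a"
    by (induction vs) auto
  ultimately show ?thesis by (metis cyclic_arcs_def)
qed

lemma loop_vertices_cyclic_arcs: "distinct vs \<Longrightarrow> loop_vertices (cyclic_arcs vs) = set vs"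
  by (simp add: loop_vertices_def cyclic_arcs_eq_image image_image)

text \<open>The arcs of a configuration are read as the graph of a permutation, with monopoles as
  fixed points. Disjointness of the loops gives each covered vertex a unique outgoing arc, so
  \<open>THE\<close> is well defined there.\<close>

definition arc_map :: "('v \<times> 'v) set \<Rightarrow> 'v \<Rightarrow> 'v" where
  "arc_map A v = (if v \<in> fst ` A then THE w. (v, w) \<in> A else v)"

lemma arc_map_cyclic_arcs:
  assumes "distinct vs"
  shows "arc_map (cyclic_arcs vs) = cycle_of_list vs"
proof
  fix v
  show "arc_map (cyclic_arcs vs) v = cycle_of_list vs v"
    using assms id_outside_supp[of v vs]
    by (auto simp: arc_map_def cyclic_arcs_eq_image image_image)
qed

lemma arc_map_empty [simp]: "arc_map {} = id"
  by (auto simp: arc_map_def)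

lemma arc_map_Un:
  assumes "fst ` A \<inter> fst ` B = {}"
  shows "arc_map (A \<union> B) v = (if v \<in> fst ` A then arc_map A v else arc_map B v)"
proof -
  have "(v, w) \<notin> B" if "v \<in> fst ` A" for w using assms that by force
  moreover have "(v, w) \<notin> A" if "v \<notin> fst ` A" for w using that by force
  ultimately show ?thesis by (auto simp: arc_map_def image_Un)
qed

lemma Union_loop_vertices: "\<Union> (loop_vertices ` C) = fst ` \<Union> C"
  by (auto simp: loop_vertices_def)

lemma arc_map_outside: "v \<notin> \<Union> (loop_vertices ` C) \<Longrightarrow> arc_map (\<Union> C) v = v"
  by (simp add: Union_loop_vertices arc_map_def)

lemma directed_loopsE:
  assumes "l \<in> directed_loops G"
  obtains vs where "l = cyclic_arcs vs" "distinct vs" "even (length vs)" "2 \<le> length vs"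
    "set vs \<subseteq> vertices G" "loop_vertices l = set vs" "\<forall>v\<in>set vs. {v, cycle_of_list vs v} \<in> edges G"
proof -
  obtain vs where vs: "l = cyclic_arcs vs" "distinct vs" "even (length vs)" "2 \<le> length vs"
    "set vs \<subseteq> vertices G" "\<forall>(u, v)\<in>cyclic_arcs vs. {u, v} \<in> edges G"
    using assms by (auto simp: directed_loops_def)
  moreover have "{v, cycle_of_list vs v} \<in> edges G" if "v \<in> set vs" for v
    using vs(6) that by (auto simp: cyclic_arcs_eq_image[OF vs(2)])
  ultimately show ?thesis
    using that loop_vertices_cyclic_arcs[OF vs(2)] by blast
qed

lemma finite_directed_loops:
  assumes "finite (vertices G)"
  shows "finite (directed_loops G)"
proof (rule finite_subset)
  show "directed_loops G \<subseteq> Pow (vertices G \<times> vertices G)"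
  proof (rule subsetI, unfold Pow_iff)
    fix l assume "l \<in> directed_loops G"
    then obtain vs where vs: "l = cyclic_arcs vs" "set vs \<subseteq> vertices G" by (elim directed_loopsE)
    have "l \<subseteq> set vs \<times> set (rotate1 vs)"
      unfolding vs(1) cyclic_arcs_def by (meson set_zip_leftD set_zip_rightD subrelI SigmaI)
    then show "l \<subseteq> vertices G \<times> vertices G" using vs(2) by auto
  qed
qed (use assms in simp)

lemma arc_map_insert:
  assumes "distinct vs" "set vs \<inter> \<Union> (loop_vertices ` C) = {}"
    and "arc_map (\<Union> C) permutes \<Union> (loop_vertices ` C)"
  shows "arc_map (\<Union> (insert (cyclic_arcs vs) C)) = cycle_of_list vs \<circ> arc_map (\<Union> C)"
proof
  fix v
  have V: "fst ` cyclic_arcs vs = set vs" using loop_vertices_cyclic_arcs[OF assms(1)] by (simp add: loop_vertices_def)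
  have "arc_map (\<Union> (insert (cyclic_arcs vs) C)) v = (if v \<in> set vs then cycle_of_list vs v else arc_map (\<Union> C) v)"
    using assms(2) V unfolding Union_insert Union_loop_vertices
    by (subst arc_map_Un) (auto simp: arc_map_cyclic_arcs[OF assms(1)])
  also have "\<dots> = (cycle_of_list vs \<circ> arc_map (\<Union> C)) v"
  proof (cases "v \<in> \<Union> (loop_vertices ` C)")
    case True
    then have "arc_map (\<Union> C) v \<in> \<Union> (loop_vertices ` C)"
      using permutes_in_image[OF assms(3), of v] by blast
    then have "v \<notin> set vs" "arc_map (\<Union> C) v \<notin> set vs" using True assms(2) by auto
    then show ?thesis by (simp add: id_outside_supp)
  next
    case False
    then show ?thesis using arc_map_outside[of v C] id_outside_supp[of v vs] by simp
  qed
  finally show "arc_map (\<Union> (insert (cyclic_arcs vs) C)) v = (cycle_of_list vs \<circ> arc_map (\<Union> C)) v" .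
qed

text \<open>Adding a loop composes with a disjoint cycle. Loops have even length, so each is an odd
  permutation and contributes one factor -1 to the sign.\<close>

lemma arc_map_configuration:
  fixes M :: "'v \<Rightarrow> 'v \<Rightarrow> real"
  assumes "finite C" "C \<subseteq> directed_loops G" "disjoint_family_on loop_vertices C"
  shows "arc_map (\<Union> C) permutes \<Union> (loop_vertices ` C)"
    and "sign (arc_map (\<Union> C)) = (- 1) ^ card C"
    and "finite (\<Union> (loop_vertices ` C))"
    and "(\<Prod>v\<in>\<Union> (loop_vertices ` C). M v (arc_map (\<Union> C) v)) = (\<Prod>l\<in>C. \<Prod>(u, v)\<in>l. M u v)"
    and "v \<in> \<Union> (loop_vertices ` C) \<Longrightarrow> {v, arc_map (\<Union> C) v} \<in> edges G"
proof -
  have "arc_map (\<Union> C) permutes \<Union> (loop_vertices ` C) \<and> sign (arc_map (\<Union> C)) = (- 1) ^ card C \<and>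
    finite (\<Union> (loop_vertices ` C)) \<and>
    (\<Prod>v\<in>\<Union> (loop_vertices ` C). M v (arc_map (\<Union> C) v)) = (\<Prod>l\<in>C. \<Prod>(u, v)\<in>l. M u v) \<and>
    (\<forall>v\<in>\<Union> (loop_vertices ` C). {v, arc_map (\<Union> C) v} \<in> edges G)"
    using assms
  proof (induction C rule: finite_induct)
    case empty
    then show ?case by (simp add: permutes_def)
  next
    case (insert l C)
    let ?s = "arc_map (\<Union> C)" and ?V = "\<Union> (loop_vertices ` C)"
    have C: "C \<subseteq> directed_loops G" "disjoint_family_on loop_vertices C" and l: "l \<in> directed_loops G"
      using insert.prems by (auto simp: disjoint_family_on_def)
    note IH = insert.IH[OF C]
    obtain vs where vs: "l = cyclic_arcs vs" "distinct vs" "even (length vs)" "2 \<le> length vs"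
      "set vs \<subseteq> vertices G" "loop_vertices l = set vs" "\<forall>v\<in>set vs. {v, cycle_of_list vs v} \<in> edges G"
      using l by (rule directed_loopsE)
    have disj: "set vs \<inter> ?V = {}"
      using insert.prems(2) insert.hyps(2) vs(6) by (fastforce simp: disjoint_family_on_def)
    have V: "\<Union> (loop_vertices ` insert l C) = set vs \<union> ?V" using vs(6) by simp
    have eq: "arc_map (\<Union> (insert l C)) = cycle_of_list vs \<circ> ?s"
      using arc_map_insert[OF vs(2) disj] IH vs(1) by simp
    have on_vs: "(cycle_of_list vs \<circ> ?s) v = cycle_of_list vs v" if "v \<in> set vs" for v
    proof -
      have "?s v = v" by (rule arc_map_outside) (use that disj in blast)
      then show ?thesis by simp
    qed
    have on_V: "(cycle_of_list vs \<circ> ?s) v = ?s v" if "v \<in> ?V" for v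
    proof -
      have "?s v \<in> ?V" using IH that by (metis permutes_in_image)
      then show ?thesis using disj id_outside_supp[of "?s v" vs] by auto
    qed
    have "cycle_of_list vs \<circ> ?s permutes set vs \<union> ?V"
      using IH permutes_subset[OF cycle_permutes[of vs], of "set vs \<union> ?V"] permutes_subset[of ?s ?V "set vs \<union> ?V"]
      by (intro permutes_compose) auto
    moreover have "sign (cycle_of_list vs \<circ> ?s) = (- 1) ^ card (insert l C)"
    proof -
      have "permutation ?s" using IH permutation_permutes by blast
      then have "sign (cycle_of_list vs \<circ> ?s) = (- 1) ^ (length vs - 1) * (- 1) ^ card C"
        using sign_compose[OF permutation_of_cycle[of vs], of ?s] sign_cycle_of_list[OF vs(2)] IH by simp
      moreover have "odd (length vs - 1)" using vs(3,4) by presburger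
      ultimately show ?thesis using insert.hyps by simp
    qed
    moreover have "(\<Prod>v\<in>set vs \<union> ?V. M v ((cycle_of_list vs \<circ> ?s) v)) = (\<Prod>l\<in>insert l C. \<Prod>(u, v)\<in>l. M u v)"
    proof -
      have "(\<Prod>v\<in>set vs \<union> ?V. M v ((cycle_of_list vs \<circ> ?s) v)) =
          (\<Prod>v\<in>set vs. M v (cycle_of_list vs v)) * (\<Prod>v\<in>?V. M v (?s v))"
        using IH disj on_vs on_V
        by (subst prod.union_disjoint) (auto intro!: arg_cong2[where f = "(*)"] prod.cong simp del: comp_apply)
      also have "(\<Prod>v\<in>set vs. M v (cycle_of_list vs v)) = (\<Prod>(u, v)\<in>l. M u v)"
        unfolding vs(1) cyclic_arcs_eq_image[OF vs(2)]
        by (subst prod.reindex) (auto simp: inj_on_def)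
      finally show ?thesis using IH insert.hyps by simp
    qed
    moreover have "\<forall>v\<in>set vs \<union> ?V. {v, (cycle_of_list vs \<circ> ?s) v} \<in> edges G"
      using on_vs on_V vs(7) IH by (metis Un_iff)
    moreover have "finite (set vs \<union> ?V)" using IH by simp
    ultimately show ?case unfolding V eq by blast
  qed
  then show "arc_map (\<Union> C) permutes \<Union> (loop_vertices ` C)"
    "sign (arc_map (\<Union> C)) = (- 1) ^ card C"
    "finite (\<Union> (loop_vertices ` C))"
    "(\<Prod>v\<in>\<Union> (loop_vertices ` C). M v (arc_map (\<Union> C) v)) = (\<Prod>l\<in>C. \<Prod>(u, v)\<in>l. M u v)"
    "v \<in> \<Union> (loop_vertices ` C) \<Longrightarrow> {v, arc_map (\<Union> C) v} \<in> edges G"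
    by auto
qed

text \<open>A loop is the graph of the permutation restricted to the orbit of any of its vertices.
  Hence the permutation determines the configuration.\<close>

lemma directed_loop_eq_orbit:
  assumes C: "C \<subseteq> directed_loops G" "disjoint_family_on loop_vertices C"
    and l: "l \<in> C" "v \<in> loop_vertices l"
  shows "l = (\<lambda>u. (u, arc_map (\<Union> C) u)) ` range (\<lambda>k. (arc_map (\<Union> C) ^^ k) v)"
proof -
  let ?s = "arc_map (\<Union> C)"
  obtain vs where vs: "l = cyclic_arcs vs" "distinct vs" "loop_vertices l = set vs"
  proof -
    have "l \<in> directed_loops G" using l(1) C(1) by blast
    then show ?thesis by (rule directed_loopsE) (rule that)
  qed
  have s: "?s u = cycle_of_list vs u" if "u \<in> set vs" for u
  proof -
    have "\<Union> C = l \<union> \<Union> (C - {l})" using l(1) by auto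
    moreover have "fst ` l \<inter> fst ` \<Union> (C - {l}) = {}"
      using C(2) l(1) unfolding disjoint_family_on_def loop_vertices_def by blast
    moreover have "u \<in> fst ` l" using that vs(3) by (simp add: loop_vertices_def)
    ultimately have "?s u = arc_map l u" by (simp add: arc_map_Un)
    then show ?thesis by (simp add: vs(1) arc_map_cyclic_arcs[OF vs(2)])
  qed
  obtain i where i: "i < length vs" "v = vs ! i" using l(2) vs(3) by (metis in_set_conv_nth)
  have pow: "(?s ^^ k) v = vs ! ((k + i) mod length vs)" for k
  proof (induction k)
    case 0
    then show ?case using i by simp
  next
    case (Suc k)
    have "vs ! ((k + i) mod length vs) \<in> set vs" using i(1) by (intro nth_mem mod_less_divisor) auto
    then have "(?s ^^ Suc k) v = cycle_of_list vs (vs ! ((k + i) mod length vs))"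
      using Suc s by simp
    also have "\<dots> = cycle_of_list vs ((cycle_of_list vs ^^ k) v)"
      using cycle_of_list_nth[OF vs(2) i(1)] i(2) by simp
    also have "\<dots> = (cycle_of_list vs ^^ Suc k) v" by simp
    also have "\<dots> = vs ! ((Suc k + i) mod length vs)"
      using cycle_of_list_nth[OF vs(2) i(1)] i(2) by metis
    finally show ?case .
  qed
  have "range (\<lambda>k. (?s ^^ k) v) = set vs"
  proof
    show "range (\<lambda>k. (?s ^^ k) v) \<subseteq> set vs"
      using i(1) by (auto simp: pow intro!: nth_mem mod_less_divisor)
    show "set vs \<subseteq> range (\<lambda>k. (?s ^^ k) v)"
    proof
      fix u assume "u \<in> set vs"
      then obtain j where j: "j < length vs" "u = vs ! j" by (metis in_set_conv_nth)
      \<comment> \<open>Adding \<open>length vs\<close> keeps the subtraction on \<open>nat\<close>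
        from truncating when \<open>j < i\<close>.\<close>
      have "(j + length vs - i + i) mod length vs = j" using i(1) j(1) by simp
      then have "u = (?s ^^ (j + length vs - i)) v" using j pow by simp
      then show "u \<in> range (\<lambda>k. (?s ^^ k) v)" by blast
    qed
  qed
  then show ?thesis
    using s unfolding vs(1) cyclic_arcs_eq_image[OF vs(2)] by auto
qed

section \<open>Configurations correspond to permutations along edges\<close>

definition edge_permutations :: "('v, 'b) weighted_plane_graph_scheme \<Rightarrow> ('v \<Rightarrow> 'v) set" where
  "edge_permutations G = {s. s permutes vertices G \<and> (\<forall>v\<in>vertices G. s v = v \<or> {v, s v} \<in> edges G)}"

lemma even_length_alternating:
  fixes colour :: "'v \<Rightarrow> bool"
  assumes "distinct cs" "\<And>v. v \<in> set cs \<Longrightarrow> colour (cycle_of_list cs v) \<noteq> colour v"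
  shows "even (length cs)"
proof (cases "cs = []")
  case False
  define v where "v = cs ! 0"
  have v: "v \<in> set cs" using False by (auto simp: v_def)
  have "(cycle_of_list cs ^^ n) v \<in> set cs \<and> (colour ((cycle_of_list cs ^^ n) v) = (colour v = even n))" for n
    by (induction n) (use v assms(2) cycle_permutes[of cs] in \<open>auto simp: permutes_in_image\<close>)
  moreover have "(cycle_of_list cs ^^ length cs) v = v"
    using cycle_of_list_nth[OF assms(1), of 0 "length cs"] False by (simp add: v_def)
  ultimately show ?thesis by metis
qed simp

lemma cycle_decomp_permutes: "cycle_decomp I p \<Longrightarrow> p permutes I"
proof (induction rule: cycle_decomp.induct)
  case (comp I p cs)
  then show ?case
    using permutes_subset[OF cycle_permutes[of cs], of "set cs \<union> I"] permutes_subset[of p I "set cs \<union> I"]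
    by (intro permutes_compose) auto
qed (simp add: permutes_def)

text \<open>Each nontrivial cycle of the permutation becomes a loop, whose length is even because
  the graph is bipartite. Lists of length at most 1 represent the identity and add no loop.\<close>

lemma cycle_decomp_configuration:
  fixes G :: "('v, 'b) weighted_plane_graph_scheme"
  assumes bip: "\<And>u v. {u, v} \<in> edges G \<Longrightarrow> colour u \<noteq> (colour v :: bool)"
  shows "cycle_decomp I p \<Longrightarrow> finite I \<Longrightarrow> I \<subseteq> vertices G \<Longrightarrow> \<forall>v\<in>I. p v = v \<or> {v, p v} \<in> edges G \<Longrightarrow>
    \<exists>C. finite C \<and> C \<subseteq> directed_loops G \<and> disjoint_family_on loop_vertices C \<and>
      \<Union> (loop_vertices ` C) \<subseteq> I \<and> arc_map (\<Union> C) = p"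
proof (induction rule: cycle_decomp.induct)
  case empty
  show ?case by (intro exI[of _ "{}"]) (simp add: disjoint_family_on_def)
next
  case (comp I p cs)
  have p: "p permutes I" using comp.hyps(1) cycle_decomp_permutes by auto
  have on_I: "(cycle_of_list cs \<circ> p) v = p v" if "v \<in> I" for v
    using comp.hyps(3) that permutes_in_image[OF p, of v] id_outside_supp[of "p v" cs] by auto
  have on_cs: "(cycle_of_list cs \<circ> p) v = cycle_of_list cs v" if "v \<in> set cs" for v
  proof -
    have "v \<notin> I" using comp.hyps(3) that by auto
    then show ?thesis using permutes_not_in[OF p, of v] by simp
  qed
  have "\<forall>v\<in>I. p v = v \<or> {v, p v} \<in> edges G" using comp.prems(3) on_I by (metis Un_iff)
  then obtain C where C: "finite C" "C \<subseteq> directed_loops G" "disjoint_family_on loop_vertices C"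
      "\<Union> (loop_vertices ` C) \<subseteq> I" "arc_map (\<Union> C) = p"
    using comp.IH comp.prems(1,2) by auto
  show ?case
  proof (cases "2 \<le> length cs")
    case False
    then have "cycle_of_list cs = id" by (cases cs rule: cycle_of_list.cases) auto
    then show ?thesis using C by auto
  next
    case True
    have edge: "{v, cycle_of_list cs v} \<in> edges G" if "v \<in> set cs" for v
      using comp.prems(3) on_cs[OF that] cycle_of_list_neq[OF comp.hyps(2) True that] that by (metis Un_iff)
    have "even (length cs)"
      using edge bip by (intro even_length_alternating[OF comp.hyps(2), of colour]) blast
    then have l: "cyclic_arcs cs \<in> directed_loops G"
      using True comp.hyps(2) comp.prems(2) edge
      by (auto simp: directed_loops_def cyclic_arcs_eq_image intro!: exI[of _ cs])
    have disj: "set cs \<inter> \<Union> (loop_vertices ` C) = {}" using comp.hyps(3) C(4) by auto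
    have "arc_map (\<Union> (insert (cyclic_arcs cs) C)) = cycle_of_list cs \<circ> p"
      using arc_map_insert[OF comp.hyps(2) disj] arc_map_configuration(1)[OF C(1-3)] C(5) by simp
    moreover have "disjoint_family_on loop_vertices (insert (cyclic_arcs cs) C)"
      using C(3) disj loop_vertices_cyclic_arcs[OF comp.hyps(2)]
      unfolding disjoint_family_on_def by blast
    moreover have "\<Union> (loop_vertices ` insert (cyclic_arcs cs) C) \<subseteq> set cs \<union> I"
      using C(4) loop_vertices_cyclic_arcs[OF comp.hyps(2)] by auto
    ultimately show ?thesis
      using l C(1,2) by (intro exI[of _ "insert (cyclic_arcs cs) C"]) auto
  qed
qed

lemma bij_betw_configurations_edge_permutations:
  fixes G :: "('v, 'b) weighted_plane_graph_scheme"
  assumes fin: "finite (vertices G)"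
    and bip: "\<And>u v. {u, v} \<in> edges G \<Longrightarrow> colour u \<noteq> (colour v :: bool)"
  shows "bij_betw (\<lambda>C. arc_map (\<Union> C)) (monopole_dimer_configurations G) (edge_permutations G)"
proof -
  have C: "finite C" "C \<subseteq> directed_loops G" "disjoint_family_on loop_vertices C"
    if "C \<in> monopole_dimer_configurations G" for C
    using that finite_subset[OF _ finite_directed_loops[OF fin]]
    by (auto simp: monopole_dimer_configurations_def)
  have V: "\<Union> (loop_vertices ` C) \<subseteq> vertices G" if "C \<subseteq> directed_loops G" for C
    using that by (fastforce elim: directed_loopsE)
  have sub: "C \<subseteq> C'" if CC: "C \<in> monopole_dimer_configurations G" "C' \<in> monopole_dimer_configurations G"
    and eq: "arc_map (\<Union> C) = arc_map (\<Union> C')" for C C'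
  proof
    fix l assume l: "l \<in> C"
    then obtain v where v: "v \<in> loop_vertices l"
      using C(2)[OF CC(1)] by (fastforce elim!: directed_loopsE dest: subsetD simp: Suc_le_eq numeral_2_eq_2)
    then have "{v, arc_map (\<Union> C) v} \<in> edges G"
      using arc_map_configuration(5)[OF C[OF CC(1)]] l by blast
    then have "arc_map (\<Union> C') v \<noteq> v" using bip eq by fastforce
    then have "v \<in> \<Union> (loop_vertices ` C')" using arc_map_outside[of v C'] by metis
    then obtain l' where l': "l' \<in> C'" "v \<in> loop_vertices l'" by blast
    have "l = l'"
      using directed_loop_eq_orbit[OF C(2,3)[OF CC(1)] l v] directed_loop_eq_orbit[OF C(2,3)[OF CC(2)] l'] eq
      by simp
    then show "l \<in> C'" using l' by simp
  qed
  show ?thesis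
  proof (rule bij_betwI')
    fix C C' assume CC: "C \<in> monopole_dimer_configurations G" "C' \<in> monopole_dimer_configurations G"
    show "(arc_map (\<Union> C) = arc_map (\<Union> C')) = (C = C')"
      using sub CC by (metis subset_antisym)
  next
    fix C assume CC: "C \<in> monopole_dimer_configurations G"
    show "arc_map (\<Union> C) \<in> edge_permutations G"
      unfolding edge_permutations_def
      using permutes_subset[OF arc_map_configuration(1)[OF C[OF CC]] V[OF C(2)[OF CC]]]
        arc_map_configuration(5)[OF C[OF CC]] arc_map_outside[of _ C] by blast
  next
    fix s assume s: "s \<in> edge_permutations G"
    then have d: "cycle_decomp (vertices G) s"
      using fin cycle_decomposition by (auto simp: edge_permutations_def)
    have "\<forall>v\<in>vertices G. s v = v \<or> {v, s v} \<in> edges G"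
      using s by (simp add: edge_permutations_def)
    from cycle_decomp_configuration[where G = G and colour = colour, OF _ d fin subset_refl this] bip
    obtain C where "C \<subseteq> directed_loops G" "disjoint_family_on loop_vertices C" "arc_map (\<Union> C) = s"
      by metis
    then show "\<exists>C\<in>monopole_dimer_configurations G. s = arc_map (\<Union> C)"
      by (intro bexI[of _ C]) (auto simp: monopole_dimer_configurations_def)
  qed
qed

text \<open>The minus sign in assumption \<open>loop\<close> compensates for an even cycle being an
  odd permutation: the sign of the permutation and these minus signs are both
  \<open>(- 1) ^ card C\<close>.\<close>

theorem partition_function_eq_permutation_sum:
  fixes G :: "('v, 'b) weighted_plane_graph_scheme" and M :: "'v \<Rightarrow> 'v \<Rightarrow> real"
  assumes fin: "finite (vertices G)"
    and bip: "\<And>u v. {u, v} \<in> edges G \<Longrightarrow> colour u \<noteq> (colour v :: bool)"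
    and diag: "\<And>v. v \<in> vertices G \<Longrightarrow> M v v = vertex_weight G v"
    and zero: "\<And>u v. u \<in> vertices G \<Longrightarrow> v \<in> vertices G \<Longrightarrow> u \<noteq> v \<Longrightarrow> {u, v} \<notin> edges G \<Longrightarrow> M u v = 0"
    and loop: "\<And>l. l \<in> directed_loops G \<Longrightarrow> - (\<Prod>(u, v)\<in>l. M u v) = loop_weight G l"
  shows "partition_function G =
    (\<Sum>s\<in>{s. s permutes vertices G}. of_int (sign s) * (\<Prod>v\<in>vertices G. M v (s v)))"
proof -
  let ?t = "\<lambda>s. of_int (sign s) * (\<Prod>v\<in>vertices G. M v (s v))"
  have "(\<Sum>s\<in>{s. s permutes vertices G}. ?t s) = (\<Sum>s\<in>edge_permutations G. ?t s)"
  proof (rule sum.mono_neutral_right)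
    show "finite {s. s permutes vertices G}" using fin by (rule finite_permutations)
    show "edge_permutations G \<subseteq> {s. s permutes vertices G}" by (auto simp: edge_permutations_def)
    show "\<forall>s\<in>{s. s permutes vertices G} - edge_permutations G. ?t s = 0"
    proof
      fix s assume "s \<in> {s. s permutes vertices G} - edge_permutations G"
      then obtain v where v: "v \<in> vertices G" "s v \<noteq> v" "{v, s v} \<notin> edges G" "s permutes vertices G"
        by (auto simp: edge_permutations_def)
      then have "M v (s v) = 0" using zero[of v "s v"] by (simp add: permutes_in_image)
      then have "(\<Prod>v\<in>vertices G. M v (s v)) = 0" using v(1) fin by (metis prod_zero)
      then show "?t s = 0" by simp
    qed
  qed
  also have "\<dots> = (\<Sum>C\<in>monopole_dimer_configurations G. ?t (arc_map (\<Union> C)))"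
    by (rule sum.reindex_bij_betw[OF bij_betw_configurations_edge_permutations[OF fin bip], symmetric])
  also have "\<dots> = partition_function G"
    unfolding partition_function_def
  proof (rule sum.cong[OF refl])
    fix C assume CC: "C \<in> monopole_dimer_configurations G"
    have C: "finite C" "C \<subseteq> directed_loops G" "disjoint_family_on loop_vertices C"
      using CC finite_subset[OF _ finite_directed_loops[OF fin]]
      by (auto simp: monopole_dimer_configurations_def)
    let ?W = "\<Union> (loop_vertices ` C)"
    have W: "?W \<subseteq> vertices G" using C(2) by (fastforce elim: directed_loopsE)
    have "(\<Prod>v\<in>vertices G. M v (arc_map (\<Union> C) v)) =
        (\<Prod>v\<in>vertices G - ?W. M v (arc_map (\<Union> C) v)) * (\<Prod>v\<in>?W. M v (arc_map (\<Union> C) v))"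
      using W fin by (rule prod.subset_diff)
    also have "(\<Prod>v\<in>vertices G - ?W. M v (arc_map (\<Union> C) v)) = (\<Prod>v\<in>monopoles G C. vertex_weight G v)"
      unfolding monopoles_def by (intro prod.cong refl) (use arc_map_outside[of _ C] diag in auto)
    also have "(\<Prod>v\<in>?W. M v (arc_map (\<Union> C) v)) = (\<Prod>l\<in>C. \<Prod>(u, v)\<in>l. M u v)"
      by (rule arc_map_configuration(4)[OF C])
    also have "\<dots> = (\<Prod>l\<in>C. - 1 * loop_weight G l)"
      using C(2) loop by (intro prod.cong refl) (metis mult_minus1 minus_minus subsetD)
    also have "\<dots> = (- 1) ^ card C * (\<Prod>l\<in>C. loop_weight G l)"
      by (simp only: prod.distrib prod_constant)
    finally show "?t (arc_map (\<Union> C)) = configuration_weight G C"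
      unfolding arc_map_configuration(2)[OF C] configuration_weight_def
      by (simp add: flip: power_add mult.assoc)
  qed
  finally show ?thesis by simp
qed

section \<open>Kasteleyn signs on the grid\<close>

definition kasteleyn :: "real \<Rightarrow> real \<Rightarrow> real \<Rightarrow> nat \<times> nat \<Rightarrow> nat \<times> nat \<Rightarrow> real" where
  "kasteleyn a b z = (\<lambda>(i, j) (i', j').
     if i' = i \<and> j' = j then z
     else if i' = Suc i \<and> j' = j then b else if i = Suc i' \<and> j' = j then - b
     else if i' = i \<and> j' = Suc j then (- 1) ^ i * a else if i' = i \<and> j = Suc j' then - ((- 1) ^ i * a)
     else 0)"

lemma grid_edge_cases:
  assumes "{u, v} \<in> edges (grid_graph m n a b z)"
  obtains i j where "u = (i, j)" "v = (i, Suc j)" | i j where "u = (i, Suc j)" "v = (i, j)"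
  | i j where "u = (i, j)" "v = (Suc i, j)" | i j where "u = (Suc i, j)" "v = (i, j)"
  using assms by (auto simp: grid_graph_def doubleton_eq_iff)

lemma grid_edge_weight:
  "edge_weight (grid_graph m n a b z) {(i, j), (i, Suc j)} = a"
  "edge_weight (grid_graph m n a b z) {(i, j), (Suc i, j)} = b"
  "edge_weight (grid_graph m n a b z) {(i, Suc j), (i, j)} = a"
  "edge_weight (grid_graph m n a b z) {(Suc i, j), (i, j)} = b"
  by (auto simp: grid_graph_def doubleton_eq_iff)

text \<open>Only the parity of \<open>arc_sign\<close> matters; it is written so that its sum along a cycle contains the signed area.\<close>

definition arc_sign :: "nat \<times> nat \<Rightarrow> nat \<times> nat \<Rightarrow> int" where
  "arc_sign u v = of_bool (int (fst v) - int (fst u) = -1 \<or> int (snd v) - int (snd u) = -1) +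
     int (fst u) * (int (snd v) - int (snd u))"

lemma kasteleyn_edge:
  assumes "{u, v} \<in> edges (grid_graph m n a b z)"
  shows "kasteleyn a b z u v =
    (if even (arc_sign u v) then 1 else - 1) * edge_weight (grid_graph m n a b z) {u, v}"
  using assms
  by (cases rule: grid_edge_cases) (simp_all add: kasteleyn_def arc_sign_def grid_edge_weight minus_one_power_iff)

lemma prod_parity:
  fixes k :: "'i \<Rightarrow> int"
  assumes "finite A"
  shows "(\<Prod>i\<in>A. if even (k i) then 1 else - 1 :: real) = (if even (\<Sum>i\<in>A. k i) then 1 else - 1)"
  using assms by (induction A rule: finite_induct) auto

lemma cyclic_arcs_nth:
  assumes "distinct vs"
  shows "cyclic_arcs vs = (\<lambda>t. (vs ! (t mod length vs), vs ! (Suc t mod length vs))) ` {..<length vs}"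
proof -
  have "cycle_of_list vs (vs ! t) = vs ! (Suc t mod length vs)" if "t < length vs" for t
    using cycle_of_list_nth[OF assms that, of 1] by simp
  then have "cyclic_arcs vs = (\<lambda>t. (vs ! t, vs ! (Suc t mod length vs))) ` {..<length vs}"
    unfolding cyclic_arcs_eq_image[OF assms] set_conv_nth by force
  also have "\<dots> = (\<lambda>t. (vs ! (t mod length vs), vs ! (Suc t mod length vs))) ` {..<length vs}"
    by (intro image_cong) auto
  finally show ?thesis .
qed

lemma cyclic_arcs_rotate:
  assumes "distinct vs"
  shows "cyclic_arcs (rotate n vs) = cyclic_arcs vs"
  using assms cycle_of_list_rotate_independent[OF assms, of n] by (simp add: cyclic_arcs_eq_image)

text \<open>The two opposite entries are negatives of each other, so minus their product is the
  squared edge weight. The curve is a single segment, which is convex and encloses nothing.\<close>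

lemma kasteleyn_doubled_edge:
  assumes "cyclic_arcs [u, v] \<in> directed_loops (grid_graph m n a b z)" "u \<noteq> v"
  shows "- (\<Prod>(u, v)\<in>cyclic_arcs [u, v]. kasteleyn a b z u v) = loop_weight (grid_graph m n a b z) (cyclic_arcs [u, v])"
proof -
  let ?G = "grid_graph m n a b z"
  have arcs: "cyclic_arcs [u, v] = {(u, v), (v, u)}" by (simp add: cyclic_arcs_def)
  have "loop_curve ?G (cyclic_arcs [u, v]) = closed_segment (position ?G u) (position ?G v)"
    unfolding arcs loop_curve_def by (simp add: closed_segment_commute)
  then have "inside (loop_curve ?G (cyclic_arcs [u, v])) = {}" by (simp add: inside_convex)
  then have 1: "enclosed_count ?G (cyclic_arcs [u, v]) = 0" by (simp add: enclosed_count_def)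
  have "{u, v} \<in> edges ?G"
    using assms(1) unfolding arcs directed_loops_def by (auto simp: insert_commute) (metis (no_types, lifting) case_prodD insertI1)
  then have "- (kasteleyn a b z u v * kasteleyn a b z v u) = edge_weight ?G {u, v} * edge_weight ?G {v, u}"
    by (cases rule: grid_edge_cases) (simp_all add: kasteleyn_def grid_edge_weight minus_one_power_iff)
  then show ?thesis using assms(2) unfolding loop_weight_def 1 unfolding arcs by simp
qed

text \<open>Supplies the starting vertex for the turning argument: lowest, and rightmost among the
  lowest.\<close>

lemma ex_lexicographic_extremum:
  fixes p :: "nat \<Rightarrow> nat \<times> nat"
  assumes "n > 0" "inj_on p {..<n}"
  obtains t0 where "t0 < n" "\<And>t. t < n \<Longrightarrow> t \<noteq> t0 \<Longrightarrow> snd (p t) > snd (p t0) \<or> snd (p t) = snd (p t0) \<and> fst (p t) < fst (p t0)"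
proof -
  define ymin where "ymin = Min ((\<lambda>t. snd (p t)) ` {..<n})"
  have "ymin \<in> (\<lambda>t. snd (p t)) ` {..<n}" unfolding ymin_def using assms(1) by (intro Min_in) auto
  then have ne: "{t. t < n \<and> snd (p t) = ymin} \<noteq> {}" by auto
  have ymin: "ymin \<le> snd (p t)" if "t < n" for t unfolding ymin_def using that by (intro Min_le) auto
  define xmax where "xmax = Max ((\<lambda>t. fst (p t)) ` {t. t < n \<and> snd (p t) = ymin})"
  have "xmax \<in> (\<lambda>t. fst (p t)) ` {t. t < n \<and> snd (p t) = ymin}" unfolding xmax_def using ne by (intro Max_in) auto
  then obtain t0 where t0: "t0 < n" "snd (p t0) = ymin" "fst (p t0) = xmax" by auto
  have xmax: "fst (p t) \<le> xmax" if "t < n" "snd (p t) = ymin" for t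
    unfolding xmax_def using that by (intro Max_ge) auto
  show ?thesis
  proof (rule that[OF t0(1)])
    fix t assume t: "t < n" "t \<noteq> t0"
    have "p t \<noteq> p t0" using assms(2) t t0(1) by (auto simp: inj_on_def)
    then have "snd (p t) \<noteq> ymin \<or> fst (p t) \<noteq> xmax" using t0 by (auto simp: prod_eq_iff)
    then show "snd (p t) > snd (p t0) \<or> snd (p t) = snd (p t0) \<and> fst (p t) < fst (p t0)"
      using ymin[OF t(1)] xmax[OF t(1)] t0 by linarith
  qed
qed

lemma grid_positions:
  "position (grid_graph m n a b z) v = Complex (of_int (int (fst v))) (of_int (int (snd v)))"
  by (simp add: grid_graph_def case_prod_beta)

text \<open>The vertex list, indexed modulo its length, is a lattice polygon. Its sign product has
  the exponent occurring in \<open>pick_parity\<close>, hence equals minus (-1) to the number of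
  enclosed vertices.\<close>

lemma kasteleyn_cycle:
  fixes m n :: nat and a b z :: real
  defines "G \<equiv> grid_graph m n a b z"
  assumes vs: "distinct vs" "length vs \<ge> 4" "set vs \<subseteq> vertices G"
    and edge: "\<And>u v. (u, v) \<in> cyclic_arcs vs \<Longrightarrow> {u, v} \<in> edges G"
    and base: "\<And>t. 0 < t \<Longrightarrow> t < length vs \<Longrightarrow> snd (vs ! t) > snd (vs ! 0) \<or>
      snd (vs ! t) = snd (vs ! 0) \<and> fst (vs ! t) < fst (vs ! 0)"
  shows "- (\<Prod>(u, v)\<in>cyclic_arcs vs. kasteleyn a b z u v) = loop_weight G (cyclic_arcs vs)"
proof -
  let ?L = "length vs"
  define p where "p t = vs ! (t mod ?L)" for t
  define x y where "x t = int (fst (p t))" and "y t = int (snd (p t))" for t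
  have L0: "?L > 0" using vs(2) by linarith
  have arcs: "cyclic_arcs vs = (\<lambda>t. (p t, p (Suc t))) ` {..<?L}"
    unfolding p_def by (rule cyclic_arcs_nth[OF vs(1)])
  have p_set: "p t \<in> set vs" for t using L0 by (simp add: p_def)
  have arc: "{p t, p (Suc t)} \<in> edges G" for t
  proof -
    have "(p (t mod ?L), p (Suc (t mod ?L))) \<in> cyclic_arcs vs" unfolding arcs using L0 by auto
    moreover have "p (t mod ?L) = p t" "p (Suc (t mod ?L)) = p (Suc t)" by (simp_all add: p_def mod_Suc_eq)
    ultimately show ?thesis using edge by simp
  qed
  have p_eq: "p s = p t \<longleftrightarrow> s mod ?L = t mod ?L" for s t
    using L0 by (simp add: p_def nth_eq_iff_index_eq[OF vs(1)])
  interpret lattice_polygon ?L x y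
  proof
    show "4 \<le> ?L" by (rule vs(2))
    show "x (t + ?L) = x t" "y (t + ?L) = y t" for t by (simp_all add: x_def y_def p_def)
    show "(x (Suc t) - x t, y (Suc t) - y t) \<in> unit_steps" for t
      using arc[of t] unfolding G_def
      by (cases rule: grid_edge_cases) (simp_all add: x_def y_def unit_steps_def)
    show "(x (t + d), y (t + d)) \<noteq> (x t, y t)" if d: "0 < d" "d < ?L" for d t
    proof
      assume "(x (t + d), y (t + d)) = (x t, y t)"
      then have "p (t + d) = p t" by (simp add: x_def y_def prod_eq_iff)
      then have "(t + d) mod ?L = t mod ?L" by (simp add: p_eq)
      then have "?L dvd d" by (metis add_diff_cancel_left' le_add1 mod_eq_dvd_iff_nat)
      then show False using d by (simp add: nat_dvd_not_less)
    qed
  qed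
  have box: "x s \<in> {1..int m}" "y s \<in> {1..int n}" for s
    using vs(3) p_set[of s] by (auto simp: G_def grid_graph_def grid_vertices_def x_def y_def)
  have base': "y t > y 0 \<or> y t = y 0 \<and> x t < x 0" if "0 < t" "t < ?L" for t
    using base[OF that] that L0 by (auto simp: x_def y_def p_def)
  have inj: "inj_on (\<lambda>t. (p t, p (Suc t))) {..<?L}"
    by (auto simp: inj_on_def p_eq)
  let ?P = "(\<lambda>t. (x t, y t)) ` {..<?L}"
  have curve: "loop_curve G (cyclic_arcs vs) = curve"
    unfolding loop_curve_def arcs curve_def edge_segment_def pt_def G_def
    by (simp add: grid_positions x_def y_def)
  have sgn: "arc_sign (p t) (p (Suc t)) = backward t + x t * (y (Suc t) - y t)" for t
    by (simp add: arc_sign_def backward_def x_def y_def)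
  \<comment> \<open>Matches the enclosed grid vertices with the integer points counted by
    \<open>pick_parity\<close>. Vertices of the cycle are removed on the right because
    \<open>inside\<close> never contains points of the curve, whatever the parity of
    \<open>wind\<close> there.\<close>
  have im: "(\<lambda>v. (int (fst v), int (snd v))) ` {v \<in> vertices G. position G v \<in> inside (loop_curve G (cyclic_arcs vs))} =
      {(u, v) \<in> {1..int m} \<times> {1..int n} - ?P. odd (wind u v)}" (is "?f ` ?A = ?B")
  proof (intro equalityI subsetI)
    fix q assume "q \<in> ?f ` ?A"
    then obtain v where v: "v \<in> vertices G" "position G v \<in> inside curve" "q = ?f v" by (auto simp: curve)
    have notin: "?f v \<notin> ?P"
    proof
      assume "?f v \<in> ?P"
      then obtain t where t: "t < ?L" "?f v = (x t, y t)" by auto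
      then have "position G v = pt t" by (simp add: G_def grid_positions pt_def)
      moreover have "pt t \<in> curve" using t(1) by (auto simp: curve_def edge_segment_def)
      ultimately show False using v(2) inside_no_overlap[of curve] by (metis IntI empty_iff)
    qed
    then show "q \<in> ?B"
      using v lattice_point_inside_iff[OF notin]
      by (auto simp: G_def grid_positions grid_graph_def grid_vertices_def)
  next
    fix q assume "q \<in> ?B"
    then obtain u v where uv: "q = (u, v)" "u \<in> {1..int m}" "v \<in> {1..int n}" "(u, v) \<notin> ?P" "odd (wind u v)"
      by auto
    have "(nat u, nat v) \<in> ?A"
      using uv lattice_point_inside_iff[OF uv(4)] unfolding curve
      by (auto simp: G_def grid_positions grid_graph_def grid_vertices_def)
    moreover have "q = ?f (nat u, nat v)" using uv by simp
    ultimately show "q \<in> ?f ` ?A" by blast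
  qed
  have inj_f: "inj_on ?f ?A" by (auto simp: inj_on_def)
  have "enclosed_count G (cyclic_arcs vs) = card ?B"
    unfolding enclosed_count_def im[symmetric] by (rule card_image[OF inj_f, symmetric])
  then have parity: "even (int (enclosed_count G (cyclic_arcs vs)) + 1 + (\<Sum>t<?L. arc_sign (p t) (p (Suc t))))"
    using pick_parity[of "int m" "int n"] box base' sgn by simp
  have prod: "(\<Prod>(u, v)\<in>cyclic_arcs vs. f u v) = (\<Prod>t<?L. f (p t) (p (Suc t)))" for f :: "nat \<times> nat \<Rightarrow> nat \<times> nat \<Rightarrow> real"
    unfolding arcs by (subst prod.reindex[OF inj]) simp
  have "(\<Prod>t<?L. kasteleyn a b z (p t) (p (Suc t))) =
      (\<Prod>t<?L. (if even (arc_sign (p t) (p (Suc t))) then 1 else - 1) * edge_weight G {p t, p (Suc t)})"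
    using arc unfolding G_def by (intro prod.cong refl kasteleyn_edge)
  also have "\<dots> = (if even (\<Sum>t<?L. arc_sign (p t) (p (Suc t))) then 1 else - 1) * (\<Prod>t<?L. edge_weight G {p t, p (Suc t)})"
    by (simp add: prod.distrib prod_parity)
  also have "(if even (\<Sum>t<?L. arc_sign (p t) (p (Suc t))) then 1 else - 1 :: real) = - ((- 1) ^ enclosed_count G (cyclic_arcs vs))"
    using parity by (auto simp: minus_one_power_iff)
  finally show ?thesis
    unfolding loop_weight_def prod by simp
qed

lemma kasteleyn_loop:
  assumes "l \<in> directed_loops (grid_graph m n a b z)"
  shows "- (\<Prod>(u, v)\<in>l. kasteleyn a b z u v) = loop_weight (grid_graph m n a b z) l"
proof -
  let ?G = "grid_graph m n a b z"
  obtain vs where vs: "l = cyclic_arcs vs" "distinct vs" "even (length vs)" "2 \<le> length vs"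
    "set vs \<subseteq> vertices ?G" "\<forall>v\<in>set vs. {v, cycle_of_list vs v} \<in> edges ?G"
    using assms by (rule directed_loopsE)
  show ?thesis
  proof (cases "length vs = 2")
    case True
    then obtain u v where "vs = [u, v]" by (auto simp: length_Suc_conv numeral_2_eq_2)
    then show ?thesis using kasteleyn_doubled_edge assms vs(1,2) by auto
  next
    case False
    then have len: "length vs \<ge> 4" using vs(3,4) by presburger
    have "inj_on (\<lambda>t. vs ! t) {..<length vs}" using vs(2) by (simp add: inj_on_nth)
    then obtain t0 where t0: "t0 < length vs"
      "\<And>t. t < length vs \<Longrightarrow> t \<noteq> t0 \<Longrightarrow> snd (vs ! t) > snd (vs ! t0) \<or> snd (vs ! t) = snd (vs ! t0) \<and> fst (vs ! t) < fst (vs ! t0)"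
      using ex_lexicographic_extremum[of "length vs" "\<lambda>t. vs ! t"] len by (metis gr_zeroI not_numeral_le_zero)
    have "- (\<Prod>(u, v)\<in>cyclic_arcs (rotate t0 vs). kasteleyn a b z u v) = loop_weight ?G (cyclic_arcs (rotate t0 vs))"
    proof (rule kasteleyn_cycle)
      show "distinct (rotate t0 vs)" "4 \<le> length (rotate t0 vs)" "set (rotate t0 vs) \<subseteq> vertices ?G"
        using vs len by auto
      show "{u, v} \<in> edges ?G" if "(u, v) \<in> cyclic_arcs (rotate t0 vs)" for u v
        using that vs(6) unfolding cyclic_arcs_rotate[OF vs(2)] cyclic_arcs_eq_image[OF vs(2)] by auto
      fix t assume t: "0 < t" "t < length (rotate t0 vs)"
      then have "(t0 + t) mod length vs \<noteq> t0"
        using t0(1) by (auto simp: mod_if)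
      have "(t0 + t) mod length vs < length vs" using t0(1) by (intro mod_less_divisor) linarith
      moreover have "rotate t0 vs ! 0 = vs ! t0" using nth_rotate[of 0 vs t0] t0(1) by (cases "vs = []") auto
      ultimately show "snd (rotate t0 vs ! 0) < snd (rotate t0 vs ! t) \<or>
        snd (rotate t0 vs ! t) = snd (rotate t0 vs ! 0) \<and> fst (rotate t0 vs ! t) < fst (rotate t0 vs ! 0)"
        using t t0(1) t0(2)[of "(t0 + t) mod length vs"] \<open>(t0 + t) mod length vs \<noteq> t0\<close> by (simp add: nth_rotate)
    qed
    then show ?thesis by (simp add: cyclic_arcs_rotate[OF vs(2)] vs(1))
  qed
qed

theorem partition_function_grid:
  "partition_function (grid_graph m n a b z) =
    (\<Sum>s\<in>{s. s permutes grid_vertices m n}. of_int (sign s) * (\<Prod>v\<in>grid_vertices m n. kasteleyn a b z v (s v)))"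
proof -
  let ?G = "grid_graph m n a b z"
  have V: "vertices ?G = grid_vertices m n" by (simp add: grid_graph_def)
  have "partition_function ?G =
    (\<Sum>s\<in>{s. s permutes vertices ?G}. of_int (sign s) * (\<Prod>v\<in>vertices ?G. kasteleyn a b z v (s v)))"
  proof (rule partition_function_eq_permutation_sum[where colour = "\<lambda>(i, j). even (i + j)"])
    show "finite (vertices ?G)" by (simp add: V grid_vertices_def)
    show "(case u of (i, j) \<Rightarrow> even (i + j)) \<noteq> (case v of (i, j) \<Rightarrow> even (i + j))" if "{u, v} \<in> edges ?G" for u v
      using that by (cases rule: grid_edge_cases) auto
    show "kasteleyn a b z v v = vertex_weight ?G v" for v
      by (cases v) (simp add: kasteleyn_def grid_graph_def)
    show "- (\<Prod>(u, v)\<in>l. kasteleyn a b z u v) = loop_weight ?G l" if "l \<in> directed_loops ?G" for l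
      using that by (rule kasteleyn_loop)
    fix u v assume uv: "u \<in> vertices ?G" "v \<in> vertices ?G" "u \<noteq> v" "{u, v} \<notin> edges ?G"
    obtain i j i' j' where ij: "u = (i, j)" "v = (i', j')" by (metis surj_pair)
    have "\<not> (i' = Suc i \<and> j' = j)" "\<not> (i = Suc i' \<and> j' = j)" "\<not> (i' = i \<and> j' = Suc j)" "\<not> (i' = i \<and> j = Suc j')"
      using uv(1,2,4) unfolding ij V by (auto simp: grid_graph_def insert_commute)
    then show "kasteleyn a b z u v = 0" using uv(3) unfolding ij kasteleyn_def by auto
  qed
  then show ?thesis by (simp only: V)
qed

section \<open>Evaluation of the determinant\<close>

text \<open>The Leibniz formula is taken over an arbitrary index set, so vertices and frequency
  pairs can serve as indices; an enumeration enters only in transferring the matrix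
  identities.\<close>

definition set_det :: "'v set \<Rightarrow> ('v \<Rightarrow> 'v \<Rightarrow> 'a::comm_ring_1) \<Rightarrow> 'a" where
  "set_det V M = (\<Sum>s\<in>{s. s permutes V}. of_int (sign s) * (\<Prod>v\<in>V. M v (s v)))"

lemma set_det_eq_det:
  assumes f: "bij_betw f {0..<n} V"
  shows "set_det V M = Determinant.det (Matrix.mat n n (\<lambda>(i, j). M (f i) (f j)))"
proof -
  let ?N = "{0..<n}" and ?g = "inv_into {0..<n} f"
  let ?A = "Matrix.mat n n (\<lambda>(i, j). M (f i) (f j))"
  have inj: "inj_on f ?N" using f by (simp add: bij_betw_def)
  have g: "bij_betw ?g V ?N" using f by (rule bij_betw_inv_into)
  have "Determinant.det ?A = (\<Sum>p\<in>{p. p permutes ?N}. of_int (sign p) * (\<Prod>i\<in>?N. ?A $$ (i, p i)))"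
    by (rule det_def') simp
  also have "\<dots> = set_det V M"
    unfolding set_det_def
  proof (rule sum.reindex_bij_witness[of _ "map_permutation V ?g" "map_permutation ?N f"])
    fix p assume "p \<in> {p. p permutes ?N}"
    then have p: "p permutes ?N" by simp
    show "map_permutation V ?g (map_permutation ?N f p) = p"
      using f p by (rule map_permutation_compose_inv) (use inj in simp)
    show "map_permutation ?N f p \<in> {s. s permutes V}"
      using map_permutation_permutes[OF f p] by simp
    have "(\<Prod>v\<in>V. M v (map_permutation ?N f p v)) = (\<Prod>i\<in>?N. M (f i) (map_permutation ?N f p (f i)))"
      by (rule prod.reindex_bij_betw[OF f, symmetric])
    also have "\<dots> = (\<Prod>i\<in>?N. ?A $$ (i, p i))"
      using permutes_in_image[OF p] by (intro prod.cong refl) (auto simp: map_permutation_apply[OF inj])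
    finally show "of_int (sign (map_permutation ?N f p)) * (\<Prod>v\<in>V. M v (map_permutation ?N f p v)) =
        of_int (sign p) * (\<Prod>i\<in>?N. ?A $$ (i, p i))"
      using sign_map_permutation[OF inj p] by simp
  next
    fix s assume "s \<in> {s. s permutes V}"
    then have s: "s permutes V" by simp
    show "map_permutation ?N f (map_permutation V ?g s) = s"
      using g s by (rule map_permutation_compose_inv) (use f in \<open>simp add: bij_betw_inv_into_right\<close>)
    show "map_permutation V ?g s \<in> {p. p permutes ?N}"
      using map_permutation_permutes[OF g s] by simp
  qed
  finally show ?thesis by simp
qed

lemma set_det_mult:
  assumes "finite V"
  shows "set_det V A * set_det V B = set_det V (\<lambda>u w. \<Sum>v\<in>V. A u v * B v w)"
proof -
  obtain f where f: "bij_betw f {0..<card V} V" using ex_bij_betw_nat_finite[OF assms] by blast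
  have "Matrix.mat (card V) (card V) (\<lambda>(i, j). \<Sum>v\<in>V. A (f i) v * B v (f j)) =
      Matrix.mat (card V) (card V) (\<lambda>(i, j). A (f i) (f j)) * Matrix.mat (card V) (card V) (\<lambda>(i, j). B (f i) (f j))"
    by (rule eq_matI) (simp_all add: scalar_prod_def sum.reindex_bij_betw[OF f, symmetric])
  then show ?thesis
    unfolding set_det_eq_det[OF f] by (simp add: det_mult[of _ "card V"])
qed

lemma set_det_transpose:
  assumes "finite V"
  shows "set_det V (\<lambda>u v. M v u) = set_det V M"
proof -
  obtain f where f: "bij_betw f {0..<card V} V" using ex_bij_betw_nat_finite[OF assms] by blast
  have "Matrix.mat (card V) (card V) (\<lambda>(i, j). M (f j) (f i)) =
      transpose_mat (Matrix.mat (card V) (card V) (\<lambda>(i, j). M (f i) (f j)))"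
    by (rule eq_matI) simp_all
  then show ?thesis
    unfolding set_det_eq_det[OF f] by (simp add: Determinant.det_transpose[of _ "card V"])
qed

lemma set_det_diagonal:
  assumes "finite V"
  shows "set_det V (\<lambda>u v. if u = v then d u else 0) = (\<Prod>v\<in>V. d v)"
proof -
  have "set_det V (\<lambda>u v. if u = v then d u else 0) =
      (\<Sum>s\<in>{id}. of_int (sign s) * (\<Prod>v\<in>V. if v = s v then d v else 0))"
    unfolding set_det_def
  proof (rule sum.mono_neutral_right)
    show "finite {s. s permutes V}" using assms by (rule finite_permutations)
    show "{id} \<subseteq> {s. s permutes V}" by (simp add: permutes_id)
    show "\<forall>s\<in>{s. s permutes V} - {id}. of_int (sign s) * (\<Prod>v\<in>V. if v = s v then d v else 0) = 0"
    proof
      fix s assume s: "s \<in> {s. s permutes V} - {id}"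
      then obtain v where v: "s v \<noteq> v" by (auto simp: fun_eq_iff)
      moreover have "v \<in> V" using s v permutes_not_in[of s V v] by auto
      ultimately have "(\<Prod>v\<in>V. if v = s v then d v else 0) = 0"
        using assms by (intro prod_zero bexI[of _ v]) (use v in auto)
      then show "of_int (sign s) * (\<Prod>v\<in>V. if v = s v then d v else 0) = 0" by simp
    qed
  qed
  then show ?thesis by simp
qed

lemma set_det_of_real:
  "set_det V (\<lambda>u v. of_real (M u v) :: complex) = of_real (set_det V M)"
  by (simp add: set_det_def)

lemma set_det_cong:
  assumes "\<And>u v. u \<in> V \<Longrightarrow> v \<in> V \<Longrightarrow> A u v = B u v"
  shows "set_det V A = set_det V B"
  unfolding set_det_def
  by (intro sum.cong refl arg_cong2[where f = "(*)"] prod.cong) (use assms in \<open>auto simp: permutes_in_image\<close>)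

section \<open>The discrete sine transform on a path\<close>

definition dst :: "nat \<Rightarrow> nat \<Rightarrow> nat \<Rightarrow> real" where
  "dst m k i = sin (pi * real k * real i / real (m + 1))"

text \<open>Multiplication by 2 sin (theta/2) makes the sum telescope. The bounds on
  \<open>r\<close> put theta/2 strictly between 0 and pi, so this factor can be cancelled.\<close>

lemma sum_cos_multiples:
  assumes "0 < r" "r < 2 * N"
  shows "(\<Sum>i<N. cos (pi * real r * real i / real N)) = (1 - (- 1) ^ r) / 2"
proof -
  define \<theta> where "\<theta> = pi * real r / real N"
  have N: "real N > 0" using assms by simp
  have "\<theta> / 2 < pi" "\<theta> / 2 > 0"
    using assms N by (auto simp: \<theta>_def field_simps simp flip: of_nat_mult)
  then have pos: "sin (\<theta> / 2) > 0" by (intro sin_gt_zero)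
  have step: "2 * sin (\<theta> / 2) * cos (real i * \<theta>) = sin ((real (Suc i) - 1/2) * \<theta>) - sin ((real i - 1/2) * \<theta>)" for i
  proof -
    have "(real (Suc i) - 1/2) * \<theta> = real i * \<theta> + \<theta> / 2" "(real i - 1/2) * \<theta> = real i * \<theta> - \<theta> / 2"
      by (simp_all add: algebra_simps)
    then show ?thesis by (simp add: sin_add sin_diff)
  qed
  have "2 * sin (\<theta> / 2) * (\<Sum>i<N. cos (real i * \<theta>)) = sin ((real N - 1/2) * \<theta>) - sin ((real 0 - 1/2) * \<theta>)"
    unfolding sum_distrib_left step by (rule sum_lessThan_telescope)
  also have "(real N - 1/2) * \<theta> = pi * real r - \<theta> / 2" using N by (simp add: \<theta>_def field_simps)
  also have "sin (pi * real r - \<theta> / 2) - sin ((real 0 - 1/2) * \<theta>) = (1 - (- 1) ^ r) * sin (\<theta> / 2)"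
    by (simp add: sin_diff algebra_simps)
  finally have "sin (\<theta> / 2) * (2 * (\<Sum>i<N. cos (real i * \<theta>))) = sin (\<theta> / 2) * (1 - (- 1) ^ r)"
    by (simp only: mult_ac)
  then have "2 * (\<Sum>i<N. cos (real i * \<theta>)) = 1 - (- 1) ^ r"
    using pos by (simp only: mult_cancel_left) auto
  moreover have "real i * \<theta> = pi * real r * real i / real N" for i by (simp add: \<theta>_def)
  ultimately show ?thesis by simp
qed

text \<open>A product of sines is half a difference of cosines with frequencies \<open>l - k\<close>
  and \<open>k + l\<close>. These have equal parity, so their cosine sums agree unless
  \<open>l - k = 0\<close>.\<close>

lemma dst_orthogonal:
  assumes "k \<in> {1..m}" "l \<in> {1..m}"
  shows "(\<Sum>i=1..m. dst m k i * dst m l i) = (if k = l then real (m + 1) / 2 else 0)"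
proof -
  have le: "(\<Sum>i=1..m. dst m k i * dst m l i) = (if k = l then real (m + 1) / 2 else 0)"
    if le: "k \<le> l" "k \<in> {1..m}" "l \<in> {1..m}" for k l
  proof -
  let ?N = "m + 1"
  have "(\<Sum>i=1..m. dst m k i * dst m l i) = (\<Sum>i<?N. dst m k i * dst m l i)"
    by (rule sum.mono_neutral_left) (auto simp: dst_def not_less_eq_eq)
  also have "\<dots> = (\<Sum>i<?N. (cos (pi * real (l - k) * real i / real ?N) - cos (pi * real (k + l) * real i / real ?N)) / 2)"
  proof (rule sum.cong[OF refl])
    fix i
    have "pi * real k * real i / real ?N - pi * real l * real i / real ?N = - (pi * real (l - k) * real i / real ?N)"
      by (simp add: of_nat_diff[OF le(1)] left_diff_distrib right_diff_distrib diff_divide_distrib)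
    then have *: "cos (pi * real k * real i / real ?N - pi * real l * real i / real ?N) = cos (pi * real (l - k) * real i / real ?N)"
      by (simp only: cos_minus)
    have "pi * real k * real i / real ?N + pi * real l * real i / real ?N = pi * real (k + l) * real i / real ?N"
      by (simp add: distrib_left distrib_right add_divide_distrib)
    then show "dst m k i * dst m l i = (cos (pi * real (l - k) * real i / real ?N) - cos (pi * real (k + l) * real i / real ?N)) / 2"
      unfolding dst_def sin_times_sin * by simp
  qed
  also have "\<dots> = ((\<Sum>i<?N. cos (pi * real (l - k) * real i / real ?N)) - (\<Sum>i<?N. cos (pi * real (k + l) * real i / real ?N))) / 2"
    unfolding sum_subtractf[symmetric] sum_divide_distrib ..
  also have "(\<Sum>i<?N. cos (pi * real (k + l) * real i / real ?N)) = (1 - (- 1) ^ (k + l)) / 2"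
    using le by (intro sum_cos_multiples) auto
  also have "(\<Sum>i<?N. cos (pi * real (l - k) * real i / real ?N)) = (if k = l then real ?N else (1 - (- 1) ^ (l - k)) / 2)"
    using le sum_cos_multiples[of "l - k" ?N] by auto
  also have "(- 1 :: real) ^ (k + l) = (- 1) ^ (l - k)"
    using le(1) by (simp add: minus_one_power_iff even_diff_nat)
  finally show ?thesis by (auto simp: minus_one_power_iff)
  qed
  show ?thesis
  proof (cases "k \<le> l")
    case False
    then have "(\<Sum>i=1..m. dst m l i * dst m k i) = (if l = k then real (m + 1) / 2 else 0)"
      using le[of l k] assms by simp
    then show ?thesis using False by (simp add: mult.commute)
  qed (use le assms in blast)
qed

lemma dst_boundary [simp]: "dst m k 0 = 0" "dst m k (Suc m) = 0"
  by (simp_all add: dst_def)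

lemma dst_neighbours: "dst m k (Suc (Suc p)) + dst m k p = 2 * cos (pi * real k / real (m + 1)) * dst m k (Suc p)"
proof -
  define t where "t = pi * real k / real (m + 1)"
  have e: "pi * real k * real i / real (m + 1) = real i * t" for i by (simp add: t_def)
  have "real (Suc (Suc p)) * t = real (Suc p) * t + t" "real p * t = real (Suc p) * t - t"
    by (simp_all add: algebra_simps)
  then show ?thesis unfolding dst_def e t_def[symmetric] by (simp add: sin_add sin_diff)
qed

lemma dst_reflect:
  assumes "k \<le> m + 1"
  shows "dst m (m + 1 - k) i = - ((- 1) ^ i * dst m k i)"
proof -
  have "pi * real (m + 1 - k) * real i / real (m + 1) = pi * real i - pi * real k * real i / real (m + 1)"
    using assms by (simp add: of_nat_diff field_simps)
  then show ?thesis unfolding dst_def by (simp add: sin_diff)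
qed

lemma cos_reflect:
  assumes "k \<le> m + 1"
  shows "cos (pi * real (m + 1 - k) / real (m + 1)) = - cos (pi * real k / real (m + 1))"
proof -
  have "pi * real (m + 1 - k) / real (m + 1) = pi - pi * real k / real (m + 1)"
    using assms by (simp add: of_nat_diff field_simps)
  then show ?thesis by (simp only: cos_pi_minus)
qed

section \<open>Diagonalisation of the Kasteleyn matrix times its transpose\<close>

lemma kasteleyn_transpose: "kasteleyn a b z v u = kasteleyn (- a) (- b) z u v"
  by (cases u; cases v) (auto simp: kasteleyn_def)

lemma finite_grid_vertices [simp]: "finite (grid_vertices m n)"
  by (simp add: grid_vertices_def)

lemma kasteleyn_action:
  fixes G :: "nat \<times> nat \<Rightarrow> complex"
  assumes bd: "\<And>j. G (0, j) = 0" "\<And>j. G (Suc m, j) = 0" "\<And>i. G (i, 0) = 0" "\<And>i. G (i, Suc n) = 0"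
    and ij: "(Suc p, Suc q) \<in> grid_vertices m n"
  shows "(\<Sum>v\<in>grid_vertices m n. of_real (kasteleyn a b z (Suc p, Suc q) v) * G v) =
    of_real z * G (Suc p, Suc q) + of_real b * (G (Suc (Suc p), Suc q) - G (p, Suc q)) +
    (- 1) ^ Suc p * of_real a * (G (Suc p, Suc (Suc q)) - G (Suc p, q))"
proof -
  let ?V = "grid_vertices m n" and ?K = "\<lambda>v. of_real (kasteleyn a b z (Suc p, Suc q) v) :: complex"
  let ?N = "{(Suc p, Suc q), (Suc (Suc p), Suc q), (p, Suc q), (Suc p, Suc (Suc q)), (Suc p, q)}"
  \<comment> \<open>Neighbours outside the grid may be added because \<open>G\<close> vanishes on
    the surrounding frame; every vertex then has the same five-point stencil.\<close>
  have "(\<Sum>v\<in>?V. ?K v * G v) = (\<Sum>v\<in>?V \<union> ?N. ?K v * G v)"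
  proof (rule sum.mono_neutral_left)
    show "\<forall>v\<in>?V \<union> ?N - ?V. ?K v * G v = 0"
    proof
      fix v assume v: "v \<in> ?V \<union> ?N - ?V"
      have pq: "p < m" "q < n" using ij by (auto simp: grid_vertices_def)
      have "v = (Suc m, Suc q) \<or> v = (0, Suc q) \<or> v = (Suc p, Suc n) \<or> v = (Suc p, 0)"
        using v pq by (auto simp: grid_vertices_def)
      then show "?K v * G v = 0" using bd by auto
    qed
  qed auto
  also have "\<dots> = (\<Sum>v\<in>?N. ?K v * G v)"
    by (rule sum.mono_neutral_right) (auto simp: kasteleyn_def split: if_splits)
  also have "\<dots> = of_real z * G (Suc p, Suc q) + of_real b * (G (Suc (Suc p), Suc q) - G (p, Suc q)) +
    (- 1) ^ Suc p * of_real a * (G (Suc p, Suc (Suc q)) - G (Suc p, q))"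
    by (simp add: kasteleyn_def algebra_simps)
  finally show ?thesis .
qed

text \<open>Two steps multiply the power of the imaginary unit by -1, which turns the antisymmetric
  difference of two neighbours into the sum handled by \<open>dst_neighbours\<close>. These are
  eigenvectors of the matrix times its transpose; the matrix alone mixes \<open>k\<close> with
  \<open>m + 1 - k\<close>.\<close>

definition eigenvector :: "nat \<Rightarrow> nat \<Rightarrow> nat \<times> nat \<Rightarrow> nat \<times> nat \<Rightarrow> complex" where
  "eigenvector m n = (\<lambda>(i, j) (k, l). \<i> ^ (i + j) * of_real (dst m k i * dst n l j))"

definition dual_eigenvector :: "nat \<Rightarrow> nat \<Rightarrow> nat \<times> nat \<Rightarrow> nat \<times> nat \<Rightarrow> complex" where
  "dual_eigenvector m n = (\<lambda>(k, l) (i, j). (- \<i>) ^ (i + j) * of_real (dst m k i * dst n l j))"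

text \<open>The dual is the conjugate transpose. The product is a nonzero scalar matrix, so the
  determinant of the eigenvector matrix can later be cancelled.\<close>

lemma eigenvector_dual:
  assumes "\<kappa> \<in> grid_vertices m n" "\<mu> \<in> grid_vertices m n"
  shows "(\<Sum>v\<in>grid_vertices m n. dual_eigenvector m n \<kappa> v * eigenvector m n v \<mu>) =
    (if \<kappa> = \<mu> then of_real (real (m + 1) / 2 * (real (n + 1) / 2)) else 0)"
proof -
  obtain k l k' l' where kl: "\<kappa> = (k, l)" "\<mu> = (k', l')" by (metis surj_pair)
  have ii: "(- \<i>) ^ e * \<i> ^ e = 1" for e by (simp flip: power_mult_distrib)
  have "dual_eigenvector m n \<kappa> (i, j) * eigenvector m n (i, j) \<mu> =
      of_real ((dst m k i * dst m k' i) * (dst n l j * dst n l' j))" for i j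
  proof -
    have "dual_eigenvector m n \<kappa> (i, j) * eigenvector m n (i, j) \<mu> =
      ((- \<i>) ^ (i + j) * \<i> ^ (i + j)) * of_real ((dst m k i * dst m k' i) * (dst n l j * dst n l' j))"
      by (simp add: kl dual_eigenvector_def eigenvector_def mult_ac)
    then show ?thesis unfolding ii by simp
  qed
  then have "(\<Sum>v\<in>grid_vertices m n. dual_eigenvector m n \<kappa> v * eigenvector m n v \<mu>) =
      (\<Sum>i=1..m. \<Sum>j=1..n. of_real ((dst m k i * dst m k' i) * (dst n l j * dst n l' j)))"
    unfolding grid_vertices_def sum.cartesian_product by (intro sum.cong refl) auto
  also have "\<dots> = of_real ((\<Sum>i=1..m. dst m k i * dst m k' i) * (\<Sum>j=1..n. dst n l j * dst n l' j))"
    by (simp add: sum_product)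
  also have "(\<Sum>i=1..m. dst m k i * dst m k' i) = (if k = k' then real (m + 1) / 2 else 0)"
    by (rule dst_orthogonal) (use assms kl in \<open>auto simp: grid_vertices_def\<close>)
  also have "(\<Sum>j=1..n. dst n l j * dst n l' j) = (if l = l' then real (n + 1) / 2 else 0)"
    by (rule dst_orthogonal) (use assms kl in \<open>auto simp: grid_vertices_def\<close>)
  also have "of_real ((if k = k' then real (m + 1) / 2 else 0) * (if l = l' then real (n + 1) / 2 else 0)) =
      (if \<kappa> = \<mu> then of_real (real (m + 1) / 2 * (real (n + 1) / 2)) else 0 :: complex)"
    by (simp add: kl)
  finally show ?thesis .
qed

text \<open>The sign \<open>(- 1) ^ i\<close> reflects the frequency \<open>k\<close> to \<open>m + 1 - k\<close>, which negates the cosine; the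
  cross terms therefore cancel in the square.\<close>

lemma kasteleyn_eigenvector:
  assumes u: "u \<in> grid_vertices m n" and kl: "k \<le> m + 1"
  shows "(\<Sum>v\<in>grid_vertices m n. of_real (kasteleyn a b z u v) * eigenvector m n v (k, l)) =
    (of_real z + 2 * \<i> * of_real b * of_real (cos (pi * real k / real (m + 1)))) * eigenvector m n u (k, l) -
    2 * \<i> * of_real a * of_real (cos (pi * real l / real (n + 1))) * eigenvector m n u (m + 1 - k, l)"
proof -
  define c d where "c = cos (pi * real k / real (m + 1))" and "d = cos (pi * real l / real (n + 1))"
  obtain p q where pq: "u = (Suc p, Suc q)" "p < m" "q < n"
    using u by (cases u; cases "fst u"; cases "snd u") (auto simp: grid_vertices_def)
  let ?G = "\<lambda>v. eigenvector m n v (k, l)"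
  have "(\<Sum>v\<in>grid_vertices m n. of_real (kasteleyn a b z u v) * ?G v) =
    of_real z * ?G (Suc p, Suc q) + of_real b * (?G (Suc (Suc p), Suc q) - ?G (p, Suc q)) +
    (- 1) ^ Suc p * of_real a * (?G (Suc p, Suc (Suc q)) - ?G (Suc p, q))"
    using u unfolding pq(1) by (intro kasteleyn_action) (simp_all add: eigenvector_def)
  also have "?G (Suc (Suc p), Suc q) - ?G (p, Suc q) = 2 * \<i> * of_real c * ?G (Suc p, Suc q)"
  proof -
    have "?G (Suc (Suc p), Suc q) - ?G (p, Suc q) =
        - (\<i> ^ (p + Suc q)) * of_real ((dst m k (Suc (Suc p)) + dst m k p) * dst n l (Suc q))"
      by (simp add: eigenvector_def algebra_simps)
    then show ?thesis unfolding dst_neighbours c_def[symmetric]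
      by (simp add: eigenvector_def algebra_simps)
  qed
  also have "?G (Suc p, Suc (Suc q)) - ?G (Suc p, q) = 2 * \<i> * of_real d * ?G (Suc p, Suc q)"
  proof -
    have "?G (Suc p, Suc (Suc q)) - ?G (Suc p, q) =
        - (\<i> ^ (Suc p + q)) * of_real (dst m k (Suc p) * (dst n l (Suc (Suc q)) + dst n l q))"
      by (simp add: eigenvector_def algebra_simps)
    then show ?thesis unfolding dst_neighbours d_def[symmetric]
      by (simp add: eigenvector_def algebra_simps)
  qed
  also have "(- 1) ^ Suc p * of_real a * (2 * \<i> * of_real d * ?G (Suc p, Suc q)) =
      - (2 * \<i> * of_real a * of_real d * eigenvector m n (Suc p, Suc q) (m + 1 - k, l))"
    unfolding eigenvector_def prod.case dst_reflect[OF kl] by (simp add: algebra_simps)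
  finally show ?thesis unfolding pq(1) c_def[symmetric] d_def[symmetric] by (simp add: algebra_simps)
qed

definition grid_eigenvalue :: "nat \<Rightarrow> nat \<Rightarrow> real \<Rightarrow> real \<Rightarrow> real \<Rightarrow> nat \<times> nat \<Rightarrow> real" where
  "grid_eigenvalue m n a b z = (\<lambda>(k, l).
     z\<^sup>2 + 4 * b\<^sup>2 * (cos (pi * (real k / real (m + 1))))\<^sup>2 + 4 * a\<^sup>2 * (cos (pi * (real l / real (n + 1))))\<^sup>2)"

lemma kasteleyn_square_eigenvector:
  assumes u: "u \<in> grid_vertices m n" and kl: "(k, l) \<in> grid_vertices m n"
  shows "(\<Sum>w\<in>grid_vertices m n. (\<Sum>v\<in>grid_vertices m n. of_real (kasteleyn a b z u v) * of_real (kasteleyn a b z w v)) *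
      eigenvector m n w (k, l)) = eigenvector m n u (k, l) * of_real (grid_eigenvalue m n a b z (k, l))"
proof -
  let ?V = "grid_vertices m n"
  define c d where "c = cos (pi * real k / real (m + 1))" and "d = cos (pi * real l / real (n + 1))"
  have k: "k \<le> m + 1" "m + 1 - k \<le> m + 1" "m + 1 - (m + 1 - k) = k" using kl by (auto simp: grid_vertices_def)
  let ?e = "\<lambda>v. eigenvector m n v (k, l)" and ?e' = "\<lambda>v. eigenvector m n v (m + 1 - k, l)"
  \<comment> \<open>Exchanging the sums lets the transpose act first, and the transpose is the same
    matrix with \<open>a\<close> and \<open>b\<close> negated.\<close>
  have "(\<Sum>w\<in>?V. (\<Sum>v\<in>?V. of_real (kasteleyn a b z u v) * of_real (kasteleyn a b z w v)) * ?e w) =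
      (\<Sum>v\<in>?V. of_real (kasteleyn a b z u v) * (\<Sum>w\<in>?V. of_real (kasteleyn (- a) (- b) z v w) * ?e w))"
    unfolding sum_distrib_left sum_distrib_right
    by (subst sum.swap) (simp add: kasteleyn_transpose[of a b z _ _] mult_ac)
  also have "\<dots> = (\<Sum>v\<in>?V. of_real (kasteleyn a b z u v) * ((of_real z - 2 * \<i> * of_real b * of_real c) * ?e v + 2 * \<i> * of_real a * of_real d * ?e' v))"
  proof (intro sum.cong refl arg_cong2[where f = "(*)"])
    fix v assume v: "v \<in> ?V"
    show "(\<Sum>w\<in>?V. of_real (kasteleyn (- a) (- b) z v w) * ?e w) = (of_real z - 2 * \<i> * of_real b * of_real c) * ?e v + 2 * \<i> * of_real a * of_real d * ?e' v"
      using kasteleyn_eigenvector[OF v k(1), of "- a" "- b" z l] by (simp add: c_def d_def)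
  qed
  also have "\<dots> = (of_real z - 2 * \<i> * of_real b * of_real c) * (\<Sum>v\<in>?V. of_real (kasteleyn a b z u v) * ?e v) +
      2 * \<i> * of_real a * of_real d * (\<Sum>v\<in>?V. of_real (kasteleyn a b z u v) * ?e' v)"
    by (simp only: sum.distrib sum_distrib_left distrib_left mult_ac)
  also have "(\<Sum>v\<in>?V. of_real (kasteleyn a b z u v) * ?e v) = (of_real z + 2 * \<i> * of_real b * of_real c) * ?e u - 2 * \<i> * of_real a * of_real d * ?e' u"
    using kasteleyn_eigenvector[OF u k(1), of a b z l] by (simp add: c_def d_def)
  \<comment> \<open>At the reflected frequency \<open>c\<close> becomes \<open>- c\<close> while
    \<open>d\<close> is unchanged, and reflecting again returns to \<open>k\<close>.\<close>
  also have "(\<Sum>v\<in>?V. of_real (kasteleyn a b z u v) * ?e' v) = (of_real z - 2 * \<i> * of_real b * of_real c) * ?e' u - 2 * \<i> * of_real a * of_real d * ?e u"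
    using kasteleyn_eigenvector[OF u k(2), of a b z l] unfolding cos_reflect[OF k(1)] k(3)
    by (simp add: c_def d_def)
  also have "(of_real z - 2 * \<i> * of_real b * of_real c) * ((of_real z + 2 * \<i> * of_real b * of_real c) * ?e u - 2 * \<i> * of_real a * of_real d * ?e' u) +
      2 * \<i> * of_real a * of_real d * ((of_real z - 2 * \<i> * of_real b * of_real c) * ?e' u - 2 * \<i> * of_real a * of_real d * ?e u) =
      ?e u * of_real (z\<^sup>2 + 4 * b\<^sup>2 * c\<^sup>2 + 4 * a\<^sup>2 * d\<^sup>2)"
    by (simp add: algebra_simps power2_eq_square)
  finally show ?thesis by (simp add: grid_eigenvalue_def c_def d_def)
qed

text \<open>With K the Kasteleyn matrix, P the eigenvector matrix and D the diagonal of eigenvalues,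
  K K^T P = P D. Taking determinants and cancelling det P gives the product; complex entries occur
  only because of P.\<close>

lemma set_det_kasteleyn_square:
  "(set_det (grid_vertices m n) (kasteleyn a b z))\<^sup>2 = (\<Prod>\<kappa>\<in>grid_vertices m n. grid_eigenvalue m n a b z \<kappa>)"
proof -
  let ?V = "grid_vertices m n"
  let ?K = "\<lambda>u v. of_real (kasteleyn a b z u v) :: complex" and ?P = "eigenvector m n"
  let ?lam = "\<lambda>\<kappa>. of_real (grid_eigenvalue m n a b z \<kappa>) :: complex"
  let ?L = "\<lambda>\<kappa> \<mu>. if \<kappa> = \<mu> then ?lam \<kappa> else 0"
  have "set_det ?V (dual_eigenvector m n) * set_det ?V ?P =
      set_det ?V (\<lambda>\<kappa> \<mu>. if \<kappa> = \<mu> then of_real (real (m + 1) / 2 * (real (n + 1) / 2)) else 0)"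
    by (simp only: set_det_mult finite_grid_vertices) (rule set_det_cong, rule eigenvector_dual)
  also have "\<dots> = (\<Prod>\<kappa>\<in>?V. of_real (real (m + 1) / 2 * (real (n + 1) / 2)))"
    by (rule set_det_diagonal) simp
  also have "\<dots> \<noteq> 0" by (simp add: complex_eq_iff)
  finally have P: "set_det ?V ?P \<noteq> 0" by auto
  have "set_det ?V ?K * set_det ?V (\<lambda>u v. ?K v u) * set_det ?V ?P =
      set_det ?V (\<lambda>u \<kappa>. \<Sum>w\<in>?V. (\<Sum>v\<in>?V. ?K u v * ?K w v) * ?P w \<kappa>)"
    by (simp only: set_det_mult finite_grid_vertices)
  also have "\<dots> = set_det ?V (\<lambda>u \<kappa>. \<Sum>\<mu>\<in>?V. ?P u \<mu> * ?L \<mu> \<kappa>)"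
  proof (rule set_det_cong)
    fix u \<kappa> assume "u \<in> ?V" "\<kappa> \<in> ?V"
    moreover have "(\<Sum>\<mu>\<in>?V. ?P u \<mu> * ?L \<mu> \<kappa>) = (\<Sum>\<mu>\<in>?V. if \<mu> = \<kappa> then ?P u \<mu> * ?lam \<mu> else 0)"
      by (rule sum.cong) auto
    ultimately show "(\<Sum>w\<in>?V. (\<Sum>v\<in>?V. ?K u v * ?K w v) * ?P w \<kappa>) = (\<Sum>\<mu>\<in>?V. ?P u \<mu> * ?L \<mu> \<kappa>)"
      using kasteleyn_square_eigenvector[of u m n "fst \<kappa>" "snd \<kappa>" a b z] by simp
  qed
  also have "\<dots> = set_det ?V ?P * (\<Prod>\<kappa>\<in>?V. ?lam \<kappa>)"
    by (simp only: set_det_mult[symmetric] set_det_diagonal finite_grid_vertices)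
  finally have eq: "set_det ?V ?K * set_det ?V (\<lambda>u v. ?K v u) * set_det ?V ?P = set_det ?V ?P * (\<Prod>\<kappa>\<in>?V. ?lam \<kappa>)" .
  have "set_det ?V (\<lambda>u v. ?K v u) = set_det ?V ?K" by (rule set_det_transpose) simp
  with eq have "set_det ?V ?P * (set_det ?V ?K * set_det ?V ?K) = set_det ?V ?P * (\<Prod>\<kappa>\<in>?V. ?lam \<kappa>)"
    by (simp only: mult_ac)
  then have "set_det ?V ?K * set_det ?V ?K = (\<Prod>\<kappa>\<in>?V. ?lam \<kappa>)"
    unfolding mult_left_cancel[OF P] .
  then have "of_real ((set_det ?V (kasteleyn a b z))\<^sup>2) = (of_real (\<Prod>\<kappa>\<in>?V. grid_eigenvalue m n a b z \<kappa>) :: complex)"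
    by (simp add: set_det_of_real power2_eq_square)
  then show ?thesis by (simp only: of_real_eq_iff)
qed

lemma grid_eigenvalue_pos: "z > 0 \<Longrightarrow> grid_eigenvalue m n a b z \<kappa> > 0"
  by (cases \<kappa>) (auto simp: grid_eigenvalue_def intro!: add_pos_nonneg)

text \<open>Scale the edge weights by t. At t = 0 the determinant is a power of z, its square is a
  product of positive eigenvalues for every t, and so by continuity it never changes sign.\<close>

lemma set_det_kasteleyn_pos:
  assumes "z > 0"
  shows "set_det (grid_vertices m n) (kasteleyn a b z) > 0"
proof (rule ccontr)
  let ?V = "grid_vertices m n"
  define g where "g t = set_det ?V (kasteleyn (t * a) (t * b) z)" for t
  assume "\<not> set_det ?V (kasteleyn a b z) > 0"
  then have g1: "g 1 \<le> 0" by (simp add: g_def)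
  have "kasteleyn (0 * a) (0 * b) z = (\<lambda>u v. if u = v then z else 0)"
    by (auto simp: kasteleyn_def fun_eq_iff)
  then have "g 0 = (\<Prod>v\<in>?V. z)"
    unfolding g_def by (simp only: set_det_diagonal finite_grid_vertices)
  then have g0: "0 \<le> g 0" using assms by (simp add: prod_nonneg)
  have "kasteleyn (t * a) (t * b) z u v = (if u = v then z else 0) + t * kasteleyn a b 0 u v" for t u v
    by (cases u; cases v) (simp add: kasteleyn_def)
  then have "continuous_on {0..1} g"
    unfolding g_def set_det_def by (auto intro!: continuous_intros)
  then obtain t where "0 \<le> t" "t \<le> 1" "g t = 0"
    using IVT2'[of g 1 0 0] g0 g1 by auto
  moreover have "(g t)\<^sup>2 > 0" for t
    unfolding g_def set_det_kasteleyn_square using assms by (intro prod_pos) (simp add: grid_eigenvalue_pos)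
  ultimately show False by (metis less_irrefl zero_power2)
qed

theorem partition_function_grid_pos:
  assumes "z > 0"
  shows "partition_function (grid_graph m n a b z) > 0"
  using set_det_kasteleyn_pos[OF assms] by (simp add: partition_function_grid set_det_def)

theorem ln_partition_function_grid:
  assumes "z > 0"
  shows "ln (partition_function (grid_graph m n a b z)) =
    (\<Sum>k=1..m. \<Sum>l=1..n. ln (grid_eigenvalue m n a b z (k, l))) / 2"
proof -
  let ?Z = "partition_function (grid_graph m n a b z)"
  have "2 * ln ?Z = ln (?Z\<^sup>2)"
    using partition_function_grid_pos[OF assms] by (simp add: ln_realpow)
  also have "?Z\<^sup>2 = (\<Prod>\<kappa>\<in>grid_vertices m n. grid_eigenvalue m n a b z \<kappa>)"
    using set_det_kasteleyn_square[of m n a b z] by (simp add: partition_function_grid set_det_def)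
  also have "ln \<dots> = (\<Sum>\<kappa>\<in>grid_vertices m n. ln (grid_eigenvalue m n a b z \<kappa>))"
    by (rule ln_prod) (simp, metis grid_eigenvalue_pos[OF assms] less_irrefl)
  also have "\<dots> = (\<Sum>k=1..m. \<Sum>l=1..n. ln (grid_eigenvalue m n a b z (k, l)))"
    by (simp add: grid_vertices_def sum.cartesian_product case_prod_beta)
  finally show ?thesis by simp
qed

section \<open>The thermodynamic limit\<close>

text \<open>The n samples lie at j/(n + 1) but are averaged with weight 1/n. The unsampled first
  cell and the change from 1/n to 1/(n + 1) each cost at most B/(n + 1).\<close>

lemma riemann_sum_bound:
  fixes g :: "real \<Rightarrow> real"
  assumes n: "n \<ge> 1" and cont: "continuous_on {0..1} g" and B: "\<And>x. x \<in> {0..1} \<Longrightarrow> \<bar>g x\<bar> \<le> B"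
    and mod: "\<And>x y. x \<in> {0..1} \<Longrightarrow> y \<in> {0..1} \<Longrightarrow> \<bar>x - y\<bar> \<le> 1 / real (n + 1) \<Longrightarrow> \<bar>g x - g y\<bar> \<le> \<epsilon>"
  shows "\<bar>(\<Sum>j=1..n. g (real j / real (n + 1))) / real n - integral {0..1} g\<bar> \<le> \<epsilon> + 2 * B / real (n + 1)"
proof -
  define N where "N = real (n + 1)"
  have N: "N > 0" by (simp add: N_def)
  define cell where "cell j = {real j / N..real (Suc j) / N}" for j :: nat
  have cell_sub: "cell j \<subseteq> {0..1}" if "j \<le> n" for j
    using that N by (auto simp: cell_def N_def field_simps)
  have cont_cell: "continuous_on (cell j) g" if "j \<le> n" for j
    using cont cell_sub[OF that] by (rule continuous_on_subset)
  have len: "real (Suc j) / N - real j / N = 1 / N" for j by (simp add: diff_divide_distrib[symmetric])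
  have B0: "B \<ge> 0" using B[of 0] by simp
  have split: "integral {0..real k / N} g = (\<Sum>j<k. integral (cell j) g)" if "k \<le> n + 1" for k
    using that
  proof (induction k)
    case (Suc k)
    have sub: "{0..real (Suc k) / N} \<subseteq> {0..1}" using Suc.prems N by (auto simp: N_def field_simps)
    have "integral {0..real k / N} g + integral {real k / N..real (Suc k) / N} g = integral {0..real (Suc k) / N} g"
      using N by (intro Henstock_Kurzweil_Integration.integral_combine integrable_continuous_real
          continuous_on_subset[OF cont sub]) (auto simp: divide_right_mono)
    then show ?case using Suc by (simp add: cell_def)
  qed simp
  have total: "integral {0..1} g = integral (cell 0) g + (\<Sum>j=1..n. integral (cell j) g)"
  proof -
    have "{..<n + 1} = insert 0 {1..n}" by auto
    moreover have "integral {0..1} g = (\<Sum>j<n + 1. integral (cell j) g)"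
      using split[of "n + 1"] N by (simp add: N_def)
    ultimately show ?thesis by simp
  qed
  have c0: "\<bar>integral (cell 0) g\<bar> \<le> B / N"
  proof -
    have "\<bar>g t\<bar> \<le> B" if "t \<in> {0..1 / N}" for t
    proof (rule B)
      have "t \<in> cell 0" using that by (simp add: cell_def)
      then show "t \<in> {0..1}" using cell_sub[of 0] by blast
    qed
    then show ?thesis
      using integral_bound[of "0" "1 / N" g B] cont_cell[of 0] N by (auto simp: cell_def)
  qed
  have cj: "\<bar>integral (cell j) g - g (real j / N) / N\<bar> \<le> \<epsilon> / N" if j: "j \<in> {1..n}" for j
  proof -
    have jn: "j \<le> n" using j by simp
    have "norm (integral {real j / N..real (Suc j) / N} (\<lambda>x. g x - g (real j / N))) \<le> \<epsilon> * (real (Suc j) / N - real j / N)"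
    proof (rule integral_bound)
      show "real j / N \<le> real (Suc j) / N" using N by (simp add: divide_right_mono)
      show "continuous_on {real j / N..real (Suc j) / N} (\<lambda>x. g x - g (real j / N))"
        using cont_cell[OF jn] unfolding cell_def by (intro continuous_intros)
      fix t assume t: "t \<in> {real j / N..real (Suc j) / N}"
      then have "t \<in> {0..1}" using cell_sub[OF jn] unfolding cell_def by blast
      moreover have "real j / N \<in> cell j" using N by (simp add: cell_def divide_right_mono)
      then have "real j / N \<in> {0..1}" using cell_sub[OF jn] by blast
      moreover have "\<bar>t - real j / N\<bar> \<le> 1 / real (n + 1)" using t len[of j] by (auto simp: N_def)
      ultimately show "norm (g t - g (real j / N)) \<le> \<epsilon>"
        using mod[of t "real j / N"] by simp
    qed
    also have "integral {real j / N..real (Suc j) / N} (\<lambda>x. g x - g (real j / N)) =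
        integral (cell j) g - g (real j / N) / N"
      using integrable_continuous_real[OF cont_cell[OF jn, unfolded cell_def]] len[of j] N
      by (subst integral_diff) (auto simp: cell_def divide_right_mono)
    finally show ?thesis unfolding len by simp
  qed
  define S where "S = (\<Sum>j=1..n. g (real j / N))"
  have "\<bar>(\<Sum>j=1..n. integral (cell j) g) - S / N\<bar> = \<bar>\<Sum>j=1..n. integral (cell j) g - g (real j / N) / N\<bar>"
    by (simp add: S_def sum_subtractf sum_divide_distrib)
  also have "\<dots> \<le> (\<Sum>j=1..n. \<bar>integral (cell j) g - g (real j / N) / N\<bar>)" by (rule sum_abs)
  also have "\<dots> \<le> (\<Sum>j=1..n. \<epsilon> / N)" using cj by (rule sum_mono)
  also have "\<dots> = real n * (\<epsilon> / N)" by simp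
  also have "\<dots> \<le> \<epsilon>"
  proof -
    have "\<epsilon> \<ge> 0" using mod[of 0 0] by simp
    then show ?thesis using N by (simp add: N_def field_simps)
  qed
  finally have 1: "\<bar>(\<Sum>j=1..n. integral (cell j) g) - S / N\<bar> \<le> \<epsilon>" .
  have "\<bar>S\<bar> \<le> (\<Sum>j=1..n. \<bar>g (real j / N)\<bar>)" unfolding S_def by (rule sum_abs)
  also have "\<dots> \<le> (\<Sum>j=1..n. B)"
    using N by (intro sum_mono B) (auto simp: N_def field_simps)
  finally have S: "\<bar>S\<bar> \<le> real n * B" by simp
  have "S / real n - S / N = S / (real n * N)"
    using n N by (simp add: N_def field_simps)
  then have "\<bar>S / real n - S / N\<bar> = \<bar>S\<bar> / (real n * N)" using N by simp
  also have "\<dots> \<le> real n * B / (real n * N)" using S N by (intro divide_right_mono) auto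
  also have "\<dots> = B / N" using n by simp
  finally have 2: "\<bar>S / real n - S / N\<bar> \<le> B / N" .
  have "\<bar>S / real n - integral {0..1} g\<bar> \<le> \<epsilon> + (B / N + B / N)"
    using 1 2 c0 total by linarith
  then show ?thesis by (simp add: S_def N_def)
qed

lemma riemann_sum_2D:
  fixes f :: "real \<Rightarrow> real \<Rightarrow> real"
  assumes cont: "continuous_on ({0..1} \<times> {0..1}) (\<lambda>(x, y). f x y)"
  shows "((\<lambda>(m, n). (\<Sum>k=1..m. \<Sum>l=1..n. f (real k / real (m + 1)) (real l / real (n + 1))) / (real m * real n))
    \<longlongrightarrow> integral {0..1} (\<lambda>x. integral {0..1} (f x))) (at_top \<times>\<^sub>F at_top)"
proof (rule tendstoI)
  fix e :: real assume e: "e > 0"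
  have comp: "compact ({0..1::real} \<times> {0..1::real})" by (intro compact_Times) auto
  obtain B where B: "\<And>x y. x \<in> {0..1} \<Longrightarrow> y \<in> {0..1} \<Longrightarrow> \<bar>f x y\<bar> \<le> B" "B > 0"
  proof -
    have "bounded ((\<lambda>(x, y). f x y) ` ({0..1} \<times> {0..1}))"
      using compact_continuous_image[OF cont comp] by (rule compact_imp_bounded)
    then obtain B where "B > 0" "\<forall>z\<in>(\<lambda>(x, y). f x y) ` ({0..1} \<times> {0..1}). norm z \<le> B"
      by (auto simp: bounded_pos)
    then show ?thesis by (intro that[of B]) auto
  qed
  have "uniformly_continuous_on ({0..1} \<times> {0..1}) (\<lambda>(x, y). f x y)"
    using cont comp by (rule compact_uniformly_continuous)
  then obtain \<delta> where \<delta>: "\<delta> > 0"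
    "\<And>p q. p \<in> {0..1} \<times> {0..1} \<Longrightarrow> q \<in> {0..1} \<times> {0..1} \<Longrightarrow> dist p q < \<delta> \<Longrightarrow> \<bar>f (fst p) (snd p) - f (fst q) (snd q)\<bar> < e / 8"
    unfolding uniformly_continuous_on_def dist_real_def case_prod_beta
    by (metis dist_commute e divide_pos_pos zero_less_numeral)
  have cont_y: "continuous_on {0..1} (f x)" if "x \<in> {0..1}" for x
  proof -
    have "continuous_on {0..1} (\<lambda>y. case (x, y) of (x, y) \<Rightarrow> f x y)"
      by (rule continuous_on_compose2[OF cont]) (intro continuous_intros, use that in auto)
    then show ?thesis by simp
  qed
  define G where "G x = integral {0..1} (f x)" for x
  have cont_G: "continuous_on {0..1} G"
    using integral_continuous_on_param[of "{0..1}" "0::real" 1 f] cont by (simp add: G_def cbox_interval)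
  have G_B: "\<bar>G x\<bar> \<le> B" if "x \<in> {0..1}" for x
    using integral_bound[OF _ cont_y[OF that], of B] B(1)[OF that] by (simp add: G_def)
  have fx_mod: "\<bar>f x y - f x' y\<bar> \<le> e / 8" if "x \<in> {0..1}" "x' \<in> {0..1}" "y \<in> {0..1}" "\<bar>x - x'\<bar> < \<delta>" for x x' y
    using \<delta>(2)[of "(x, y)" "(x', y)"] that by (auto simp: dist_Pair_Pair dist_real_def)
  have fy_mod: "\<bar>f x y - f x y'\<bar> \<le> e / 8" if "x \<in> {0..1}" "y \<in> {0..1}" "y' \<in> {0..1}" "\<bar>y - y'\<bar> < \<delta>" for x y y'
    using \<delta>(2)[of "(x, y)" "(x, y')"] that by (auto simp: dist_Pair_Pair dist_real_def)
  have G_mod: "\<bar>G x - G x'\<bar> \<le> e / 8" if x: "x \<in> {0..1}" "x' \<in> {0..1}" "\<bar>x - x'\<bar> < \<delta>" for x x'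
  proof -
    have "G x - G x' = integral {0..1} (\<lambda>y. f x y - f x' y)"
      unfolding G_def using x cont_y
      by (intro integral_diff[symmetric] integrable_continuous_real) auto
    then show ?thesis
      using integral_bound[of 0 1 "\<lambda>y. f x y - f x' y" "e / 8"] fx_mod x cont_y
      by (auto intro!: continuous_intros)
  qed
  \<comment> \<open>With 16 in the denominator, 2B/(n + 1) is at most e/8. Together with the modulus
    e/8 each one-dimensional sum is off by at most e/4, and the double sum by at most e/2.\<close>
  have "0 < min \<delta> (e / (16 * B))" using \<delta>(1) e B(2) by simp
  then obtain M where M: "1 / real (Suc M) < min \<delta> (e / (16 * B))"
    by (rule nat_approx_posE)
  have small: "1 / real (n + 1) < \<delta>" "2 * B / real (n + 1) \<le> e / 8" if "n \<ge> Suc M" for n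
  proof -
    have "1 / real (n + 1) \<le> 1 / real (Suc M)" using that by (intro divide_left_mono) auto
    then have "1 / real (n + 1) < \<delta>" and *: "1 / real (n + 1) < e / (16 * B)" using M by auto
    then show "1 / real (n + 1) < \<delta>" by simp
    have "2 * B * (1 / real (n + 1)) \<le> 2 * B * (e / (16 * B))" using * B(2) by (intro mult_left_mono) auto
    then show "2 * B / real (n + 1) \<le> e / 8" using B(2) by simp
  qed
  have "dist ((\<Sum>k=1..m. \<Sum>l=1..n. f (real k / real (m + 1)) (real l / real (n + 1))) / (real m * real n))
      (integral {0..1} G) < e" if mn: "m \<ge> Suc M" "n \<ge> Suc M" for m n
  proof -
    define x where "x k = real k / real (m + 1)" for k
    have x: "x k \<in> {0..1}" if "k \<in> {1..m}" for k using that by (auto simp: x_def field_simps)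
    define T where "T k = (\<Sum>l=1..n. f (x k) (real l / real (n + 1))) / real n" for k
    have T: "\<bar>T k - G (x k)\<bar> \<le> e / 4" if k: "k \<in> {1..m}" for k
    proof -
      have "\<bar>T k - G (x k)\<bar> \<le> e / 8 + 2 * B / real (n + 1)"
        unfolding T_def G_def
      proof (rule riemann_sum_bound)
        show "1 \<le> n" using mn by simp
        show "continuous_on {0..1} (f (x k))" using cont_y x[OF k] .
        show "\<bar>f (x k) y\<bar> \<le> B" if "y \<in> {0..1}" for y using B(1) x[OF k] that .
        show "\<bar>f (x k) y - f (x k) y'\<bar> \<le> e / 8" if "y \<in> {0..1}" "y' \<in> {0..1}" "\<bar>y - y'\<bar> \<le> 1 / real (n + 1)" for y y'
          using fy_mod[OF x[OF k] that(1,2)] small(1)[OF mn(2)] that(3) by linarith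
      qed
      then show ?thesis using small(2)[OF mn(2)] by linarith
    qed
    have m0: "real m > 0" using mn by simp
    have "\<bar>(\<Sum>k=1..m. T k) / real m - (\<Sum>k=1..m. G (x k)) / real m\<bar> = \<bar>\<Sum>k=1..m. T k - G (x k)\<bar> / real m"
      using m0 by (simp add: sum_subtractf diff_divide_distrib[symmetric])
    also have "\<dots> \<le> (\<Sum>k=1..m. \<bar>T k - G (x k)\<bar>) / real m"
      using m0 by (intro divide_right_mono sum_abs) auto
    also have "\<dots> \<le> (\<Sum>k=1..m. e / 4) / real m"
      using m0 T by (intro divide_right_mono sum_mono) auto
    also have "\<dots> = e / 4" using m0 by simp
    finally have 1: "\<bar>(\<Sum>k=1..m. T k) / real m - (\<Sum>k=1..m. G (x k)) / real m\<bar> \<le> e / 4" .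
    have "\<bar>(\<Sum>k=1..m. G (x k)) / real m - integral {0..1} G\<bar> \<le> e / 8 + 2 * B / real (m + 1)"
      unfolding x_def
    proof (rule riemann_sum_bound)
      show "1 \<le> m" using mn by simp
      show "\<bar>G y - G y'\<bar> \<le> e / 8" if "y \<in> {0..1}" "y' \<in> {0..1}" "\<bar>y - y'\<bar> \<le> 1 / real (m + 1)" for y y'
        using G_mod[OF that(1,2)] small(1)[OF mn(1)] that(3) by linarith
    qed (use cont_G G_B in auto)
    then have 2: "\<bar>(\<Sum>k=1..m. G (x k)) / real m - integral {0..1} G\<bar> \<le> e / 4"
      using small(2)[OF mn(1)] by linarith
    have "(\<Sum>k=1..m. \<Sum>l=1..n. f (x k) (real l / real (n + 1))) / (real m * real n) = (\<Sum>k=1..m. T k) / real m"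
      by (simp add: T_def sum_divide_distrib mult.commute)
    then show ?thesis using 1 2 e unfolding x_def dist_real_def by linarith
  qed
  then show "\<forall>\<^sub>F p in at_top \<times>\<^sub>F at_top. dist (case p of (m, n) \<Rightarrow>
      (\<Sum>k=1..m. \<Sum>l=1..n. f (real k / real (m + 1)) (real l / real (n + 1))) / (real m * real n))
      (integral {0..1} (\<lambda>x. integral {0..1} (f x))) < e"
    unfolding eventually_prod_sequentially G_def by auto
qed

text \<open>Limits are unique only along a proper filter, so this is what identifies the value of
  \<open>Lim\<close>.\<close>

lemma both_even_to_infinity_neq_bot: "both_even_to_infinity \<noteq> bot"
proof
  assume "both_even_to_infinity = bot"
  then have "eventually (\<lambda>_. False) both_even_to_infinity" by simp
  then obtain N :: nat where "\<forall>m\<ge>N. \<forall>n\<ge>N. \<not> (even n \<and> even m)"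
    unfolding both_even_to_infinity_def eventually_inf_principal eventually_prod_sequentially by auto
  moreover have "2 * N \<ge> N" "even (2 * N)" by simp_all
  ultimately show False by blast
qed

section \<open>The free energy integral and its derivative\<close>

definition dispersion :: "real \<Rightarrow> real \<Rightarrow> real \<Rightarrow> real \<Rightarrow> real \<Rightarrow> real" where
  "dispersion a b z x y = z\<^sup>2 + 4 * b\<^sup>2 * (cos (pi * x))\<^sup>2 + 4 * a\<^sup>2 * (cos (pi * y))\<^sup>2"

lemma dispersion_pos: "z > 0 \<Longrightarrow> dispersion a b z x y > 0"
  by (auto simp: dispersion_def intro!: add_pos_nonneg)

definition energy_integral :: "real \<Rightarrow> real \<Rightarrow> real \<Rightarrow> real" where
  "energy_integral a b z = integral {0..1} (\<lambda>x. integral {0..1} (\<lambda>y. ln (dispersion a b z x y))) / 2"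

lemma continuous_on_ln_dispersion:
  assumes "z > 0"
  shows "continuous_on X (\<lambda>(x, y). ln (dispersion a b z x y))"
proof -
  have "dispersion a b z x y \<noteq> 0" for x y using dispersion_pos[OF assms, of a b x y] by simp
  then show ?thesis unfolding dispersion_def case_prod_beta by (intro continuous_intros) auto
qed

text \<open>Differentiation under the integral sign is done over the square \<open>?Q\<close>, where
  the iterated integral is a single one by continuity. The factor 2 from z^2 cancels the 1/2 left by
  taking the root of Z^2.\<close>

lemma has_derivative_energy_integral:
  assumes "z > 0"
  shows "(energy_integral a b has_real_derivative
    z * integral {0..1} (\<lambda>x. integral {0..1} (\<lambda>y. 1 / dispersion a b z x y))) (at z)"
proof -
  let ?Q = "cbox (0, 0) (1, 1) :: (real \<times> real) set"
  define E where "E z = integral ?Q (\<lambda>(x, y). ln (dispersion a b z x y))" for z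
  have D0: "dispersion a b z x y \<noteq> 0" if "z > 0" for z x y using dispersion_pos[OF that, of a b x y] by simp
  have E: "energy_integral a b z = E z / 2" if "z > 0" for z
    unfolding E_def energy_integral_def
    using integral_prod_continuous[OF continuous_on_ln_dispersion[OF that, of "?Q" a b]] by (simp add: cbox_interval)
  have "((\<lambda>z. integral ?Q (\<lambda>(x, y). ln (dispersion a b z x y))) has_field_derivative
      integral ?Q (\<lambda>(x, y). 2 * z * (1 / dispersion a b z x y))) (at z within {0<..})"
  proof (rule leibniz_rule_field_derivative[where fx = "\<lambda>z (x, y). 2 * z * (1 / dispersion a b z x y)"
        and f = "\<lambda>z (x, y). ln (dispersion a b z x y)"])
    fix w :: real and t :: "real \<times> real" assume w: "w \<in> {0<..}"
    obtain x y where t: "t = (x, y)" by fastforce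
    have "((\<lambda>z. dispersion a b z x y) has_field_derivative 2 * w) (at w within {0<..})"
      unfolding dispersion_def by (auto intro!: derivative_eq_intros)
    moreover have "dispersion a b w x y > 0" using w by (intro dispersion_pos) simp
    ultimately show "((\<lambda>z. case t of (x, y) \<Rightarrow> ln (dispersion a b z x y)) has_field_derivative
        (case t of (x, y) \<Rightarrow> 2 * w * (1 / dispersion a b w x y))) (at w within {0<..})"
      unfolding t prod.case by (auto intro!: derivative_eq_intros)
  next
    fix w :: real assume "w \<in> {0<..}"
    then show "(\<lambda>(x, y). ln (dispersion a b w x y)) integrable_on ?Q"
      by (intro integrable_continuous continuous_on_ln_dispersion) simp
  next
    show "continuous_on ({0<..} \<times> ?Q) (\<lambda>(z, x, y). 2 * z * (1 / dispersion a b z x y))"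
    proof -
      have "\<forall>p\<in>{0<..} \<times> ?Q. dispersion a b (fst p) (fst (snd p)) (snd (snd p)) \<noteq> 0" using D0 by auto
      then show ?thesis unfolding dispersion_def case_prod_beta by (intro continuous_intros) auto
    qed
  qed (use assms in auto)
  moreover have "integral ?Q (\<lambda>(x, y). 2 * z * (1 / dispersion a b z x y)) =
      2 * z * integral {0..1} (\<lambda>x. integral {0..1} (\<lambda>y. 1 / dispersion a b z x y))"
  proof -
    have "continuous_on ?Q (\<lambda>(x, y). 1 / dispersion a b z x y)"
      using D0[OF assms] unfolding dispersion_def case_prod_beta by (intro continuous_intros) auto
    then have "integral ?Q (\<lambda>(x, y). 1 / dispersion a b z x y) =
        integral {0..1} (\<lambda>x. integral {0..1} (\<lambda>y. 1 / dispersion a b z x y))"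
      using integral_prod_continuous[of "0::real" "0::real" 1 1 "\<lambda>(x, y). 1 / dispersion a b z x y"] by (simp add: cbox_interval)
    moreover have "integral ?Q (\<lambda>(x, y). 2 * z * (1 / dispersion a b z x y)) =
        2 * z * integral ?Q (\<lambda>(x, y). 1 / dispersion a b z x y)"
      unfolding case_prod_beta by (rule integral_mult_right)
    ultimately show ?thesis by simp
  qed
  ultimately have "(E has_field_derivative
      2 * z * integral {0..1} (\<lambda>x. integral {0..1} (\<lambda>y. 1 / dispersion a b z x y))) (at z)"
    using assms unfolding E_def by (simp add: at_within_open[of z "{0<..}"])
  then have "((\<lambda>z. E z / 2) has_field_derivative
      z * integral {0..1} (\<lambda>x. integral {0..1} (\<lambda>y. 1 / dispersion a b z x y))) (at z)"
    by (auto intro!: derivative_eq_intros)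
  then show ?thesis
    by (rule has_field_derivative_transform_within_open[where S = "{0<..}"]) (use assms E in auto)
qed

section \<open>Reduction to the elliptic integral\<close>

text \<open>A smooth branch on the whole line of the solution \<open>\<phi>\<close> of \<open>tan \<phi> = \<kappa> * tan t\<close>.\<close>

definition stretched_angle :: "real \<Rightarrow> real \<Rightarrow> real" where
  "stretched_angle \<kappa> t = t + arctan ((\<kappa> - 1) * sin t * cos t / ((cos t)\<^sup>2 + \<kappa> * (sin t)\<^sup>2))"

lemma stretched_denominator_pos:
  assumes "\<kappa> > 0"
  shows "(cos t)\<^sup>2 + \<kappa> * (sin t)\<^sup>2 > (0::real)"
proof (cases "sin t = 0")
  case True
  then have "(cos t)\<^sup>2 = 1" using sin_cos_squared_add[of t] by simp
  then show ?thesis using True by simp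
qed (use assms in \<open>simp add: add_nonneg_pos\<close>)

text \<open>This is multiplicativity of the norm for (c - i s)(c + i \<kappa> s) = (c^2 + \<kappa>
  s^2) + i (\<kappa> - 1) s c. The argument of this product is the correction in
  \<open>stretched_angle\<close>; its real part is positive for \<kappa> > 0, so
  \<open>arctan\<close> gives it without jumps.\<close>

lemma stretched_angle_aux:
  fixes c s \<kappa> :: real
  assumes "c\<^sup>2 + s\<^sup>2 = 1"
  shows "(c\<^sup>2 + \<kappa> * s\<^sup>2)\<^sup>2 + ((\<kappa> - 1) * s * c)\<^sup>2 = c\<^sup>2 + \<kappa>\<^sup>2 * s\<^sup>2"
proof -
  have "(c\<^sup>2 + \<kappa> * s\<^sup>2)\<^sup>2 + ((\<kappa> - 1) * s * c)\<^sup>2 = (c\<^sup>2 + s\<^sup>2) * (c\<^sup>2 + \<kappa>\<^sup>2 * s\<^sup>2)"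
    by (simp add: power2_eq_square algebra_simps)
  then show ?thesis using assms by simp
qed

lemma cos_stretched_angle_squared:
  assumes "\<kappa> > 0"
  shows "(cos (stretched_angle \<kappa> t))\<^sup>2 = (cos t)\<^sup>2 / ((cos t)\<^sup>2 + \<kappa>\<^sup>2 * (sin t)\<^sup>2)"
proof -
  define c s D u where "c = cos t" and "s = sin t" and "D = c\<^sup>2 + \<kappa> * s\<^sup>2" and "u = (\<kappa> - 1) * s * c / D"
  have cs: "c\<^sup>2 + s\<^sup>2 = 1" by (simp add: c_def s_def)
  have D: "D > 0" using stretched_denominator_pos[OF assms, of t] by (simp add: D_def c_def s_def)
  have "c - s * u = c * (D - (\<kappa> - 1) * s\<^sup>2) / D"
    using D by (simp add: u_def field_simps power2_eq_square)
  also have "D - (\<kappa> - 1) * s\<^sup>2 = 1" using cs by (simp add: D_def algebra_simps)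
  finally have 1: "c - s * u = c / D" by simp
  have 2: "1 + u\<^sup>2 = (c\<^sup>2 + \<kappa>\<^sup>2 * s\<^sup>2) / D\<^sup>2"
    using D stretched_angle_aux[OF cs, of \<kappa>] by (simp add: u_def D_def[symmetric] power_divide add_divide_eq_iff divide_simps)
  have "cos (stretched_angle \<kappa> t) = (c - s * u) / sqrt (1 + u\<^sup>2)"
    by (simp add: stretched_angle_def cos_add cos_arctan sin_arctan c_def s_def u_def D_def diff_divide_distrib)
  then have "(cos (stretched_angle \<kappa> t))\<^sup>2 = (c - s * u)\<^sup>2 / (1 + u\<^sup>2)"
    by (simp add: power_divide add_nonneg_nonneg)
  also have "\<dots> = c\<^sup>2 / (c\<^sup>2 + \<kappa>\<^sup>2 * s\<^sup>2)"
    unfolding 1 2 using D by (simp add: power_divide)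
  finally show ?thesis by (simp add: c_def s_def)
qed

lemma has_derivative_stretched_angle:
  assumes "\<kappa> > 0"
  shows "(stretched_angle \<kappa> has_real_derivative \<kappa> / ((cos t)\<^sup>2 + \<kappa>\<^sup>2 * (sin t)\<^sup>2)) (at t)"
proof -
  define c s D u W where "c = cos t" and "s = sin t" and "D = c\<^sup>2 + \<kappa> * s\<^sup>2" and "u = (\<kappa> - 1) * s * c / D"
    and "W = c\<^sup>2 + \<kappa>\<^sup>2 * s\<^sup>2"
  have cs: "c\<^sup>2 + s\<^sup>2 = 1" by (simp add: c_def s_def)
  have D: "D > 0" using stretched_denominator_pos[OF assms, of t] by (simp add: D_def c_def s_def)
  have W: "W > 0" using stretched_denominator_pos[of "\<kappa>\<^sup>2" t] assms by (simp add: W_def c_def s_def)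
  have 2: "1 + u\<^sup>2 = W / D\<^sup>2"
    using D stretched_angle_aux[OF cs, of \<kappa>] by (simp add: W_def u_def D_def[symmetric] power_divide add_divide_eq_iff divide_simps)
  define N' D' where "N' = (\<kappa> - 1) * (c * c - s * s)" and "D' = 2 * (\<kappa> - 1) * s * c"
  have dN: "((\<lambda>t. (\<kappa> - 1) * sin t * cos t) has_real_derivative N') (at t)"
    unfolding N'_def c_def s_def by (auto intro!: derivative_eq_intros simp: algebra_simps)
  have dD: "((\<lambda>t. (cos t)\<^sup>2 + \<kappa> * (sin t)\<^sup>2) has_real_derivative D') (at t)"
    unfolding D'_def c_def s_def by (auto intro!: derivative_eq_intros simp: algebra_simps)
  have du: "((\<lambda>t. (\<kappa> - 1) * sin t * cos t / ((cos t)\<^sup>2 + \<kappa> * (sin t)\<^sup>2)) has_real_derivative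
      (N' * D - (\<kappa> - 1) * s * c * D') / (D * D)) (at t)"
    using DERIV_divide[OF dN dD] D by (simp add: D_def c_def s_def)
  have "(stretched_angle \<kappa> has_real_derivative 1 + inverse (1 + u\<^sup>2) * ((N' * D - (\<kappa> - 1) * s * c * D') / (D * D))) (at t)"
    unfolding stretched_angle_def[abs_def]
    using DERIV_add[OF DERIV_ident DERIV_chain2[OF DERIV_arctan du]] by (simp add: u_def D_def c_def s_def)
  moreover have "N' * D - (\<kappa> - 1) * s * c * D' = (\<kappa> - 1) * (c\<^sup>2 - \<kappa> * s\<^sup>2) * (c\<^sup>2 + s\<^sup>2)"
    unfolding N'_def D'_def D_def by (simp add: power2_eq_square algebra_simps)
  moreover have "1 + inverse (1 + u\<^sup>2) * ((\<kappa> - 1) * (c\<^sup>2 - \<kappa> * s\<^sup>2) * (c\<^sup>2 + s\<^sup>2) / (D * D)) = \<kappa> / W"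
  proof -
    have "1 + inverse (1 + u\<^sup>2) * ((\<kappa> - 1) * (c\<^sup>2 - \<kappa> * s\<^sup>2) * (c\<^sup>2 + s\<^sup>2) / (D * D)) = (W + (\<kappa> - 1) * (c\<^sup>2 - \<kappa> * s\<^sup>2)) / W"
      unfolding 2 cs using D W by (simp add: power2_eq_square field_simps)
    also have "W + (\<kappa> - 1) * (c\<^sup>2 - \<kappa> * s\<^sup>2) = \<kappa> * (c\<^sup>2 + s\<^sup>2)"
      by (simp add: W_def power2_eq_square algebra_simps)
    finally show ?thesis using cs by simp
  qed
  ultimately show ?thesis by (simp add: W_def c_def s_def)
qed

lemma stretched_angle_0 [simp]: "stretched_angle \<kappa> 0 = 0" "stretched_angle \<kappa> pi = pi"
  by (simp_all add: stretched_angle_def)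

lemma stretched_angle_bounds: "\<bar>stretched_angle \<kappa> t - t\<bar> < pi / 2"
  unfolding stretched_angle_def using arctan_bounded[of "(\<kappa> - 1) * sin t * cos t / ((cos t)\<^sup>2 + \<kappa> * (sin t)\<^sup>2)"] by auto

text \<open>Used twice: with a constant \<open>g\<close> for the inner integral, and with the
  elliptic integrand for the outer one.\<close>

lemma stretched_angle_substitution:
  fixes g :: "real \<Rightarrow> real"
  assumes \<kappa>: "\<kappa> > 0" and g: "continuous_on UNIV g"
  shows "((\<lambda>x. g (stretched_angle \<kappa> (pi * x)) / ((cos (pi * x))\<^sup>2 + \<kappa>\<^sup>2 * (sin (pi * x))\<^sup>2))
    has_integral (integral {0..pi} g / (pi * \<kappa>))) {0..1}"
proof -
  have "((\<lambda>x. (\<kappa> / ((cos (pi * x))\<^sup>2 + \<kappa>\<^sup>2 * (sin (pi * x))\<^sup>2) * pi) *\<^sub>R g (stretched_angle \<kappa> (pi * x)))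
      has_integral (integral {stretched_angle \<kappa> (pi * 0)..stretched_angle \<kappa> (pi * 1)} g)) {0..1}"
  \<comment> \<open>The substitution rule asks for an interval containing the image; this one comes
    from \<open>stretched_angle_bounds\<close>, by which the angle is displaced by less than
    pi/2.\<close>
  proof (rule has_integral_substitution[where c = "- (pi / 2)" and d = "pi + pi / 2"])
    show "(\<lambda>x. stretched_angle \<kappa> (pi * x)) ` {0..1} \<subseteq> {- (pi / 2)..pi + pi / 2}"
    proof (rule image_subsetI)
      fix x :: real assume "x \<in> {0..1}"
      then have "0 \<le> pi * x" "pi * x \<le> pi" by (auto simp: mult_le_cancel_left1)
      then show "stretched_angle \<kappa> (pi * x) \<in> {- (pi / 2)..pi + pi / 2}"
        using stretched_angle_bounds[of \<kappa> "pi * x"] unfolding abs_less_iff atLeastAtMost_iff by linarith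
    qed
    show "continuous_on {- (pi / 2)..pi + pi / 2} g" using g continuous_on_subset by blast
    show "((\<lambda>x. stretched_angle \<kappa> (pi * x)) has_real_derivative \<kappa> / ((cos (pi * x))\<^sup>2 + \<kappa>\<^sup>2 * (sin (pi * x))\<^sup>2) * pi)
        (at x within {0..1})" for x
      by (rule DERIV_chain2[OF has_derivative_stretched_angle[OF \<kappa>]]) (auto intro!: derivative_eq_intros)
  qed auto
  then have "((\<lambda>x. (\<kappa> / ((cos (pi * x))\<^sup>2 + \<kappa>\<^sup>2 * (sin (pi * x))\<^sup>2) * pi) * g (stretched_angle \<kappa> (pi * x)))
      has_integral (integral {0..pi} g)) {0..1}" by simp
  from has_integral_divide[OF this, of "pi * \<kappa>"] show ?thesis
    using \<kappa> by (simp add: mult.commute)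
qed

section \<open>Evaluation of the double integral\<close>

lemma integral_inverse_cos_squared:
  fixes A a :: real
  assumes "A > 0"
  shows "integral {0..1} (\<lambda>y. 1 / (A + 4 * a\<^sup>2 * (cos (pi * y))\<^sup>2)) = 1 / sqrt (A * (A + 4 * a\<^sup>2))"
proof -
  \<comment> \<open>Chosen so that A + 4 a^2 cos^2 = A sin^2 + B cos^2 = B (cos^2 + \<kappa>^2
    sin^2), the denominator produced by the substitution.\<close>
  define B \<kappa> where "B = A + 4 * a\<^sup>2" and "\<kappa> = sqrt (A / B)"
  have B: "B > 0" using assms by (simp add: B_def add_pos_nonneg)
  have \<kappa>: "\<kappa> > 0" "\<kappa>\<^sup>2 = A / B" using assms B by (simp_all add: \<kappa>_def)
  have eq: "(1 / B) * (1 / ((cos (pi * y))\<^sup>2 + \<kappa>\<^sup>2 * (sin (pi * y))\<^sup>2)) = 1 / (A + 4 * a\<^sup>2 * (cos (pi * y))\<^sup>2)" for y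
  proof -
    have "B * ((cos (pi * y))\<^sup>2 + \<kappa>\<^sup>2 * (sin (pi * y))\<^sup>2) = B * (cos (pi * y))\<^sup>2 + A * (sin (pi * y))\<^sup>2"
      unfolding \<kappa>(2) using B by (simp add: distrib_left)
    also have "\<dots> = A * ((sin (pi * y))\<^sup>2 + (cos (pi * y))\<^sup>2) + 4 * a\<^sup>2 * (cos (pi * y))\<^sup>2"
      unfolding B_def by (simp only: distrib_left distrib_right add_ac)
    also have "\<dots> = A + 4 * a\<^sup>2 * (cos (pi * y))\<^sup>2" by (simp only: sin_cos_squared_add mult_1_right)
    finally show ?thesis by (simp flip: times_divide_times_eq)
  qed
  have "integral {0..pi} (\<lambda>_. 1 :: real) = pi" using pi_ge_zero by simp
  with stretched_angle_substitution[OF \<kappa>(1), of "\<lambda>_. 1"]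
  have "((\<lambda>y. 1 / ((cos (pi * y))\<^sup>2 + \<kappa>\<^sup>2 * (sin (pi * y))\<^sup>2)) has_integral (1 / \<kappa>)) {0..1}" by simp
  from has_integral_mult_right[OF this, of "1 / B"]
  have "((\<lambda>y. 1 / (A + 4 * a\<^sup>2 * (cos (pi * y))\<^sup>2)) has_integral (1 / B * (1 / \<kappa>))) {0..1}"
    unfolding eq .
  then have "integral {0..1} (\<lambda>y. 1 / (A + 4 * a\<^sup>2 * (cos (pi * y))\<^sup>2)) = 1 / B * (1 / \<kappa>)"
    by (rule integral_unique)
  also have "1 / B * (1 / \<kappa>) = 1 / sqrt (A * B)"
  proof -
    have "B * \<kappa> = sqrt (B\<^sup>2 * (A / B))"
      unfolding real_sqrt_mult \<kappa>_def using B by simp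
    also have "B\<^sup>2 * (A / B) = A * B" using B by (simp add: power2_eq_square)
    finally show ?thesis by simp
  qed
  finally show ?thesis by (simp add: B_def)
qed

text \<open>A shift by pi/2 turns the cosine into a sine on a symmetric interval, and evenness
  contributes the factor 2.\<close>

lemma elliptic_K_eq_integral_cos:
  assumes "k\<^sup>2 < 1"
  shows "integral {0..pi} (\<lambda>t. 1 / sqrt (1 - k\<^sup>2 * (cos t)\<^sup>2)) = 2 * elliptic_K k"
proof -
  define f where "f t = 1 / sqrt (1 - k\<^sup>2 * (sin t)\<^sup>2)" for t
  have pos: "1 - k\<^sup>2 * (sin t)\<^sup>2 > 0" for t
  proof -
    have "k\<^sup>2 * (sin t)\<^sup>2 \<le> k\<^sup>2 * 1" by (intro mult_left_mono) (auto simp: abs_square_le_1)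
    then show ?thesis using assms by simp
  qed
  have "sqrt (1 - k\<^sup>2 * (sin t)\<^sup>2) \<noteq> 0" for t using pos[of t] by simp
  then have cont: "continuous_on X f" for X unfolding f_def by (intro continuous_intros) auto
  have eq: "(\<lambda>t. 1 / sqrt (1 - k\<^sup>2 * (cos t)\<^sup>2)) = f \<circ> (\<lambda>t. t + - (pi / 2))"
    by (auto simp: f_def sin_diff)
  have "integral {0..pi} (\<lambda>t. 1 / sqrt (1 - k\<^sup>2 * (cos t)\<^sup>2)) = integral {0 + - (pi / 2)..pi + - (pi / 2)} f"
    unfolding eq by (rule integral_shift[OF cont])
  also have "\<dots> = integral {- (pi / 2)..pi / 2} f" by simp
  also have "\<dots> = integral {- (pi / 2)..0} f + integral {0..pi / 2} f"
    using pi_ge_zero by (intro Henstock_Kurzweil_Integration.integral_combine[symmetric] integrable_continuous_real cont) auto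
  also have "integral {- (pi / 2)..0} f = integral {0..pi / 2} f"
  proof -
    have "(\<lambda>x. f (- x)) = f" by (auto simp: f_def)
    then show ?thesis
      using Henstock_Kurzweil_Integration.integral_reflect_real[of "pi / 2" 0 f] by simp
  qed
  finally show ?thesis unfolding elliptic_K_def f_def[abs_def] by simp
qed

lemma integral_inverse_dispersion:
  fixes a b z k :: real
  assumes a: "a > 0" and b: "b > 0" and z: "z > 0"
    and k: "k = 4 * a * b / sqrt ((4 * a\<^sup>2 + z\<^sup>2) * (4 * b\<^sup>2 + z\<^sup>2))"
  shows "integral {0..1} (\<lambda>x. integral {0..1} (\<lambda>y. 1 / dispersion a b z x y)) =
    k * elliptic_K k / (2 * pi * a * b)"
proof -
  \<comment> \<open>With this \<kappa> the quantity \<open>A\<close> left by the inner integral is Q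
    cos^2 + z^2 sin^2 = Q (cos^2 + \<kappa>^2 sin^2), so the same substitution applies to the outer
    variable.\<close>
  define P Q \<kappa> where "P = 4 * a\<^sup>2 + z\<^sup>2" and "Q = 4 * b\<^sup>2 + z\<^sup>2" and "\<kappa> = z / sqrt Q"
  have PQ: "P > 0" "Q > 0" using a b z by (auto simp: P_def Q_def intro!: add_pos_pos)
  have \<kappa>: "\<kappa> > 0" "\<kappa>\<^sup>2 = z\<^sup>2 / Q" using PQ z by (simp_all add: \<kappa>_def power_divide)
  have k': "k = 4 * a * b / sqrt (P * Q)" using k by (simp add: P_def Q_def)
  have k2: "k\<^sup>2 = 16 * a\<^sup>2 * b\<^sup>2 / (P * Q)"
    unfolding k' using PQ by (simp add: power_divide power_mult_distrib)
  have PQ_eq: "P * Q = z\<^sup>2 * (z\<^sup>2 + 4 * a\<^sup>2 + 4 * b\<^sup>2) + 16 * a\<^sup>2 * b\<^sup>2"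
    by (simp add: P_def Q_def algebra_simps)
  have "16 * a\<^sup>2 * b\<^sup>2 < P * Q" unfolding PQ_eq using z a b by (simp add: add_pos_pos)
  then have k_less: "k\<^sup>2 < 1" unfolding k2 using PQ by simp
  define g where "g t = 1 / sqrt (1 - k\<^sup>2 * (cos t)\<^sup>2)" for t
  have gpos: "1 - k\<^sup>2 * (cos t)\<^sup>2 > 0" for t
  proof -
    have "k\<^sup>2 * (cos t)\<^sup>2 \<le> k\<^sup>2 * 1" by (intro mult_left_mono) (auto simp: abs_square_le_1)
    then show ?thesis using k_less by simp
  qed
  have "sqrt (1 - k\<^sup>2 * (cos t)\<^sup>2) \<noteq> 0" for t using gpos[of t] by simp
  then have cont: "continuous_on UNIV g" unfolding g_def by (intro continuous_intros) auto
  have inner: "integral {0..1} (\<lambda>y. 1 / dispersion a b z x y) =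
      \<kappa> / sqrt (P * Q) * (g (stretched_angle \<kappa> (pi * x)) / ((cos (pi * x))\<^sup>2 + \<kappa>\<^sup>2 * (sin (pi * x))\<^sup>2))" for x
  proof -
    define c s W where "c = (cos (pi * x))\<^sup>2" and "s = (sin (pi * x))\<^sup>2" and "W = c + \<kappa>\<^sup>2 * s"
    have cs: "s = 1 - c" by (simp add: c_def s_def sin_squared_eq)
    have W: "W > 0" using stretched_denominator_pos[of "\<kappa>\<^sup>2" "pi * x"] \<kappa>(1) by (simp add: W_def c_def s_def)
    define A where "A = z\<^sup>2 + 4 * b\<^sup>2 * c"
    have A: "A > 0" using z by (auto simp: A_def c_def intro!: add_pos_nonneg)
    have AW: "A = Q * W"
      unfolding W_def \<kappa>(2) cs A_def using PQ by (simp add: Q_def field_simps)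
    have cosW: "(cos (stretched_angle \<kappa> (pi * x)))\<^sup>2 = c / W"
      using cos_stretched_angle_squared[OF \<kappa>(1)] by (simp add: W_def c_def s_def)
    define R where "R = 1 - k\<^sup>2 * (c / W)"
    have R: "R > 0" using gpos[of "stretched_angle \<kappa> (pi * x)"] by (simp add: R_def cosW)
    \<comment> \<open>The modulus originates here: P A - 16 a^2 b^2 c equals z^2 (A + 4 a^2), and
      pulling out P Q W leaves 1 - k^2 c/W, where c/W is the squared cosine of the new
      angle.\<close>
    have zA: "z\<^sup>2 * (A + 4 * a\<^sup>2) = P * Q * W * R"
    proof -
      have "P * Q * W * R = P * Q * W - 16 * a\<^sup>2 * b\<^sup>2 * c"
        unfolding R_def k2 using PQ W by (simp add: field_simps)
      moreover have "P * Q * W = P * A" by (simp add: AW)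
      moreover have "P * A - 16 * a\<^sup>2 * b\<^sup>2 * c = z\<^sup>2 * (A + 4 * a\<^sup>2)"
        by (simp add: A_def P_def algebra_simps)
      ultimately show ?thesis by linarith
    qed
    have "A * (A + 4 * a\<^sup>2) = A * (z\<^sup>2 * (A + 4 * a\<^sup>2)) / z\<^sup>2" using z by simp
    also have "\<dots> = (P * Q) * Q * W\<^sup>2 * R / z\<^sup>2"
      unfolding zA unfolding AW by (simp add: power2_eq_square mult_ac)
    also have "\<dots> = (P * Q) * W\<^sup>2 * R / \<kappa>\<^sup>2"
      unfolding \<kappa>(2) using PQ z by (simp add: field_simps)
    finally have sq: "sqrt (A * (A + 4 * a\<^sup>2)) = sqrt (P * Q) * W * sqrt R / \<kappa>"
      using W \<kappa>(1) by (simp add: real_sqrt_mult real_sqrt_divide)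
    have "1 / sqrt (A * (A + 4 * a\<^sup>2)) = \<kappa> / sqrt (P * Q) * (1 / sqrt R / W)"
      unfolding sq by (simp add: mult_ac)
    moreover have "integral {0..1} (\<lambda>y. 1 / dispersion a b z x y) = 1 / sqrt (A * (A + 4 * a\<^sup>2))"
      using integral_inverse_cos_squared[OF A, of a] by (simp add: dispersion_def A_def c_def)
    ultimately show ?thesis by (simp add: g_def cosW R_def W_def c_def s_def)
  qed
  have "((\<lambda>x. integral {0..1} (\<lambda>y. 1 / dispersion a b z x y)) has_integral
      \<kappa> / sqrt (P * Q) * (integral {0..pi} g / (pi * \<kappa>))) {0..1}"
    unfolding inner using has_integral_mult_right[OF stretched_angle_substitution[OF \<kappa>(1) cont], of "\<kappa> / sqrt (P * Q)"] by simp
  then have "integral {0..1} (\<lambda>x. integral {0..1} (\<lambda>y. 1 / dispersion a b z x y)) =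
      \<kappa> / sqrt (P * Q) * (integral {0..pi} g / (pi * \<kappa>))"
    by (rule integral_unique)
  also have "integral {0..pi} g = 2 * elliptic_K k"
    using elliptic_K_eq_integral_cos[OF k_less] by (simp add: g_def[abs_def])
  also have "\<kappa> / sqrt (P * Q) * (2 * elliptic_K k / (pi * \<kappa>)) = k * elliptic_K k / (2 * pi * a * b)"
    using \<kappa>(1) PQ a b unfolding k' by (simp add: field_simps)
  finally show ?thesis .
qed

section \<open>Identification of the free energy and the monopole density\<close>

lemma grid_eigenvalue_eq_dispersion:
  "grid_eigenvalue m n a b z (k, l) = dispersion a b z (real k / real (m + 1)) (real l / real (n + 1))"
  by (simp add: grid_eigenvalue_def dispersion_def)

lemma finite_free_energy_tendsto:
  assumes "z > 0"
  shows "(finite_free_energy a b z \<longlongrightarrow> energy_integral a b z) both_even_to_infinity"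
proof (rule tendsto_mono)
  show "both_even_to_infinity \<le> at_top \<times>\<^sub>F at_top" by (simp add: both_even_to_infinity_def)
  have "finite_free_energy a b z = (\<lambda>p. (case p of (m, n) \<Rightarrow> (\<Sum>k=1..m. \<Sum>l=1..n.
      ln (dispersion a b z (real k / real (m + 1)) (real l / real (n + 1)))) / (real m * real n)) / 2)"
    unfolding finite_free_energy_def
    by (auto simp: ln_partition_function_grid[OF assms] grid_eigenvalue_eq_dispersion)
  then show "(finite_free_energy a b z \<longlongrightarrow> energy_integral a b z) (at_top \<times>\<^sub>F at_top)"
    unfolding energy_integral_def
    using riemann_sum_2D[OF continuous_on_ln_dispersion[OF assms, of _ a b]] by (simp only:) (intro tendsto_intros, auto)
qed

lemma free_energy_eq_integral:
  assumes "z > 0"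
  shows "free_energy a b z = energy_integral a b z"
  unfolding free_energy_def
  by (rule tendsto_Lim[OF both_even_to_infinity_neq_bot finite_free_energy_tendsto[OF assms]])

lemma has_derivative_free_energy:
  assumes "a > 0" and "b > 0" and "z > 0"
    and "k = 4 * a * b / sqrt ((4 * a\<^sup>2 + z\<^sup>2) * (4 * b\<^sup>2 + z\<^sup>2))"
  shows "(free_energy a b has_real_derivative z * (k * elliptic_K k / (2 * pi * a * b))) (at z)"
  \<comment> \<open>The free energy is identified with the integral for positive vertex weight, so
    the derivative is transferred on the open half-line.\<close>
  by (rule has_field_derivative_transform_within_open[where S = "{0<..}",
        OF has_derivative_energy_integral[OF assms(3), of a b, unfolded integral_inverse_dispersion[OF assms]]])
     (use assms(3) free_energy_eq_integral in auto)

text \<open>\<open>ln\<close>, \<open>Lim\<close> and \<open>deriv\<close> are total functions, so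
  the formula alone would not show that they denote genuine values. Positivity, convergence and
  differentiability are therefore asserted alongside it.\<close>

theorem mainTheorem7:
  fixes a b z k :: real
  assumes "a > 0" and "b > 0" and "z > 0"
    and "k = 4 * a * b / sqrt ((4 * a\<^sup>2 + z\<^sup>2) * (4 * b\<^sup>2 + z\<^sup>2))"
  shows "(\<forall>\<^sub>F (m, n) in both_even_to_infinity. partition_function (grid_graph m n a b z) > 0) \<and>
    (finite_free_energy a b z \<longlongrightarrow> free_energy a b z) both_even_to_infinity \<and>
    (\<lambda>x. free_energy a b x) differentiable (at z) \<and>
    monopole_density a b z = z\<^sup>2 * k * elliptic_K k / (2 * pi * a * b)"
proof -
  note deriv = has_derivative_free_energy[OF assms]
  have "\<forall>\<^sub>F (m, n) in both_even_to_infinity. partition_function (grid_graph m n a b z) > 0"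
    by (intro always_eventually) (auto intro: partition_function_grid_pos[OF assms(3)])
  moreover have "(finite_free_energy a b z \<longlongrightarrow> free_energy a b z) both_even_to_infinity"
    using finite_free_energy_tendsto[OF assms(3)] by (simp add: free_energy_eq_integral[OF assms(3)])
  moreover have "(\<lambda>x. free_energy a b x) differentiable (at z)"
    using deriv real_differentiable_def by blast
  moreover have "monopole_density a b z = z\<^sup>2 * k * elliptic_K k / (2 * pi * a * b)"
    using DERIV_imp_deriv[OF deriv] by (simp add: monopole_density_def power2_eq_square)
  ultimately show ?thesis by blast
qed

end
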